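(* Let $E\to M$ be a vector bundle. There exists a 1-to-1 correspondence between equivalence classes of homological vector fields $$\partial\in\mathrm{Der}_1(\mathrm{D}^\bullet(E),\pitchfork),\qquad \partial^2=0,$$ and Loday algebroid structures on $E$.
   Context: All objects are smooth. **Loday algebroid.** A Loday bracket is an $\mathbb R$-bilinear bracket with $[x,[y,z]]=[[x,y],z]+[y,[x,z]]$. A bilinear map $B$ on $\mathrm{Sec}(E)$ is a bidifferential operator of total degree $\le1$ if $\delta_i(f)\delta_j(g)B=0$ for all $f,g\in C^\infty(M)$, $i,j\in\{1,2\}$, where $\delta_i(f)B$ is $B$ with its $i$-th argument multiplied by $f$, minus $fB$. A Loday algebroid structure on $E$ is a Loday bracket on $\mathrm{Sec}(E)$ which is a bidifferential operator of total degree $\le1$ and such that for each $X$ the operator $[X,\cdot]$ is a derivative endomorphism, i.e. for every $f$ there is $\widehat f\in C^\infty(M)$ with $[X,fY]-f[X,Y]=\widehat fY$ for all $Y$. **Reduced shuffle algebra.** For a $k$-linear operator $D:\mathrm{Sec}(E)^{k}\to C^\infty(M)$ put $\delta_i(f)D(X_1,\dots,X_k)=D(X_1,\dots,fX_i,\dots,X_k)-fD(X_1,\dots,X_k)$. $D$ has total degree $\le m$ if every product of $m+1$ operators $\delta_{i_1}(f_1)\cdots\delta_{i_{m+1}}(f_{m+1})$ annihilates $D$; $D$ has degree $0$ in the last variable if $\delta_k(f)D=0$ for all $f$. $\mathrm{D}^k(E)$ is the space of $k$-linear multidifferential operators $\mathrm{Sec}(E)^k\to C^\infty(M)$ of degree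 $0$ in the last variable and of total degree $\le k-1$; $\mathrm{D}^0(E)=C^\infty(M)$, $\mathrm{D}^1(E)=\mathrm{Sec}(E^* )$; $\mathrm{D}^\bullet(E)=\bigoplus_{k\ge0}\mathrm{D}^k(E)$. The shuffle product of $\ell'$ of degree $p$ and $\ell''$ of degree $q$ is $$(\ell'\pitchfork\ell'')(X_1,\ldots,X_{p+q})=\sum_{\sigma\in\mathrm{Sh}(p,q)}\mathrm{sign}(\sigma)\,\ell'(X_{\sigma_1},\ldots,X_{\sigma_p})\,\ell''(X_{\sigma_{p+1}},\ldots,X_{\sigma_{p+q}}),$$ which makes $(\mathrm{D}^\bullet(E),\pitchfork)$ a graded commutative associative unital $\mathbb R$-algebra. **Homological vector fields.** A degree 1 graded derivation $\partial$ of $(\mathrm{D}^\bullet(E),\pitchfork)$ defines $\rho_\partial(X)(f)=\langle X,\partial f\rangle$ and a bracket $[\cdot,\cdot]_\partial$ on $\mathrm{Sec}(E)$ by $$\langle\mathfrak l,[X,Y]_\partial\rangle=\langle X,\partial\langle\mathfrak l,Y\rangle\rangle-\langle Y,\partial\langle\mathfrak l,X\rangle\rangle-(\partial\mathfrak l)(X,Y),\qquad \mathfrak l\in\mathrm{Sec}(E^* ).$$ $\mathrm{Der}_1(\mathrm{D}^\bullet(E),\pitchfork)$ is the space of degree 1 graded derivations $\partial$ of the reduced shuffle algebra such that for all $c\in\mathrm{D}^2(E)$ and $X_1,X_2,X_3\in\mathrm{Sec}(E)$ $$(\partial c)(X_1,X_2,X_3)=\sum_{i=1}^3(-1)^{i+1}\langle\partial(c(X_1,\ldots\hat\imath\ldots,X_3)),X_i\rangle+\sum_{i<j}(-1)^i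 c(X_1,\ldots\hat\imath\ldots,\overset{(j)}{[X_i,X_j]_\partial},\ldots,X_3),$$ where $\hat\imath$ means $X_i$ is omitted and $(j)$ means the bracket takes the place of $X_j$. A homological vector field is a $\partial\in\mathrm{Der}_1(\mathrm{D}^\bullet(E),\pitchfork)$ with $\partial^2=0$. Two homological vector fields are equivalent if they coincide on $C^\infty(M)$ and on $\mathrm{Sec}(E^* )$. *)

theory Defs
  imports "HOL-Analysis.Analysis" "HOL-Library.Function_Algebras"
begin

section \<open>Smooth maps, manifolds and vector bundles\<close>

text \<open>
  For open \<open>S\<close> in a finite-dimensional space this is the usual class \<open>C\<^sup>k\<close>: the derivative is
  \<open>C\<^sup>k\<close> iff all directional derivatives are.
\<close>

primrec Ck_on :: "nat \<Rightarrow> ('a::real_normed_vector \<Rightarrow> 'b::real_normed_vector) \<Rightarrow> 'a set \<Rightarrow> bool" where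
  "Ck_on 0 = (\<lambda>f S. continuous_on S f)"
| "Ck_on (Suc k) = (\<lambda>f S. (\<forall>x\<in>S. f differentiable (at x)) \<and>
                          (\<forall>v. Ck_on k (\<lambda>x. frechet_derivative f (at x) v) S))"

definition smooth_on :: "('a::real_normed_vector \<Rightarrow> 'b::real_normed_vector) \<Rightarrow> 'a set \<Rightarrow> bool" where
  "smooth_on f S \<longleftrightarrow> (\<forall>k. Ck_on k f S)"

text \<open>
  The model space is a finite-dimensional inner product space rather than a type of class
  \<open>euclidean_space\<close>, because the latter excludes dimension \<open>0\<close> (a Loday algebroid over a point is a
  Loday algebra). The atlas need not be maximal.
\<close>

locale smooth_manifold =
  fixes atlas :: "('m::{t2_space, second_countable_topology} set \<times> ('m \<Rightarrow> 'b::real_inner)) set"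
  assumes model_finite_dim: "\<exists>B::'b set. finite B \<and> span B = UNIV"
    and charts_cover: "(\<Union>(U, \<phi>)\<in>atlas. U) = UNIV"
    and chart_open: "(U, \<phi>) \<in> atlas \<Longrightarrow> open U \<and> open (\<phi> ` U)"
    and chart_homeomorphism: "(U, \<phi>) \<in> atlas \<Longrightarrow> homeomorphism U (\<phi> ` U) \<phi> (inv_into U \<phi>)"
    and chart_transition:
      "(U, \<phi>) \<in> atlas \<Longrightarrow> (V, \<psi>) \<in> atlas \<Longrightarrow> smooth_on (\<psi> \<circ> inv_into U \<phi>) (\<phi> ` (U \<inter> V))"
begin

definition smooth_fun_on :: "'m set \<Rightarrow> ('m \<Rightarrow> 'v::real_normed_vector) \<Rightarrow> bool" where
  "smooth_fun_on W f \<longleftrightarrow> (\<forall>(U, \<phi>)\<in>atlas. smooth_on (f \<circ> inv_into U \<phi>) (\<phi> ` (U \<inter> W)))"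

definition Cinf :: "('m \<Rightarrow> real) set" where
  "Cinf = {f. smooth_fun_on UNIV f}"

end

text \<open>
  A vector bundle is given by its fibres \<open>E p\<close> and a vector bundle atlas \<open>triv\<close>; the total space is
  \<open>{(p, v). v \<in> E p}\<close> with the smooth structure induced by \<open>triv\<close>. The type \<open>'f\<close> only provides the
  elements and the vector space operations of the fibres: it carries no topology, and any family
  of vector spaces embeds into a single one (their direct sum), so having all fibres inside \<open>'f\<close>
  loses no generality. The typical fibre \<open>'r\<close> may be \<open>0\<close>.
\<close>

locale vector_bundle = smooth_manifold atlas
  for atlas :: "('m::{t2_space, second_countable_topology} set \<times> ('m \<Rightarrow> 'b::real_inner)) set" +
  fixes E :: "'m \<Rightarrow> 'f::real_vector set"
    and triv :: "('m set \<times> ('m \<Rightarrow> 'f \<Rightarrow> 'r::real_inner)) set"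
  assumes typical_fibre_finite_dim: "\<exists>B::'r set. finite B \<and> span B = UNIV"
    and fibre_subspace: "subspace (E p)"
    and triv_cover: "(\<Union>(U, \<tau>)\<in>triv. U) = UNIV"
    and triv_open: "(U, \<tau>) \<in> triv \<Longrightarrow> open U"
    and triv_bij: "(U, \<tau>) \<in> triv \<Longrightarrow> p \<in> U \<Longrightarrow> bij_betw (\<tau> p) (E p) UNIV"
    and triv_linear: "(U, \<tau>) \<in> triv \<Longrightarrow> p \<in> U \<Longrightarrow> v \<in> E p \<Longrightarrow> w \<in> E p \<Longrightarrow>
          \<tau> p (a *\<^sub>R v + b *\<^sub>R w) = a *\<^sub>R \<tau> p v + b *\<^sub>R \<tau> p w"
    and triv_transition: "(U, \<tau>) \<in> triv \<Longrightarrow> (V, \<sigma>) \<in> triv \<Longrightarrow>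
          smooth_fun_on (U \<inter> V) (\<lambda>p. \<sigma> p (inv_into (E p) (\<tau> p) u))"


section \<open>Operators on lists of arguments\<close>

text \<open>
  A \<open>k\<close>-linear operator is a function on argument lists of length \<open>k\<close>, indexed from \<open>0\<close>. Sums,
  differences and \<open>0\<close> of functions and operators are pointwise.
\<close>

definition fmult :: "('m \<Rightarrow> real) \<Rightarrow> ('m \<Rightarrow> 'v::real_vector) \<Rightarrow> 'm \<Rightarrow> 'v" (infixr "\<odot>" 75) where
  "f \<odot> X = (\<lambda>p. f p *\<^sub>R X p)"

definition delta :: "nat \<Rightarrow> ('m \<Rightarrow> real) \<Rightarrow> (('m \<Rightarrow> 'f::real_vector) list \<Rightarrow> 'm \<Rightarrow> 'v::real_vector)
    \<Rightarrow> ('m \<Rightarrow> 'f) list \<Rightarrow> 'm \<Rightarrow> 'v" where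
  "delta i f D = (\<lambda>Xs. D (Xs[i := f \<odot> Xs ! i]) - f \<odot> D Xs)"

definition binary :: "('s \<Rightarrow> 's \<Rightarrow> 't) \<Rightarrow> 's list \<Rightarrow> 't" where
  "binary B = (\<lambda>Xs. B (Xs ! 0) (Xs ! 1))"

definition shuffles_perm :: "nat \<Rightarrow> nat \<Rightarrow> (nat \<Rightarrow> nat) set" where
  "shuffles_perm p q = {\<sigma>. \<sigma> permutes {..<p + q} \<and>
     strict_mono_on {..<p} \<sigma> \<and> strict_mono_on {p..<p + q} \<sigma>}"

text \<open>
  The sum over \<open>p\<close> extends the shuffle product bilinearly to inhomogeneous elements: an operator
  of degree \<open>p\<close> vanishes on lists of any other length, so for homogeneous factors only the term
  for their degrees survives.
\<close>

definition shuffle_prod :: "('s list \<Rightarrow> 'm \<Rightarrow> real) \<Rightarrow> ('s list \<Rightarrow> 'm \<Rightarrow> real) \<Rightarrow> 's list \<Rightarrow> 'm \<Rightarrow> real"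
    (infixl "\<bowtie>" 70) where
  "l' \<bowtie> l'' = (\<lambda>Xs x. \<Sum>p\<le>length Xs. \<Sum>\<sigma>\<in>shuffles_perm p (length Xs - p).
      of_int (sign \<sigma>) * l' (map (\<lambda>i. Xs ! \<sigma> i) [0..<p]) x
                      * l'' (map (\<lambda>i. Xs ! \<sigma> i) [p..<length Xs]) x)"


section \<open>Loday algebroids, the reduced shuffle algebra, homological vector fields\<close>

context vector_bundle
begin

definition Sec :: "('m \<Rightarrow> 'f) set" where
  "Sec = {X. (\<forall>p. X p \<in> E p) \<and> (\<forall>(U, \<tau>)\<in>triv. smooth_fun_on U (\<lambda>p. \<tau> p (X p)))}"

definition args :: "nat \<Rightarrow> ('m \<Rightarrow> 'f) list set" where
  "args k = {Xs. set Xs \<subseteq> Sec \<and> length Xs = k}"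

definition multilinear_op :: "nat \<Rightarrow> (('m \<Rightarrow> 'f) list \<Rightarrow> 'm \<Rightarrow> 'v::real_vector) \<Rightarrow> bool" where
  "multilinear_op k D \<longleftrightarrow> (\<forall>Xs\<in>args k. \<forall>i<k.
     (\<forall>Y\<in>Sec. D (Xs[i := Xs ! i + Y]) = D Xs + D (Xs[i := Y])) \<and>
     (\<forall>r. D (Xs[i := (\<lambda>_. r) \<odot> Xs ! i]) = (\<lambda>_. r) \<odot> D Xs))"

definition total_degree_le :: "nat \<Rightarrow> nat \<Rightarrow> (('m \<Rightarrow> 'f) list \<Rightarrow> 'm \<Rightarrow> 'v::real_vector) \<Rightarrow> bool" where
  "total_degree_le k m D \<longleftrightarrow>
     (\<forall>ps. length ps = Suc m \<and> set ps \<subseteq> {..<k} \<times> Cinf \<longrightarrow>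
        (\<forall>Xs\<in>args k. foldr (\<lambda>(i, f). delta i f) ps D Xs = 0))"

text \<open>Brackets are normalised to \<open>0\<close> outside \<open>Sec\<close>, so that equality of functions is equality of brackets.\<close>

definition loday_bracket :: "(('m \<Rightarrow> 'f) \<Rightarrow> ('m \<Rightarrow> 'f) \<Rightarrow> 'm \<Rightarrow> 'f) \<Rightarrow> bool" where
  "loday_bracket B \<longleftrightarrow>
     (\<forall>X Y. X \<notin> Sec \<or> Y \<notin> Sec \<longrightarrow> B X Y = 0) \<and>
     (\<forall>X\<in>Sec. \<forall>Y\<in>Sec. B X Y \<in> Sec) \<and>
     multilinear_op 2 (binary B) \<and>
     (\<forall>X\<in>Sec. \<forall>Y\<in>Sec. \<forall>Z\<in>Sec. B X (B Y Z) = B (B X Y) Z + B Y (B X Z))"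

definition loday_algebroids :: "(('m \<Rightarrow> 'f) \<Rightarrow> ('m \<Rightarrow> 'f) \<Rightarrow> 'm \<Rightarrow> 'f) set" where
  "loday_algebroids = {B. loday_bracket B \<and> total_degree_le 2 1 (binary B) \<and>
     (\<forall>X\<in>Sec. \<forall>f\<in>Cinf. \<exists>f'\<in>Cinf. \<forall>Y\<in>Sec. B X (f \<odot> Y) - f \<odot> B X Y = f' \<odot> Y)}"

text \<open>Operators of degree \<open>k\<close> are normalised to \<open>0\<close> outside \<open>args k\<close>; \<open>Dsp 0\<close> is \<open>Cinf\<close> embedded by \<open>fun_op\<close>.\<close>

definition Dsp :: "nat \<Rightarrow> (('m \<Rightarrow> 'f) list \<Rightarrow> 'm \<Rightarrow> real) set" where
  "Dsp k = {c. (\<forall>Xs. Xs \<notin> args k \<longrightarrow> c Xs = 0) \<and>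
     (\<forall>Xs\<in>args k. c Xs \<in> Cinf) \<and>
     (k > 0 \<longrightarrow> multilinear_op k c \<and> total_degree_le k (k - 1) c \<and>
        (\<forall>f\<in>Cinf. \<forall>Xs\<in>args k. delta (k - 1) f c Xs = 0))}"

text \<open>
  The direct sum, as finite sums of homogeneous operators; these have disjoint supports, so the
  sum is direct.
\<close>

definition Dtot :: "(('m \<Rightarrow> 'f) list \<Rightarrow> 'm \<Rightarrow> real) set" where
  "Dtot = {\<Sum>k<n. c k | n c. \<forall>k. c k \<in> Dsp k}"

definition fun_op :: "('m \<Rightarrow> real) \<Rightarrow> ('m \<Rightarrow> 'f) list \<Rightarrow> 'm \<Rightarrow> real" where
  "fun_op f = (\<lambda>Xs. if Xs = [] then f else 0)"

text \<open>
  Smooth sections \<open>l\<close> of the dual bundle, regarded as operators \<open>X \<mapsto> \<langle>l, X\<rangle>\<close>. Smoothness is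
  that of the coefficients with respect to the local frames of \<open>E\<close> given by \<open>triv\<close>.
\<close>

definition DualSec :: "(('m \<Rightarrow> 'f) list \<Rightarrow> 'm \<Rightarrow> real) set" where
  "DualSec = {(\<lambda>Xs. if Xs \<in> args 1 then (\<lambda>p. l p ((Xs ! 0) p)) else 0) | l :: 'm \<Rightarrow> 'f \<Rightarrow> real.
     (\<forall>p. \<forall>v\<in>E p. \<forall>w\<in>E p. \<forall>a b. l p (a *\<^sub>R v + b *\<^sub>R w) = a * l p v + b * l p w) \<and>
     (\<forall>(U, \<tau>)\<in>triv. \<forall>w. smooth_fun_on U (\<lambda>p. l p (inv_into (E p) (\<tau> p) w)))}"

text \<open>Operators on the algebra are normalised to \<open>0\<close> outside \<open>Dtot\<close>.\<close>

definition deg1_derivation ::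
  "((('m \<Rightarrow> 'f) list \<Rightarrow> 'm \<Rightarrow> real) \<Rightarrow> ('m \<Rightarrow> 'f) list \<Rightarrow> 'm \<Rightarrow> real) \<Rightarrow> bool" where
  "deg1_derivation d \<longleftrightarrow>
     (\<forall>c. c \<notin> Dtot \<longrightarrow> d c = 0) \<and>
     (\<forall>k. \<forall>c\<in>Dsp k. d c \<in> Dsp (Suc k)) \<and>
     (\<forall>c\<in>Dtot. \<forall>c'\<in>Dtot. d (c + c') = d c + d c') \<and>
     (\<forall>c\<in>Dtot. \<forall>r::real. d (\<lambda>Xs. (\<lambda>_. r) \<odot> c Xs) = (\<lambda>Xs. (\<lambda>_. r) \<odot> d c Xs)) \<and>
     (\<forall>k. \<forall>c\<in>Dsp k. \<forall>c'\<in>Dtot.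
        d (c \<bowtie> c') = d c \<bowtie> c' + (\<lambda>Xs p. (-1) ^ k * (c \<bowtie> d c') Xs p))"

definition anchor ::
  "((('m \<Rightarrow> 'f) list \<Rightarrow> 'm \<Rightarrow> real) \<Rightarrow> ('m \<Rightarrow> 'f) list \<Rightarrow> 'm \<Rightarrow> real)
     \<Rightarrow> ('m \<Rightarrow> 'f) \<Rightarrow> ('m \<Rightarrow> real) \<Rightarrow> 'm \<Rightarrow> real" where
  "anchor d X f = d (fun_op f) [X]"

definition bracket ::
  "((('m \<Rightarrow> 'f) list \<Rightarrow> 'm \<Rightarrow> real) \<Rightarrow> ('m \<Rightarrow> 'f) list \<Rightarrow> 'm \<Rightarrow> real)
     \<Rightarrow> ('m \<Rightarrow> 'f) \<Rightarrow> ('m \<Rightarrow> 'f) \<Rightarrow> 'm \<Rightarrow> 'f" where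
  "bracket d X Y =
     (if X \<in> Sec \<and> Y \<in> Sec
      then THE Z. Z \<in> Sec \<and>
        (\<forall>l\<in>DualSec. l [Z] = anchor d X (l [Y]) - anchor d Y (l [X]) - d l [X, Y])
      else 0)"

definition Der1 ::
  "((('m \<Rightarrow> 'f) list \<Rightarrow> 'm \<Rightarrow> real) \<Rightarrow> ('m \<Rightarrow> 'f) list \<Rightarrow> 'm \<Rightarrow> real) set" where
  "Der1 = {d. deg1_derivation d \<and>
     (\<forall>c\<in>Dsp 2. \<forall>X\<^sub>1\<in>Sec. \<forall>X\<^sub>2\<in>Sec. \<forall>X\<^sub>3\<in>Sec.
        d c [X\<^sub>1, X\<^sub>2, X\<^sub>3] =
          d (fun_op (c [X\<^sub>2, X\<^sub>3])) [X\<^sub>1] - d (fun_op (c [X\<^sub>1, X\<^sub>3])) [X\<^sub>2] + d (fun_op (c [X\<^sub>1, X\<^sub>2])) [X\<^sub>3]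
          - c [bracket d X\<^sub>1 X\<^sub>2, X\<^sub>3] - c [X\<^sub>2, bracket d X\<^sub>1 X\<^sub>3] + c [X\<^sub>1, bracket d X\<^sub>2 X\<^sub>3])}"

definition homological_vector_fields ::
  "((('m \<Rightarrow> 'f) list \<Rightarrow> 'm \<Rightarrow> real) \<Rightarrow> ('m \<Rightarrow> 'f) list \<Rightarrow> 'm \<Rightarrow> real) set" where
  "homological_vector_fields = {d\<in>Der1. \<forall>c\<in>Dtot. d (d c) = 0}"

definition hvf_equiv ::
  "((('m \<Rightarrow> 'f) list \<Rightarrow> 'm \<Rightarrow> real) \<Rightarrow> ('m \<Rightarrow> 'f) list \<Rightarrow> 'm \<Rightarrow> real) rel" where
  "hvf_equiv = {(d, d'). d \<in> homological_vector_fields \<and> d' \<in> homological_vector_fields \<and>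
     (\<forall>f\<in>Cinf. d (fun_op f) = d' (fun_op f)) \<and> (\<forall>l\<in>DualSec. d l = d' l)}"

end

end

theory Submission
  imports Defs
begin

text \<open>
  A homological vector field \<open>d\<close> and its bracket determine each other on generators, by
  \<open>\<langle>l, [X,Y]\<rangle> = \<rho>(X)\<langle>l, Y\<rangle> - \<rho>(Y)\<langle>l, X\<rangle> - (d l)(X, Y)\<close> with \<open>\<rho>(X) f = \<langle>X, d f\<rangle>\<close>.

  From \<open>d\<close> to the bracket. Since \<open>d\<close> is a derivation, \<open>\<rho>\<close> is an anchor and the right-hand side is
  function-linear in \<open>l\<close>, so it is the evaluation of \<open>l\<close> at a section
  (\<open>DualSec_functional_eq_section\<close>, \<open>bracket_spec\<close>). As \<open>d l\<close> has degree \<open>0\<close> in the last argument and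
  total degree at most \<open>1\<close>, the operator \<open>[X, \<cdot>]\<close> is a derivative endomorphism with symbol \<open>\<rho>(X)\<close> and
  the bracket has total degree at most \<open>1\<close>. By \<open>d (d f) = 0\<close> the anchor is a homomorphism, and then
  \<open>d (d l) = 0\<close>, where \<open>d\<close> acts on \<open>d l\<close> by the formula that is built into the class of derivations,
  is the Loday identity paired with \<open>l\<close> (\<open>bracket_jacobi\<close>).

  Equivalence. The bracket determines the anchor at every point with nonzero fibre, and at the other
  points all anchors vanish. Hence it determines \<open>d\<close> on functions and then on dual sections; the
  converse is the formula above (\<open>hvf_equiv_iff_bracket_eq\<close>).

  From the bracket to \<open>d\<close>. The vector field is the Loday coboundary operator with values in functions,
  on which sections act by \<open>\<rho>\<close> from the left and by \<open>- \<rho>\<close> from the right. Its algebra rests on the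
  commutation rules with the contraction \<open>i\<^sub>X\<close> by the first argument: \<open>i\<^sub>X\<close> is a graded derivation of
  the shuffle product (\<open>shuffle_prod_Cons\<close>), \<open>i\<^sub>Y L\<^sub>X = L\<^sub>X i\<^sub>Y - i\<^bsub>[X,Y]\<^esub>\<close> for the Lie derivative, and
  \<open>i\<^sub>X d = L\<^sub>X - d i\<^sub>X\<close>. The last two rules serve as recursive definitions of \<open>L\<close> and \<open>d\<close> on argument lists.
  Then the derivation properties of \<open>L\<^sub>X\<close> and \<open>d\<close>, the rules for \<open>[L\<^sub>X, L\<^sub>Y]\<close> and \<open>[L\<^sub>X, d]\<close>, and \<open>d\<^sup>2 = 0\<close>
  (\<open>cobd_cobd\<close>) are inductions on the list that move one contraction through both sides. What remains
  is that \<open>d\<close> preserves the reduced shuffle algebra. Linearity over functions in the last argument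
  is again an induction; the bound on the total degree is read off from the explicit sum of
  anchor and bracket terms (\<open>ann_cobd\<close>): both the anchor and the bracket raise the degree by one.

  The geometric input consists of bump functions, by which local frames yield enough global sections
  of \<open>E\<close> and of \<open>E\<^sup>*\<close>; they show that the operators of degree \<open>1\<close> are the smooth dual sections and that
  \<open>E\<close> is its own double dual.
\<close>

section \<open>Calculus of smooth maps\<close>

lemma Ck_on_Suc_D:
  assumes "Ck_on (Suc k) f S" "x \<in> S"
  shows "(f has_derivative frechet_derivative f (at x)) (at x)"
  using assms by (simp add: frechet_derivative_works[symmetric])

lemma Ck_on_subset: "Ck_on k f S \<Longrightarrow> T \<subseteq> S \<Longrightarrow> Ck_on k f T"
  by (induction k arbitrary: f) (auto intro: continuous_on_subset)

lemma Ck_on_cong: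
  assumes "open S" "\<And>x. x \<in> S \<Longrightarrow> f x = g x" "Ck_on k f S"
  shows "Ck_on k g S"
  using assms(2,3)
proof (induction k arbitrary: f g)
  case 0
  from "0.prems"(2) have "continuous_on S f" by simp
  then have "continuous_on S g"
    by (rule continuous_on_eq) (rule "0.prems"(1))
  then show ?case by simp
next
  case (Suc k)
  have D: "(g has_derivative frechet_derivative f (at x)) (at x)" if "x \<in> S" for x
    using Ck_on_Suc_D[OF Suc.prems(2) that] \<open>open S\<close> that Suc.prems(1)
    by (rule has_derivative_transform_within_open)
  have "frechet_derivative f (at x) = frechet_derivative g (at x)" if "x \<in> S" for x
    using D[OF that] by (rule frechet_derivative_at)
  then have "Ck_on k (\<lambda>x. frechet_derivative g (at x) v) S" for v
    using Suc.IH[of "\<lambda>x. frechet_derivative f (at x) v" "\<lambda>x. frechet_derivative g (at x) v"]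
      Suc.prems(2) by simp
  moreover have "\<forall>x\<in>S. g differentiable at x"
    using D unfolding differentiable_def by blast
  ultimately show ?case by simp
qed

lemma Ck_on_local:
  assumes "\<And>x. x \<in> S \<Longrightarrow> \<exists>T. open T \<and> x \<in> T \<and> Ck_on k f T"
  shows "Ck_on k f S"
  using assms
proof (induction k arbitrary: f)
  case 0
  show ?case
    unfolding Ck_on.simps
  proof (rule continuous_at_imp_continuous_on, rule ballI)
    fix x assume "x \<in> S"
    then obtain T where "open T" "x \<in> T" "continuous_on T f"
      using "0.prems" by auto
    then show "isCont f x"
      using continuous_on_eq_continuous_at by blast
  qed
next
  case (Suc k)
  have "f differentiable at x" if "x \<in> S" for x
    using Suc.prems[OF that] by auto
  moreover have "Ck_on k (\<lambda>x. frechet_derivative f (at x) v) S" for v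
  proof (rule Suc.IH)
    fix x assume "x \<in> S"
    then show "\<exists>T. open T \<and> x \<in> T \<and> Ck_on k (\<lambda>x. frechet_derivative f (at x) v) T"
      using Suc.prems[of x] by auto
  qed
  ultimately show ?case
    by auto
qed

lemma Ck_on_Suc_I:
  assumes "open S"
    and "\<And>x. x \<in> S \<Longrightarrow> (f has_derivative f' x) (at x)"
    and "\<And>v. Ck_on k (\<lambda>x. f' x v) S"
  shows "Ck_on (Suc k) f S"
proof -
  have "f' x = frechet_derivative f (at x)" if "x \<in> S" for x
    using assms(2)[OF that] by (rule frechet_derivative_at)
  then have "Ck_on k (\<lambda>x. frechet_derivative f (at x) v) S" for v
    using Ck_on_cong[OF assms(1) _ assms(3)[of v]] by simp
  then show ?thesis
    using assms(2) by (auto simp: differentiable_def)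
qed

lemma Ck_on_Suc_imp_Ck_on: "Ck_on (Suc k) f S \<Longrightarrow> Ck_on k f S"
proof (induction k arbitrary: f)
  case 0
  then have "f differentiable_on S"
    by (simp add: differentiable_at_imp_differentiable_on)
  then show ?case
    by (simp add: differentiable_imp_continuous_on)
next
  case (Suc k)
  from Suc.prems have "Ck_on (Suc k) (\<lambda>x. frechet_derivative f (at x) v) S" for v
    unfolding Ck_on.simps(2)[of "Suc k"] by blast
  then have "Ck_on k (\<lambda>x. frechet_derivative f (at x) v) S" for v
    by (rule Suc.IH)
  with Suc.prems show ?case by simp
qed

lemma Ck_on_const: "open S \<Longrightarrow> Ck_on k (\<lambda>x. c) S"
proof (induction k arbitrary: c)
  case (Suc k)
  then show ?case
    by (intro Ck_on_Suc_I[where f' = "\<lambda>x v. 0"]) (auto intro: derivative_eq_intros)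
qed (simp)

lemma Ck_on_add:
  assumes "open S"
  shows "Ck_on k f S \<Longrightarrow> Ck_on k g S \<Longrightarrow> Ck_on k (\<lambda>x. f x + g x) S"
proof (induction k arbitrary: f g)
  case 0
  then show ?case by (simp add: continuous_on_add)
next
  case (Suc k)
  show ?case
  proof (rule Ck_on_Suc_I[OF assms])
    show "((\<lambda>x. f x + g x) has_derivative
        (\<lambda>v. frechet_derivative f (at x) v + frechet_derivative g (at x) v)) (at x)" if "x \<in> S" for x
      using Suc.prems that by (intro has_derivative_add Ck_on_Suc_D)
    show "Ck_on k (\<lambda>x. frechet_derivative f (at x) v + frechet_derivative g (at x) v) S" for v
      using Suc.prems by (intro Suc.IH) auto
  qed
qed

lemma Ck_on_bilinear:
  assumes "open S" "bounded_bilinear B"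
  shows "Ck_on k f S \<Longrightarrow> Ck_on k g S \<Longrightarrow> Ck_on k (\<lambda>x. B (f x) (g x)) S"
proof (induction k arbitrary: f g)
  case 0
  then show ?case by (simp add: bounded_bilinear.continuous_on[OF assms(2)])
next
  case (Suc k)
  show ?case
  proof (rule Ck_on_Suc_I[OF assms(1)])
    show "((\<lambda>x. B (f x) (g x)) has_derivative
        (\<lambda>v. B (f x) (frechet_derivative g (at x) v) + B (frechet_derivative f (at x) v) (g x))) (at x)"
      if "x \<in> S" for x
      using Suc.prems that by (intro bounded_bilinear.FDERIV[OF assms(2)] Ck_on_Suc_D)
    show "Ck_on k (\<lambda>x. B (f x) (frechet_derivative g (at x) v) + B (frechet_derivative f (at x) v) (g x)) S"
      for v
      using Suc.prems
      by (intro Ck_on_add[OF assms(1)] Suc.IH Ck_on_Suc_imp_Ck_on[OF Suc.prems(1)]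
            Ck_on_Suc_imp_Ck_on[OF Suc.prems(2)]) auto
  qed
qed

text \<open>
  The derivative \<open>h' (f x) * D f x v\<close> of \<open>h \<circ> f\<close> is again a product of such a composition and a
  derivative of \<open>f\<close>, so the induction on the order of differentiability closes once all
  derivatives \<open>h n\<close> of \<open>h 0\<close> are treated together.
\<close>

lemma Ck_on_real_compose:
  fixes h :: "nat \<Rightarrow> real \<Rightarrow> real"
  assumes "open S"
    and deriv: "\<And>n t. (h n has_real_derivative h (Suc n) t) (at t)"
  shows "Ck_on k f S \<Longrightarrow> Ck_on k (\<lambda>x. h n (f x)) S"
proof (induction k arbitrary: n)
  case 0
  have "continuous_on UNIV (h n)"
    using deriv by (meson DERIV_isCont continuous_at_imp_continuous_on)
  then show ?case
    using 0 continuous_on_compose2[of UNIV "h n" S f] by simp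
next
  case (Suc k)
  show ?case
  proof (rule Ck_on_Suc_I[OF assms(1)])
    show "((\<lambda>x. h n (f x)) has_derivative
        (\<lambda>v. h (Suc n) (f x) * frechet_derivative f (at x) v)) (at x)" if "x \<in> S" for x
      using has_derivative_compose[OF Ck_on_Suc_D[OF Suc.prems that], of "h n"] deriv[of n "f x"]
      by (simp add: has_field_derivative_def mult.commute)
    show "Ck_on k (\<lambda>x. h (Suc n) (f x) * frechet_derivative f (at x) v) S" for v
      using Suc.prems
      by (intro Ck_on_bilinear[OF assms(1) bounded_bilinear_mult] Suc.IH
          Ck_on_Suc_imp_Ck_on[OF Suc.prems]) auto
  qed
qed

lemma smooth_on_subset: "smooth_on f S \<Longrightarrow> T \<subseteq> S \<Longrightarrow> smooth_on f T"
  unfolding smooth_on_def using Ck_on_subset by blast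

lemma smooth_on_cong:
  assumes "open S" "\<And>x. x \<in> S \<Longrightarrow> f x = g x" "smooth_on f S"
  shows "smooth_on g S"
  unfolding smooth_on_def
proof
  show "Ck_on k g S" for k
    by (rule Ck_on_cong[of S f]) (use assms in \<open>auto simp: smooth_on_def\<close>)
qed

lemma smooth_on_local:
  assumes "\<And>x. x \<in> S \<Longrightarrow> \<exists>T. open T \<and> x \<in> T \<and> smooth_on f T"
  shows "smooth_on f S"
  unfolding smooth_on_def
proof
  show "Ck_on k f S" for k
    by (rule Ck_on_local) (use assms smooth_on_def in blast)
qed

lemma smooth_on_const: "open S \<Longrightarrow> smooth_on (\<lambda>x. c) S"
  by (simp add: smooth_on_def Ck_on_const)

lemma smooth_on_add: "open S \<Longrightarrow> smooth_on f S \<Longrightarrow> smooth_on g S \<Longrightarrow> smooth_on (\<lambda>x. f x + g x) S"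
  by (simp add: smooth_on_def Ck_on_add)

lemma smooth_on_bilinear:
  "open S \<Longrightarrow> bounded_bilinear B \<Longrightarrow> smooth_on f S \<Longrightarrow> smooth_on g S \<Longrightarrow>
     smooth_on (\<lambda>x. B (f x) (g x)) S"
  by (simp add: smooth_on_def Ck_on_bilinear)

lemma smooth_on_real_compose:
  fixes h :: "nat \<Rightarrow> real \<Rightarrow> real"
  assumes "open S" "\<And>n t. (h n has_real_derivative h (Suc n) t) (at t)" "smooth_on f S"
  shows "smooth_on (\<lambda>x. h n (f x)) S"
  unfolding smooth_on_def
proof
  show "Ck_on k (\<lambda>x. h n (f x)) S" for k
    by (rule Ck_on_real_compose[where h = h, OF assms(1,2)]) (use assms(3) smooth_on_def in blast)
qed

subsection \<open>A flat function and a plateau\<close>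

text \<open>
  The functions \<open>p (1/t) * exp (-1/t)\<close> (extended by \<open>0\<close> to \<open>t \<le> 0\<close>), for polynomials \<open>p\<close>, are closed
  under differentiation; the case \<open>p = 1\<close> is the usual flat function.
\<close>

definition flat :: "real poly \<Rightarrow> real \<Rightarrow> real" where
  "flat p t = (if t > 0 then poly p (1/t) * exp (- (1/t)) else 0)"

lemma poly_times_exp_tendsto_0: "((\<lambda>x::real. poly p x * exp (- x)) \<longlongrightarrow> 0) at_top"
proof -
  have "((\<lambda>x::real. \<Sum>i\<le>degree p. coeff p i * (x ^ i / exp x)) \<longlongrightarrow> (\<Sum>i\<le>degree p. coeff p i * 0)) at_top"
    by (intro tendsto_intros tendsto_power_div_exp_0)
  then show ?thesis
    by (simp add: poly_altdef sum_distrib_right exp_minus divide_inverse mult.assoc)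
qed

text \<open>
  At \<open>0\<close> both one-sided limits of the difference quotient vanish, since \<open>exp\<close> beats the polynomial
  \<open>x * p x\<close> at \<open>x = 1/t\<close>.
\<close>

lemma flat_deriv:
  "(flat p has_real_derivative flat ([:0, 0, 1:] * (p - pderiv p)) t) (at t)"
proof (cases "t = 0")
  case False
  show ?thesis
  proof (cases "t > 0")
    case True
    have "((\<lambda>t. poly p (1/t) * exp (- (1/t))) has_real_derivative
        poly ([:0, 0, 1:] * (p - pderiv p)) (1/t) * exp (- (1/t))) (at t)"
      using True
      by (auto intro!: derivative_eq_intros simp: field_simps power2_eq_square)
    moreover have "\<forall>\<^sub>F x in nhds t. flat p x = poly p (1/x) * exp (- (1/x))"
      using eventually_nhds_in_open[of "{0<..}" t] True
      by (auto elim!: eventually_mono simp: flat_def)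
    ultimately show ?thesis
      using True by (simp add: flat_def DERIV_cong_ev)
  next
    case False
    then have "t < 0" using \<open>t \<noteq> 0\<close> by simp
    then have "\<forall>\<^sub>F x in nhds t. flat p x = 0"
      using eventually_nhds_in_open[of "{..<0}" t] by (auto elim!: eventually_mono simp: flat_def)
    then show ?thesis
      using \<open>t < 0\<close> by (simp add: flat_def DERIV_cong_ev)
  qed
next
  case True
  have "((\<lambda>h. flat p h / h) \<longlongrightarrow> 0) (at_right 0)"
  proof -
    have "((\<lambda>h. poly ([:0, 1:] * p) (inverse h) * exp (- inverse h)) \<longlongrightarrow> 0) (at_right 0)"
      by (rule filterlim_compose[OF poly_times_exp_tendsto_0 filterlim_inverse_at_top_right])
    then show ?thesis
      by (rule Lim_transform_eventually)
        (auto simp: eventually_at_right_field flat_def field_simps intro!: exI[of _ 1])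
  qed
  moreover have "((\<lambda>h. flat p h / h) \<longlongrightarrow> 0) (at_left 0)"
    by (rule Lim_transform_eventually[of "\<lambda>_. 0"])
      (auto simp: eventually_at_left_field flat_def intro!: exI[of _ "-1"])
  ultimately have "((\<lambda>h. flat p h / h) \<longlongrightarrow> 0) (at 0)"
    by (simp add: filterlim_split_at_real)
  then show ?thesis
    using True by (simp add: DERIV_def flat_def)
qed

lemma smooth_on_flat:
  assumes "open S" "smooth_on f S"
  shows "smooth_on (\<lambda>x. flat p (f x)) S"
proof -
  let ?step = "\<lambda>p. [:0, 0, 1:] * (p - pderiv p)"
  have "smooth_on (\<lambda>x. flat ((?step ^^ 0) p) (f x)) S"
    by (rule smooth_on_real_compose[where h = "\<lambda>n. flat ((?step ^^ n) p)", OF assms(1) _ assms(2)])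
      (use flat_deriv in \<open>simp\<close>)
  then show ?thesis by simp
qed

lemma flat_1_pos: "t > 0 \<Longrightarrow> flat 1 t > 0"
  and flat_1_nonpos: "t \<le> 0 \<Longrightarrow> flat 1 t = 0"
  and flat_1_mono: "0 < s \<Longrightarrow> s \<le> t \<Longrightarrow> flat 1 s \<le> flat 1 t"
  by (auto simp: flat_def field_simps)

text \<open>
  Composing the flat function with itself produces a plateau without dividing by a function: the
  inner argument \<open>1 - flat 1 (s - 1/2) / flat 1 (1/2)\<close> equals \<open>1\<close> for \<open>s \<le> 1/2\<close> and is \<open>\<le> 0\<close> for
  \<open>s \<ge> 1\<close>. Only sums and products are used, to which the closure properties of smooth maps apply.
\<close>

definition plateau :: "real \<Rightarrow> real" where
  "plateau s = flat 1 (1 + (- 1 / flat 1 (1/2)) * flat 1 (s + (-1/2))) * (1 / flat 1 1)"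

lemma plateau_eq_1: "s \<le> 1/2 \<Longrightarrow> plateau s = 1"
  using flat_1_pos[of 1] by (simp add: plateau_def flat_1_nonpos)

lemma plateau_eq_0: "s \<ge> 1 \<Longrightarrow> plateau s = 0"
  using flat_1_pos[of "1/2"] flat_1_mono[of "1/2" "s - 1/2"]
  by (simp add: plateau_def flat_1_nonpos field_simps)

lemma smooth_on_plateau:
  assumes "open S" "smooth_on f S"
  shows "smooth_on (\<lambda>x. plateau (f x)) S"
  unfolding plateau_def
  by (intro smooth_on_bilinear[OF assms(1) bounded_bilinear_mult] smooth_on_flat smooth_on_add
      smooth_on_const assms)

section \<open>Finite-dimensional inner product spaces\<close>

text \<open>
  Gram--Schmidt, by induction on the spanning set.
\<close>

lemma orthonormal_basis_exists:
  fixes S :: "'a::real_inner set"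
  assumes "finite S"
  shows "\<exists>B. finite B \<and> span B = span S \<and> (\<forall>b\<in>B. \<forall>c\<in>B. b \<bullet> c = (if b = c then 1 else 0))"
  using assms
proof (induction S)
  case empty
  then show ?case by (intro exI[of _ "{}"]) auto
next
  case (insert a S)
  then obtain B where B: "finite B" "span B = span S"
    and ON: "\<And>b c. b \<in> B \<Longrightarrow> c \<in> B \<Longrightarrow> b \<bullet> c = (if b = c then 1 else 0)"
    by blast
  \<comment> \<open>The orthogonal projection of \<open>a\<close> to the span of \<open>B\<close>.\<close>
  define v where "v = (\<Sum>b\<in>B. (a \<bullet> b) *\<^sub>R b)"
  have v_span: "v \<in> span B"
    unfolding v_def by (intro span_sum span_scale span_base)
  have v_inner: "v \<bullet> c = a \<bullet> c" if "c \<in> B" for c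
    using that B(1) by (simp add: v_def inner_sum_left ON if_distrib sum.delta cong: if_cong)
  show ?case
  proof (cases "a = v")
    case True
    then have "span (insert a S) = span B"
      using v_span B(2) by (metis span_redundant)
    then show ?thesis using B ON by blast
  next
    case False
    define e where "e = (1 / norm (a - v)) *\<^sub>R (a - v)"
    have e_inner: "e \<bullet> c = 0" "c \<bullet> e = 0" if "c \<in> B" for c
      using v_inner[OF that] by (simp_all add: e_def inner_diff_left inner_commute[of c])
    have "e \<notin> B"
      using e_inner(1)[of e] False by (auto simp: e_def)
    moreover have "e \<bullet> e = 1"
      using False by (simp add: e_def dot_square_norm power2_eq_square)
    moreover have "span (insert e B) = span (insert a S)"
    proof
      have "span B \<subseteq> span (insert a S)"
        using B(2) by (metis span_mono subset_insertI)
      then show "span (insert e B) \<subseteq> span (insert a S)"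
        using v_span unfolding e_def
        by (intro span_minimal)
          (auto intro!: span_scale span_diff intro: span_base span_superset[THEN subsetD])
      have "a = norm (a - v) *\<^sub>R e + v"
        using False by (simp add: e_def)
      also have "\<dots> \<in> span (insert e B)"
        using v_span by (intro span_add span_scale) (auto intro: span_base span_mono[THEN subsetD, of B])
      finally have "a \<in> span (insert e B)" .
      moreover have "S \<subseteq> span (insert e B)"
        using B(2) span_mono[of B "insert e B"] span_superset[of S] by blast
      ultimately show "span (insert a S) \<subseteq> span (insert e B)"
        by (intro span_minimal) auto
    qed
    ultimately show ?thesis
      using B(1) ON e_inner by (intro exI[of _ "insert e B"]) auto
  qed
qed

lemma orthonormal_expansion:
  fixes B :: "'a::real_inner set"
  assumes "finite B" "\<And>b c. b \<in> B \<Longrightarrow> c \<in> B \<Longrightarrow> b \<bullet> c = (if b = c then 1 else 0)"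
    and "x \<in> span B"
  shows "(\<Sum>b\<in>B. (x \<bullet> b) *\<^sub>R b) = x"
  using assms(3)
proof (induction rule: span_induct_alt)
  case base
  then show ?case by simp
next
  case (step c x y)
  have "(\<Sum>b\<in>B. ((c *\<^sub>R x + y) \<bullet> b) *\<^sub>R b) = c *\<^sub>R (\<Sum>b\<in>B. (x \<bullet> b) *\<^sub>R b) + (\<Sum>b\<in>B. (y \<bullet> b) *\<^sub>R b)"
    by (simp add: inner_add_left scaleR_add_left sum.distrib scaleR_sum_right)
  also have "(\<Sum>b\<in>B. (x \<bullet> b) *\<^sub>R b) = x"
    using step.hyps assms(1,2) by (simp add: if_distrib[of "\<lambda>r. r *\<^sub>R _"] sum.delta cong: if_cong)
  finally show ?case using step.IH by simp
qed

text \<open>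
  A closed ball lies in the box of vectors with bounded coordinates, which is compact as an iterated
  sum of segments.
\<close>

lemma compact_cball_finite_dim:
  fixes a :: "'a::real_inner"
  assumes "\<exists>S::'a set. finite S \<and> span S = UNIV"
  shows "compact (cball a r)"
proof -
  obtain B :: "'a set" where B: "finite B" "span B = UNIV"
    and ON: "\<And>b c. b \<in> B \<Longrightarrow> c \<in> B \<Longrightarrow> b \<bullet> c = (if b = c then 1 else 0)"
    using assms orthonormal_basis_exists by metis
  define K where "K A = {(\<Sum>b\<in>A. x b *\<^sub>R b) | x. \<forall>b\<in>A. \<bar>x b\<bar> \<le> r}" for A :: "'a set"
  have "compact (K A)" if "finite A" for A
    using that
  proof (induction A)
    case empty
    then show ?case by (simp add: K_def)
  next
    case (insert c A)
    have "K (insert c A) = {u + v | u v. u \<in> (\<lambda>t. t *\<^sub>R c) ` {-r..r} \<and> v \<in> K A}" (is "_ = ?R")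
    proof (intro equalityI subsetI)
      fix y assume "y \<in> K (insert c A)"
      then obtain x where "y = (\<Sum>b\<in>insert c A. x b *\<^sub>R b)" "\<forall>b\<in>insert c A. \<bar>x b\<bar> \<le> r"
        unfolding K_def by blast
      then have "y = x c *\<^sub>R c + (\<Sum>b\<in>A. x b *\<^sub>R b)" "x c \<in> {-r..r}"
        "(\<Sum>b\<in>A. x b *\<^sub>R b) \<in> K A"
        using insert.hyps unfolding K_def by auto
      then show "y \<in> ?R" by blast
    next
      fix y assume "y \<in> ?R"
      then obtain t x where "y = t *\<^sub>R c + (\<Sum>b\<in>A. x b *\<^sub>R b)" "\<bar>t\<bar> \<le> r" "\<forall>b\<in>A. \<bar>x b\<bar> \<le> r"
        unfolding K_def by auto
      moreover have "(\<Sum>b\<in>A. x b *\<^sub>R b) = (\<Sum>b\<in>A. (x(c := t)) b *\<^sub>R b)"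
        using insert.hyps by (intro sum.cong) auto
      ultimately show "y \<in> K (insert c A)"
        using insert.hyps unfolding K_def by (auto intro!: exI[of _ "x(c := t)"])
    qed
    moreover have "compact ((\<lambda>t. t *\<^sub>R c) ` {-r..r})"
      by (intro compact_continuous_image continuous_intros) simp
    ultimately show ?case
      using compact_sums[OF _ insert.IH] by simp
  qed
  then have "compact ((\<lambda>x. a + x) ` K B)"
    using B(1) by (intro compact_continuous_image continuous_intros) auto
  moreover have "cball a r \<subseteq> (\<lambda>x. a + x) ` K B"
  proof
    fix y assume y: "y \<in> cball a r"
    have "\<bar>(y - a) \<bullet> b\<bar> \<le> r" if "b \<in> B" for b
    proof -
      have "norm b = 1" using ON[OF that that] by (simp add: norm_eq_sqrt_inner)
      then show ?thesis
        using Cauchy_Schwarz_ineq2[of "y - a" b] y by (simp add: dist_norm norm_minus_commute)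
    qed
    moreover have "y - a = (\<Sum>b\<in>B. ((y - a) \<bullet> b) *\<^sub>R b)"
      using orthonormal_expansion[OF B(1) ON] B(2) by simp
    ultimately have "y - a \<in> K B" unfolding K_def by blast
    then have "a + (y - a) \<in> (\<lambda>x. a + x) ` K B" by (rule imageI)
    then show "y \<in> (\<lambda>x. a + x) ` K B" by simp
  qed
  ultimately show ?thesis
    using closed_Int_compact[of "cball a r"] by (metis closed_cball inf.absorb1)
qed

section \<open>Smooth functions on a manifold\<close>

context smooth_manifold
begin

lemma chart_inv [simp]: "(U, \<phi>) \<in> atlas \<Longrightarrow> p \<in> U \<Longrightarrow> inv_into U \<phi> (\<phi> p) = p"
  using chart_homeomorphism by (metis homeomorphism_apply1)

lemma chart_image_open:
  assumes "(U, \<phi>) \<in> atlas" "open W"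
  shows "open (\<phi> ` (U \<inter> W))"
proof -
  have "openin (top_of_set U) (U \<inter> W)"
    using assms(2) by auto
  then have "openin (top_of_set (\<phi> ` U)) (\<phi> ` (U \<inter> W))"
    using homeomorphism_imp_open_map[OF chart_homeomorphism[OF assms(1)]] by blast
  then show ?thesis
    using chart_open[OF assms(1)] openin_open_trans by blast
qed

lemma smooth_fun_on_subset: "smooth_fun_on W f \<Longrightarrow> V \<subseteq> W \<Longrightarrow> smooth_fun_on V f"
  unfolding smooth_fun_on_def by (fastforce elim!: smooth_on_subset)

lemma smooth_fun_on_cong:
  assumes "open W" "\<And>p. p \<in> W \<Longrightarrow> f p = g p" "smooth_fun_on W f"
  shows "smooth_fun_on W g"
  unfolding smooth_fun_on_def
proof safe
  fix U \<phi> assume U: "(U, \<phi>) \<in> atlas"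
  show "smooth_on (g \<circ> inv_into U \<phi>) (\<phi> ` (U \<inter> W))"
    by (rule smooth_on_cong[where f = "f \<circ> inv_into U \<phi>"])
      (use chart_image_open[OF U] assms U in \<open>auto simp: smooth_fun_on_def\<close>)
qed

lemma smooth_fun_on_local:
  assumes "\<And>p. p \<in> W \<Longrightarrow> \<exists>N. open N \<and> p \<in> N \<and> smooth_fun_on N f"
  shows "smooth_fun_on W f"
  unfolding smooth_fun_on_def
proof safe
  fix U \<phi> assume U: "(U, \<phi>) \<in> atlas"
  show "smooth_on (f \<circ> inv_into U \<phi>) (\<phi> ` (U \<inter> W))"
  proof (rule smooth_on_local)
    fix x assume "x \<in> \<phi> ` (U \<inter> W)"
    then obtain p where p: "p \<in> U" "p \<in> W" "x = \<phi> p" by blast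
    with assms obtain N where "open N" "p \<in> N" "smooth_fun_on N f" by blast
    then show "\<exists>T. open T \<and> x \<in> T \<and> smooth_on (f \<circ> inv_into U \<phi>) T"
      using U p chart_image_open[OF U]
      by (intro exI[of _ "\<phi> ` (U \<inter> N)"]) (auto simp: smooth_fun_on_def)
  qed
qed

lemma smooth_fun_on_const: "open W \<Longrightarrow> smooth_fun_on W (\<lambda>p. c)"
  by (auto simp: smooth_fun_on_def o_def intro!: smooth_on_const chart_image_open)

lemma smooth_fun_on_add:
  "open W \<Longrightarrow> smooth_fun_on W f \<Longrightarrow> smooth_fun_on W g \<Longrightarrow> smooth_fun_on W (\<lambda>p. f p + g p)"
  unfolding smooth_fun_on_def o_def by (fast intro!: smooth_on_add chart_image_open)

lemma smooth_fun_on_bilinear: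
  assumes "bounded_bilinear B" "open W" "smooth_fun_on W f" "smooth_fun_on W g"
  shows "smooth_fun_on W (\<lambda>p. B (f p) (g p))"
  using assms(2-4) unfolding smooth_fun_on_def o_def
  by (fast intro!: smooth_on_bilinear[OF _ assms(1)] chart_image_open)

lemma smooth_fun_on_plateau:
  "open W \<Longrightarrow> smooth_fun_on W f \<Longrightarrow> smooth_fun_on W (\<lambda>p. plateau (f p))"
  unfolding smooth_fun_on_def o_def by (fast intro!: smooth_on_plateau chart_image_open)

lemma smooth_fun_on_sum:
  assumes "open W" "\<And>i. i \<in> I \<Longrightarrow> smooth_fun_on W (f i)"
  shows "smooth_fun_on W (\<lambda>p. \<Sum>i\<in>I. f i p)"
  using assms(2)
  by (induction I rule: infinite_finite_induct)
    (auto intro!: smooth_fun_on_const smooth_fun_on_add assms(1))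

lemma smooth_fun_on_chart: "(U, \<phi>) \<in> atlas \<Longrightarrow> smooth_fun_on U \<phi>"
  unfolding smooth_fun_on_def using chart_transition by fast

text \<open>
  The support must be closed in \<open>M\<close> and not only in the chart domain, so that functions can be
  extended by \<open>0\<close>; this is where compactness of balls and the Hausdorff property enter.
\<close>

lemma bump_function_exists:
  assumes "open W" "p \<in> W"
  obtains \<eta> N C where "\<eta> \<in> Cinf" "open N" "p \<in> N" "\<And>q. q \<in> N \<Longrightarrow> \<eta> q = 1"
    "closed C" "C \<subseteq> W" "\<And>q. q \<notin> C \<Longrightarrow> \<eta> q = 0"
proof -
  obtain U \<phi> where U: "(U, \<phi>) \<in> atlas" "p \<in> U"
    using charts_cover by fast
  define a where "a = \<phi> p"
  have "open (\<phi> ` (U \<inter> W))" "a \<in> \<phi> ` (U \<inter> W)"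
    using chart_image_open[OF U(1) assms(1)] U(2) assms(2) by (auto simp: a_def)
  then obtain r where r: "r > 0" "cball a r \<subseteq> \<phi> ` (U \<inter> W)"
    using open_contains_cball by blast
  define C where "C = inv_into U \<phi> ` cball a r"
  define s where "s q = (1 / r\<^sup>2) * ((\<phi> q + - a) \<bullet> (\<phi> q + - a))" for q
  define \<eta> where "\<eta> q = (if q \<in> U then plateau (s q) else 0)" for q
  have s: "s q = (dist a (\<phi> q) / r)\<^sup>2" for q
  proof -
    have "(\<phi> q + - a) \<bullet> (\<phi> q + - a) = (dist a (\<phi> q))\<^sup>2"
      by (metis diff_conv_add_uminus dist_commute dist_norm power2_norm_eq_inner)
    then show ?thesis by (simp add: s_def power_divide)
  qed
  have "continuous_on (cball a r) (inv_into U \<phi>)"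
    using chart_homeomorphism[OF U(1)] r(2) unfolding homeomorphism_def
    by (meson Int_lower1 continuous_on_subset image_mono order_trans)
  then have "compact C"
    unfolding C_def by (intro compact_continuous_image compact_cball_finite_dim model_finite_dim)
  then have "closed C" by (rule compact_imp_closed)
  have C: "C \<subseteq> U \<inter> W"
    using r(2) U(1) by (force simp: C_def)
  have off: "\<eta> q = 0" if "q \<notin> C" for q
  proof (cases "q \<in> U")
    case True
    have "\<phi> q \<notin> cball a r"
      using that True U(1) unfolding C_def by (metis chart_inv imageI)
    then have "s q \<ge> 1"
      using r(1) by (simp add: s)
    then show ?thesis by (simp add: \<eta>_def plateau_eq_0)
  qed (simp add: \<eta>_def)
  define N where "N = U \<inter> \<phi> -` ball a (r / 2)"
  have "open U" using chart_open U(1) by blast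
  then have "open N"
    unfolding N_def using chart_homeomorphism[OF U(1)]
    by (intro continuous_open_preimage) (auto simp: homeomorphism_def)
  have "p \<in> N" using U(2) r(1) by (simp add: N_def a_def)
  have on: "\<eta> q = 1" if "q \<in> N" for q
  proof -
    have "dist a (\<phi> q) / r \<le> 1/2" using that r(1) by (simp add: N_def field_simps)
    then have "(dist a (\<phi> q) / r)\<^sup>2 \<le> (1/2)\<^sup>2"
      using r(1) by (intro power_mono) auto
    also have "(1/2::real)\<^sup>2 \<le> 1/2" by (simp add: power2_eq_square)
    finally have "s q \<le> 1/2" by (simp only: s)
    then show ?thesis using that by (simp add: \<eta>_def N_def plateau_eq_1)
  qed
  have "smooth_fun_on U (\<lambda>q. plateau (s q))"
    unfolding s_def
    by (intro smooth_fun_on_plateau smooth_fun_on_bilinear[OF bounded_bilinear_mult]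
        smooth_fun_on_bilinear[OF bounded_bilinear_inner] smooth_fun_on_add smooth_fun_on_const
        smooth_fun_on_chart U(1) \<open>open U\<close>)
  then have "smooth_fun_on U \<eta>"
    using \<open>open U\<close> smooth_fun_on_cong[of U "\<lambda>q. plateau (s q)" \<eta>] by (simp add: \<eta>_def)
  moreover have "smooth_fun_on (- C) \<eta>"
    by (rule smooth_fun_on_cong[OF _ _ smooth_fun_on_const[of _ 0]])
      (use \<open>closed C\<close> off in auto)
  ultimately have "smooth_fun_on UNIV \<eta>"
    using \<open>open U\<close> \<open>closed C\<close> C by (intro smooth_fun_on_local) (metis ComplI IntD1 open_Compl subsetD)
  then show thesis
    using that[of \<eta> N C] \<open>open N\<close> \<open>p \<in> N\<close> on off \<open>closed C\<close> C by (auto simp: Cinf_def)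
qed

text \<open>
  Extension by zero: \<open>V\<close> is covered by \<open>V \<inter> W\<close>, where \<open>f\<close> is smooth, and the complement of the closed
  support, where the extension vanishes.
\<close>

lemma smooth_fun_on_cutoff:
  assumes "\<eta> \<in> Cinf" "closed C" "C \<subseteq> W" "\<And>q. q \<notin> C \<Longrightarrow> \<eta> q = 0"
    and "open V" "open W" "smooth_fun_on (V \<inter> W) f"
  shows "smooth_fun_on V (\<lambda>q. if q \<in> W then \<eta> q *\<^sub>R f q else 0)"
proof -
  let ?g = "\<lambda>q. if q \<in> W then \<eta> q *\<^sub>R f q else 0"
  have "smooth_fun_on (V \<inter> W) (\<lambda>q. \<eta> q *\<^sub>R f q)"
    using assms smooth_fun_on_subset[of UNIV \<eta> "V \<inter> W"]
    by (intro smooth_fun_on_bilinear[OF bounded_bilinear_scaleR]) (auto simp: Cinf_def)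
  then have 1: "smooth_fun_on (V \<inter> W) ?g"
    using assms(5,6) by (elim smooth_fun_on_cong[rotated 2]) auto
  have 2: "smooth_fun_on (- C) ?g"
    by (rule smooth_fun_on_cong[OF _ _ smooth_fun_on_const[of _ 0]])
      (use assms(2,4) in auto)
  show ?thesis
  proof (rule smooth_fun_on_local)
    fix p assume "p \<in> V"
    then have "p \<in> V \<inter> W \<or> p \<in> - C" using assms(3) by blast
    then show "\<exists>N. open N \<and> p \<in> N \<and> smooth_fun_on N ?g"
      using 1 2 assms(2,5,6) by (metis open_Compl open_Int)
  qed
qed

lemma Cinf_const: "(\<lambda>_. c) \<in> Cinf"
  by (simp add: Cinf_def smooth_fun_on_const)

lemma Cinf_zero: "0 \<in> Cinf"
  using Cinf_const[of 0] by (simp add: zero_fun_def)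

lemma Cinf_add: "f \<in> Cinf \<Longrightarrow> g \<in> Cinf \<Longrightarrow> f + g \<in> Cinf"
  by (simp add: Cinf_def plus_fun_def smooth_fun_on_add)

lemma Cinf_fmult: "f \<in> Cinf \<Longrightarrow> g \<in> Cinf \<Longrightarrow> f \<odot> g \<in> Cinf"
  by (simp add: Cinf_def fmult_def smooth_fun_on_bilinear[OF bounded_bilinear_mult, simplified])

lemma Cinf_diff: "f \<in> Cinf \<Longrightarrow> g \<in> Cinf \<Longrightarrow> f - g \<in> Cinf"
proof -
  assume "f \<in> Cinf" "g \<in> Cinf"
  moreover have "f - g = f + (\<lambda>_. -1) \<odot> g"
    by (auto simp: fmult_def)
  ultimately show ?thesis
    using Cinf_add Cinf_fmult Cinf_const by metis
qed

lemma Cinf_sum: "(\<And>i. i \<in> I \<Longrightarrow> f i \<in> Cinf) \<Longrightarrow> (\<Sum>i\<in>I. f i) \<in> Cinf"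
  by (induction I rule: infinite_finite_induct) (auto intro: Cinf_zero Cinf_add)

end

section \<open>Sections, dual sections and tensoriality\<close>

lemma fmult_apply [simp]: "(f \<odot> X) p = f p *\<^sub>R X p"
  by (simp add: fmult_def)

lemma fmult_add_right: "f \<odot> (X + Y) = f \<odot> X + f \<odot> Y"
  by (auto simp: scaleR_add_right)

lemma fmult_diff_right: "f \<odot> (X - Y) = f \<odot> X - f \<odot> Y"
  by (auto simp: scaleR_diff_right)

lemma fmult_zero_right [simp]: "f \<odot> 0 = 0"
  by auto

lemma sum_fun_apply: "(\<Sum>i\<in>I. f i) p = (\<Sum>i\<in>I. f i p)"
  by (induction I rule: infinite_finite_induct) auto

context vector_bundle
begin

\<comment> \<open>The degree \<open>1\<close> is kept as a numeral, so that facts on \<open>Dsp 1\<close> and \<open>args 1\<close> stay applicable.\<close>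
declare One_nat_def [simp del]

lemma triv_inv_in: "(U, \<tau>) \<in> triv \<Longrightarrow> p \<in> U \<Longrightarrow> inv_into (E p) (\<tau> p) w \<in> E p"
  using triv_bij by (metis bij_betw_def inv_into_into UNIV_I)

lemma triv_inv_right: "(U, \<tau>) \<in> triv \<Longrightarrow> p \<in> U \<Longrightarrow> \<tau> p (inv_into (E p) (\<tau> p) w) = w"
  using triv_bij by (metis bij_betw_def f_inv_into_f UNIV_I)

lemma triv_inv_left: "(U, \<tau>) \<in> triv \<Longrightarrow> p \<in> U \<Longrightarrow> v \<in> E p \<Longrightarrow> inv_into (E p) (\<tau> p) (\<tau> p v) = v"
  using triv_bij by (metis bij_betw_def inv_into_f_f)

lemma triv_scale:
  "(U, \<tau>) \<in> triv \<Longrightarrow> p \<in> U \<Longrightarrow> v \<in> E p \<Longrightarrow> \<tau> p (a *\<^sub>R v) = a *\<^sub>R \<tau> p v"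
  using triv_linear[of U \<tau> p v v a 0] by simp

lemma triv_zero: "(U, \<tau>) \<in> triv \<Longrightarrow> p \<in> U \<Longrightarrow> \<tau> p 0 = 0"
  using triv_scale[of U \<tau> p 0 0] fibre_subspace by (simp add: subspace_0)

lemma triv_add:
  "(U, \<tau>) \<in> triv \<Longrightarrow> p \<in> U \<Longrightarrow> v \<in> E p \<Longrightarrow> w \<in> E p \<Longrightarrow> \<tau> p (v + w) = \<tau> p v + \<tau> p w"
  using triv_linear[of U \<tau> p v w 1 1] by simp

lemma triv_sum:
  assumes "(U, \<tau>) \<in> triv" "p \<in> U" "\<And>i. i \<in> I \<Longrightarrow> v i \<in> E p"
  shows "\<tau> p (\<Sum>i\<in>I. a i *\<^sub>R v i) = (\<Sum>i\<in>I. a i *\<^sub>R \<tau> p (v i))"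
  using assms(3)
proof (induction I rule: infinite_finite_induct)
  case (insert i I)
  then have "(\<Sum>j\<in>I. a j *\<^sub>R v j) \<in> E p"
    by (intro subspace_sum subspace_scale fibre_subspace) auto
  with insert show ?case
    using assms(1,2) by (simp add: triv_add triv_scale subspace_scale fibre_subspace)
qed (use assms triv_zero in auto)

lemma triv_expansion:
  assumes "(U, \<tau>) \<in> triv" "p \<in> U" "v \<in> E p"
    and "finite B" "span B = UNIV" "\<And>b c. b \<in> B \<Longrightarrow> c \<in> B \<Longrightarrow> b \<bullet> c = (if b = c then 1 else 0)"
  shows "(\<Sum>e\<in>B. (\<tau> p v \<bullet> e) *\<^sub>R inv_into (E p) (\<tau> p) e) = v"
proof -
  let ?w = "\<Sum>e\<in>B. (\<tau> p v \<bullet> e) *\<^sub>R inv_into (E p) (\<tau> p) e"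
  have "\<tau> p ?w = (\<Sum>e\<in>B. (\<tau> p v \<bullet> e) *\<^sub>R e)"
    using assms(1,2) by (simp add: triv_sum triv_inv_in triv_inv_right)
  also have "\<dots> = \<tau> p v"
    using assms(4-6) by (intro orthonormal_expansion) auto
  finally have "\<tau> p ?w = \<tau> p v" .
  moreover have "?w \<in> E p"
    using assms(1,2) by (intro subspace_sum subspace_scale fibre_subspace triv_inv_in)
  ultimately show ?thesis
    using assms(1-3) triv_inv_left by metis
qed

subsection \<open>The module of sections\<close>

lemma SecD: "X \<in> Sec \<Longrightarrow> X p \<in> E p"
  by (simp add: Sec_def)

lemma Sec_smooth: "X \<in> Sec \<Longrightarrow> (U, \<tau>) \<in> triv \<Longrightarrow> smooth_fun_on U (\<lambda>p. \<tau> p (X p))"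
  by (auto simp: Sec_def)

lemma Sec_zero: "0 \<in> Sec"
proof -
  have "smooth_fun_on U (\<lambda>p. \<tau> p (0 p))" if "(U, \<tau>) \<in> triv" for U \<tau>
    by (rule smooth_fun_on_cong[OF _ _ smooth_fun_on_const[of U 0]])
      (use that triv_zero triv_open in auto)
  then show ?thesis by (auto simp: Sec_def fibre_subspace subspace_0)
qed

lemma Sec_add:
  assumes "X \<in> Sec" "Y \<in> Sec"
  shows "X + Y \<in> Sec"
proof -
  have "smooth_fun_on U (\<lambda>p. \<tau> p ((X + Y) p))" if "(U, \<tau>) \<in> triv" for U \<tau>
    by (rule smooth_fun_on_cong[OF _ _ smooth_fun_on_add[of U "\<lambda>p. \<tau> p (X p)" "\<lambda>p. \<tau> p (Y p)"]])
      (use that triv_open triv_add assms SecD Sec_smooth in auto)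
  then show ?thesis using assms by (auto simp: Sec_def fibre_subspace subspace_add)
qed

lemma Sec_fmult:
  assumes "f \<in> Cinf" "X \<in> Sec"
  shows "f \<odot> X \<in> Sec"
proof -
  have "smooth_fun_on U (\<lambda>p. \<tau> p ((f \<odot> X) p))" if "(U, \<tau>) \<in> triv" for U \<tau>
    by (rule smooth_fun_on_cong[OF _ _ smooth_fun_on_bilinear[OF bounded_bilinear_scaleR,
            of U f "\<lambda>p. \<tau> p (X p)"]])
      (use that triv_open triv_scale assms SecD Sec_smooth smooth_fun_on_subset[of UNIV f U]
        in \<open>auto simp: Cinf_def\<close>)
  then show ?thesis using assms by (auto simp: Sec_def fibre_subspace subspace_scale)
qed

lemma Sec_diff: "X \<in> Sec \<Longrightarrow> Y \<in> Sec \<Longrightarrow> X - Y \<in> Sec"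
proof -
  assume "X \<in> Sec" "Y \<in> Sec"
  moreover have "X - Y = X + (\<lambda>_. -1) \<odot> Y"
    by auto
  ultimately show ?thesis
    using Sec_add Sec_fmult Cinf_const by metis
qed

lemma Sec_sum: "(\<And>i. i \<in> I \<Longrightarrow> X i \<in> Sec) \<Longrightarrow> (\<Sum>i\<in>I. X i) \<in> Sec"
  by (induction I rule: infinite_finite_induct) (auto intro: Sec_zero Sec_add)

lemma Sec_local:
  assumes "\<And>p. \<exists>N Y. open N \<and> p \<in> N \<and> Y \<in> Sec \<and> (\<forall>q\<in>N. X q = Y q)"
  shows "X \<in> Sec"
proof -
  have "X p \<in> E p" for p using assms[of p] SecD by metis
  moreover have "smooth_fun_on U (\<lambda>p. \<tau> p (X p))" if U: "(U, \<tau>) \<in> triv" for U \<tau>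
  proof (rule smooth_fun_on_local)
    fix p assume "p \<in> U"
    obtain N Y where N: "open N" "p \<in> N" "Y \<in> Sec" "\<And>q. q \<in> N \<Longrightarrow> X q = Y q"
      using assms[of p] by blast
    have "smooth_fun_on (U \<inter> N) (\<lambda>p. \<tau> p (X p))"
      by (rule smooth_fun_on_cong[where f = "\<lambda>p. \<tau> p (Y p)"])
        (use N U triv_open smooth_fun_on_subset[OF Sec_smooth[OF N(3) U]] in auto)
    then show "\<exists>N. open N \<and> p \<in> N \<and> smooth_fun_on N (\<lambda>p. \<tau> p (X p))"
      using \<open>p \<in> U\<close> N U triv_open by (metis IntI open_Int)
  qed
  ultimately show ?thesis by (auto simp: Sec_def)
qed

lemma cutoff_section:
  assumes "\<eta> \<in> Cinf" "closed C" "C \<subseteq> U" "\<And>q. q \<notin> C \<Longrightarrow> \<eta> q = 0" and U: "(U, \<tau>) \<in> triv"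
  shows "(\<lambda>q. if q \<in> U then \<eta> q *\<^sub>R inv_into (E q) (\<tau> q) w else 0) \<in> Sec" (is "?X \<in> Sec")
proof -
  have "smooth_fun_on V (\<lambda>q. \<sigma> q (?X q))" if V: "(V, \<sigma>) \<in> triv" for V \<sigma>
    by (rule smooth_fun_on_cong[OF _ _ smooth_fun_on_cutoff[OF assms(1-4) triv_open[OF V]
            triv_open[OF U], of "\<lambda>q. \<sigma> q (inv_into (E q) (\<tau> q) w)"]])
      (use V U triv_open triv_scale triv_zero triv_inv_in triv_transition[OF U V]
        in \<open>auto simp: Int_commute\<close>)
  then show ?thesis
    using U by (auto simp: Sec_def fibre_subspace subspace_0 subspace_scale triv_inv_in)
qed

lemma local_section:
  assumes "(U, \<tau>) \<in> triv" "p \<in> U"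
  obtains X N where "X \<in> Sec" "open N" "p \<in> N" "N \<subseteq> U" "\<And>q. q \<in> N \<Longrightarrow> X q = inv_into (E q) (\<tau> q) w"
proof -
  obtain \<eta> N C where "\<eta> \<in> Cinf" "open N" "p \<in> N" "\<And>q. q \<in> N \<Longrightarrow> \<eta> q = 1"
    "closed C" "C \<subseteq> U" "\<And>q. q \<notin> C \<Longrightarrow> \<eta> q = 0"
    using bump_function_exists[OF triv_open] assms by metis
  then show thesis
    using that[OF cutoff_section[OF _ _ _ _ assms(1)], of \<eta> C "N \<inter> U" w] assms triv_open[OF assms(1)]
    by auto
qed

lemma section_through:
  assumes "v \<in> E p"
  shows "\<exists>X\<in>Sec. X p = v"
proof -
  obtain U \<tau> where U: "(U, \<tau>) \<in> triv" "p \<in> U" using triv_cover by fast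
  then obtain X N where "X \<in> Sec" "p \<in> N" "\<And>q. q \<in> N \<Longrightarrow> X q = inv_into (E q) (\<tau> q) (\<tau> p v)"
    using local_section[OF U] by metis
  then show ?thesis using triv_inv_left U assms by metis
qed

subsection \<open>Dual sections\<close>

text \<open>
  The sections of \<open>E\<^sup>*\<close> as families of linear forms; \<open>pairing_op\<close> turns them into operators of degree \<open>1\<close>.
\<close>

definition smooth_dual :: "('m \<Rightarrow> 'f \<Rightarrow> real) \<Rightarrow> bool" where
  "smooth_dual l \<longleftrightarrow>
     (\<forall>p. \<forall>v\<in>E p. \<forall>w\<in>E p. \<forall>a b. l p (a *\<^sub>R v + b *\<^sub>R w) = a * l p v + b * l p w) \<and>
     (\<forall>(U, \<tau>)\<in>triv. \<forall>w. smooth_fun_on U (\<lambda>p. l p (inv_into (E p) (\<tau> p) w)))"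

definition pairing_op :: "('m \<Rightarrow> 'f \<Rightarrow> real) \<Rightarrow> ('m \<Rightarrow> 'f) list \<Rightarrow> 'm \<Rightarrow> real" where
  "pairing_op l = (\<lambda>Xs. if Xs \<in> args 1 then (\<lambda>p. l p ((Xs ! 0) p)) else 0)"

lemma DualSec_eq: "DualSec = pairing_op ` Collect smooth_dual"
  unfolding DualSec_def smooth_dual_def pairing_op_def by blast

lemma args_1_iff: "Xs \<in> args 1 \<longleftrightarrow> (\<exists>X\<in>Sec. Xs = [X])"
  by (auto simp: args_def length_Suc_conv One_nat_def)

lemma ball_args_1: "(\<forall>Xs\<in>args 1. P Xs) \<longleftrightarrow> (\<forall>X\<in>Sec. P [X])"
  using args_1_iff by auto

lemma pairing_op_apply: "X \<in> Sec \<Longrightarrow> pairing_op l [X] = (\<lambda>p. l p (X p))"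
  by (simp add: pairing_op_def args_def)

lemma orthonormal_frame:
  obtains B :: "'r set" where "finite B" "span B = UNIV"
    "\<And>b c. b \<in> B \<Longrightarrow> c \<in> B \<Longrightarrow> b \<bullet> c = (if b = c then 1 else 0)"
  using typical_fibre_finite_dim orthonormal_basis_exists by metis

lemma smooth_dual_sum:
  assumes "smooth_dual l" "\<And>i. i \<in> I \<Longrightarrow> v i \<in> E p"
  shows "l p (\<Sum>i\<in>I. a i *\<^sub>R v i) = (\<Sum>i\<in>I. a i * l p (v i))"
  using assms(2)
proof (induction I rule: infinite_finite_induct)
  have lin: "l p (a *\<^sub>R v + b *\<^sub>R w) = a * l p v + b * l p w" if "v \<in> E p" "w \<in> E p" for a b v w
    using assms(1) that by (auto simp: smooth_dual_def)
  have "l p 0 = 0"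
    using lin[of 0 0 0 0] fibre_subspace by (simp add: subspace_0)
  then show "\<And>I. infinite I \<Longrightarrow> l p (\<Sum>i\<in>I. a i *\<^sub>R v i) = (\<Sum>i\<in>I. a i * l p (v i))"
    "l p (\<Sum>i\<in>{}. a i *\<^sub>R v i) = (\<Sum>i\<in>{}. a i * l p (v i))" by simp_all
  fix i I assume I: "finite I" "i \<notin> I" and
    IH: "(\<And>j. j \<in> I \<Longrightarrow> v j \<in> E p) \<Longrightarrow> l p (\<Sum>i\<in>I. a i *\<^sub>R v i) = (\<Sum>i\<in>I. a i * l p (v i))" and
    v: "\<And>j. j \<in> insert i I \<Longrightarrow> v j \<in> E p"
  have "(\<Sum>j\<in>I. a j *\<^sub>R v j) \<in> E p"
    using v by (intro subspace_sum subspace_scale fibre_subspace) auto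
  then have "l p (a i *\<^sub>R v i + 1 *\<^sub>R (\<Sum>j\<in>I. a j *\<^sub>R v j)) = a i * l p (v i) + 1 * l p (\<Sum>j\<in>I. a j *\<^sub>R v j)"
    using v by (intro lin) auto
  then show "l p (\<Sum>i\<in>insert i I. a i *\<^sub>R v i) = (\<Sum>i\<in>insert i I. a i * l p (v i))"
    using I IH v by simp
qed

text \<open>
  Locally \<open>\<langle>l, X\<rangle>\<close> is the sum over a frame of the products of the coefficients of \<open>X\<close> and \<open>l\<close>.
\<close>

lemma smooth_dual_Cinf:
  assumes "smooth_dual l" "X \<in> Sec"
  shows "(\<lambda>p. l p (X p)) \<in> Cinf"
  unfolding Cinf_def mem_Collect_eq
proof (rule smooth_fun_on_local)
  fix p :: 'm
  obtain U \<tau> where U: "(U, \<tau>) \<in> triv" "p \<in> U" using triv_cover by fast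
  obtain B :: "'r set" where B: "finite B" "span B = UNIV"
    "\<And>b c. b \<in> B \<Longrightarrow> c \<in> B \<Longrightarrow> b \<bullet> c = (if b = c then 1 else 0)"
    using orthonormal_frame by blast
  have eq: "(\<Sum>e\<in>B. (\<tau> q (X q) \<bullet> e) * l q (inv_into (E q) (\<tau> q) e)) = l q (X q)" if "q \<in> U" for q
    using smooth_dual_sum[OF assms(1), of B "\<lambda>e. inv_into (E q) (\<tau> q) e" q "\<lambda>e. \<tau> q (X q) \<bullet> e"]
      triv_expansion[OF U(1) that SecD[OF assms(2)] B] triv_inv_in[OF U(1) that] by simp
  have "open U" using U triv_open by blast
  then have "smooth_fun_on U (\<lambda>q. \<Sum>e\<in>B. (\<tau> q (X q) \<bullet> e) * l q (inv_into (E q) (\<tau> q) e))"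
    using assms U
    by (intro smooth_fun_on_sum smooth_fun_on_bilinear[OF bounded_bilinear_mult]
        smooth_fun_on_bilinear[OF bounded_bilinear_inner] smooth_fun_on_const Sec_smooth)
      (auto simp: smooth_dual_def)
  then have "smooth_fun_on U (\<lambda>q. l q (X q))"
    by (rule smooth_fun_on_cong[OF \<open>open U\<close>, rotated]) (rule eq)
  then show "\<exists>N. open N \<and> p \<in> N \<and> smooth_fun_on N (\<lambda>p. l p (X p))"
    using U \<open>open U\<close> by blast
qed

lemma cutoff_smooth_dual:
  assumes "\<eta> \<in> Cinf" "closed C" "C \<subseteq> U" "\<And>q. q \<notin> C \<Longrightarrow> \<eta> q = 0" and U: "(U, \<tau>) \<in> triv"
  shows "smooth_dual (\<lambda>q v. if q \<in> U then \<eta> q *\<^sub>R (\<tau> q v \<bullet> w) else 0)"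
  unfolding smooth_dual_def
proof (intro conjI allI ballI)
  show "(if p \<in> U then \<eta> p *\<^sub>R (\<tau> p (a *\<^sub>R v + b *\<^sub>R v') \<bullet> w) else 0) =
      a * (if p \<in> U then \<eta> p *\<^sub>R (\<tau> p v \<bullet> w) else 0) + b * (if p \<in> U then \<eta> p *\<^sub>R (\<tau> p v' \<bullet> w) else 0)"
    if "v \<in> E p" "v' \<in> E p" for p v v' a b
    using that U by (simp add: triv_linear inner_add_left algebra_simps)
next
  fix V\<sigma> assume "V\<sigma> \<in> triv"
  moreover obtain V \<sigma> where "V\<sigma> = (V, \<sigma>)" by force
  ultimately have V: "(V, \<sigma>) \<in> triv" and [simp]: "V\<sigma> = (V, \<sigma>)" by simp_all
  have "smooth_fun_on V
      (\<lambda>q. if q \<in> U then \<eta> q *\<^sub>R (\<tau> q (inv_into (E q) (\<sigma> q) u) \<bullet> w) else 0)" for u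
    using triv_transition[OF V U] triv_open[OF V] triv_open[OF U]
    by (intro smooth_fun_on_cutoff[OF assms(1-4)] smooth_fun_on_bilinear[OF bounded_bilinear_inner]
        smooth_fun_on_const) auto
  then show "case V\<sigma> of (V, \<sigma>) \<Rightarrow> \<forall>u. smooth_fun_on V
      (\<lambda>q. if q \<in> U then \<eta> q *\<^sub>R (\<tau> q (inv_into (E q) (\<sigma> q) u) \<bullet> w) else 0)"
    by simp
qed

text \<open>
  A local frame, cut off by a bump function \<open>\<eta>\<close>: the squares \<open>\<eta>\<^sup>2\<close> appear since both the frame and
  the dual frame are multiplied by \<open>\<eta>\<close> in order to become global.
\<close>

lemma local_frame:
  fixes p :: 'm
  obtains \<eta> N and B :: "'r set" and s T where
    "\<eta> \<in> Cinf" "open N" "p \<in> N" "\<And>q. q \<in> N \<Longrightarrow> \<eta> q = 1" "finite B"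
    "\<And>e. e \<in> B \<Longrightarrow> s e \<in> Sec" "\<And>e. e \<in> B \<Longrightarrow> T e \<in> DualSec"
    "\<And>X. X \<in> Sec \<Longrightarrow> (\<eta> \<odot> \<eta>) \<odot> X = (\<Sum>e\<in>B. T e [X] \<odot> s e)"
    "\<And>l X. l \<in> DualSec \<Longrightarrow> X \<in> Sec \<Longrightarrow> (\<eta> \<odot> \<eta>) \<odot> l [X] = (\<Sum>e\<in>B. l [s e] \<odot> T e [X])"
proof -
  obtain U \<tau> where U: "(U, \<tau>) \<in> triv" "p \<in> U" using triv_cover by fast
  obtain \<eta> N C where \<eta>: "\<eta> \<in> Cinf" "open N" "p \<in> N" "\<And>q. q \<in> N \<Longrightarrow> \<eta> q = 1"
    "closed C" "C \<subseteq> U" "\<And>q. q \<notin> C \<Longrightarrow> \<eta> q = 0"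
    using bump_function_exists[OF triv_open] U by metis
  obtain B :: "'r set" where B: "finite B" "span B = UNIV"
    "\<And>b c. b \<in> B \<Longrightarrow> c \<in> B \<Longrightarrow> b \<bullet> c = (if b = c then 1 else 0)"
    using orthonormal_frame by blast
  define s where "s e = (\<lambda>q. if q \<in> U then \<eta> q *\<^sub>R inv_into (E q) (\<tau> q) e else 0)" for e
  define T where "T e = pairing_op (\<lambda>q v. if q \<in> U then \<eta> q *\<^sub>R (\<tau> q v \<bullet> e) else 0)" for e
  have s: "s e \<in> Sec" for e
    unfolding s_def by (rule cutoff_section[OF \<eta>(1,5,6,7) U(1)])
  have T: "T e \<in> DualSec" for e
    unfolding T_def DualSec_eq using cutoff_smooth_dual[OF \<eta>(1,5,6,7) U(1)] by blast
  have off: "\<eta> q = 0" if "q \<notin> U" for q using \<eta>(6,7) that by blast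
  show thesis
  proof (rule that[of \<eta> N B s T, OF \<eta>(1-4) B(1) s T])
    fix X assume X: "X \<in> Sec"
    show "(\<eta> \<odot> \<eta>) \<odot> X = (\<Sum>e\<in>B. T e [X] \<odot> s e)"
    proof
      fix q
      show "((\<eta> \<odot> \<eta>) \<odot> X) q = (\<Sum>e\<in>B. T e [X] \<odot> s e) q"
      proof (cases "q \<in> U")
        case True
        have "(\<Sum>e\<in>B. (\<eta> q * (\<tau> q (X q) \<bullet> e) * \<eta> q) *\<^sub>R inv_into (E q) (\<tau> q) e) =
          (\<eta> q * \<eta> q) *\<^sub>R (\<Sum>e\<in>B. (\<tau> q (X q) \<bullet> e) *\<^sub>R inv_into (E q) (\<tau> q) e)"
          by (simp add: scaleR_sum_right mult_ac)
        then show ?thesis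
          using True triv_expansion[OF U(1) True SecD[OF X] B]
          by (simp add: sum_fun_apply T_def s_def pairing_op_apply X)
      qed (simp add: off sum_fun_apply T_def s_def pairing_op_apply X)
    qed
    fix l assume "l \<in> DualSec"
    then obtain l' where l': "smooth_dual l'" "l = pairing_op l'"
      unfolding DualSec_eq by blast
    have sc: "l' q (a *\<^sub>R v) = a * l' q v" if "v \<in> E q" for q a v
      using smooth_dual_sum[OF l'(1), of "{0::nat}" "\<lambda>_. v" q "\<lambda>_. a"] that by simp
    show "(\<eta> \<odot> \<eta>) \<odot> l [X] = (\<Sum>e\<in>B. l [s e] \<odot> T e [X])"
    proof
      fix q
      show "((\<eta> \<odot> \<eta>) \<odot> l [X]) q = (\<Sum>e\<in>B. l [s e] \<odot> T e [X]) q"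
      proof (cases "q \<in> U")
        case True
        have "l' q (X q) = (\<Sum>e\<in>B. (\<tau> q (X q) \<bullet> e) * l' q (inv_into (E q) (\<tau> q) e))"
          using smooth_dual_sum[OF l'(1), of B "\<lambda>e. inv_into (E q) (\<tau> q) e" q "\<lambda>e. \<tau> q (X q) \<bullet> e"]
            triv_expansion[OF U(1) True SecD[OF X] B] triv_inv_in[OF U(1) True] by simp
        then show ?thesis
          using True s
          by (simp add: sum_fun_apply T_def pairing_op_apply X l'(2))
            (simp add: s_def sc triv_inv_in[OF U(1)] sum_distrib_left mult_ac)
      next
        case False
        then show ?thesis
          by (simp add: off sum_fun_apply T_def pairing_op_apply X)
      qed
    qed
  qed
qed

subsection \<open>Tensoriality\<close>

definition scal :: "('m \<Rightarrow> real) \<Rightarrow> (('m \<Rightarrow> 'f) list \<Rightarrow> 'm \<Rightarrow> real) \<Rightarrow> ('m \<Rightarrow> 'f) list \<Rightarrow> 'm \<Rightarrow> real" where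
  "scal f c = (\<lambda>Xs. f \<odot> c Xs)"

lemma Dsp_1_iff:
  "c \<in> Dsp 1 \<longleftrightarrow> (\<forall>Xs. Xs \<notin> args 1 \<longrightarrow> c Xs = 0) \<and> (\<forall>X\<in>Sec. c [X] \<in> Cinf) \<and>
     (\<forall>X\<in>Sec. \<forall>Y\<in>Sec. c [X + Y] = c [X] + c [Y]) \<and> (\<forall>f\<in>Cinf. \<forall>X\<in>Sec. c [f \<odot> X] = f \<odot> c [X])"
  (is "_ \<longleftrightarrow> ?R")
proof -
  note args = args_1_iff
  show ?thesis
  proof
    assume c: "c \<in> Dsp 1"
    have "c [X] \<in> Cinf" "\<forall>Y\<in>Sec. c [X + Y] = c [X] + c [Y]" "\<forall>f\<in>Cinf. c [f \<odot> X] = f \<odot> c [X]"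
      if "X \<in> Sec" for X
    proof -
      have "[X] \<in> args 1" using that by (auto simp: args)
      with c show "c [X] \<in> Cinf" "\<forall>Y\<in>Sec. c [X + Y] = c [X] + c [Y]"
        "\<forall>f\<in>Cinf. c [f \<odot> X] = f \<odot> c [X]"
        unfolding Dsp_def multilinear_op_def delta_def by force+
    qed
    then show ?R
      using c unfolding Dsp_def by blast
  next
    assume R: ?R
    have "total_degree_le 1 0 c"
      unfolding total_degree_le_def
    proof (intro allI impI ballI)
      fix ps :: "(nat \<times> ('m \<Rightarrow> real)) list" and Xs assume ps: "length ps = Suc 0 \<and> set ps \<subseteq> {..<1} \<times> Cinf" and "Xs \<in> args 1"
      then obtain f X where "ps = [(0::nat, f)]" "f \<in> Cinf" "Xs = [X]" "X \<in> Sec"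
        unfolding args by (cases ps) auto
      then show "foldr (\<lambda>(i, f). delta i f) ps c Xs = 0"
        using R by (simp add: delta_def)
    qed
    then show "c \<in> Dsp 1"
      using R Cinf_const unfolding Dsp_def multilinear_op_def ball_args_1 by (auto simp: delta_def)
  qed
qed

lemma Dsp_1_outside: "c \<in> Dsp 1 \<Longrightarrow> Xs \<notin> args 1 \<Longrightarrow> c Xs = 0"
  and Dsp_1_Cinf: "c \<in> Dsp 1 \<Longrightarrow> X \<in> Sec \<Longrightarrow> c [X] \<in> Cinf"
  and Dsp_1_add: "c \<in> Dsp 1 \<Longrightarrow> X \<in> Sec \<Longrightarrow> Y \<in> Sec \<Longrightarrow> c [X + Y] = c [X] + c [Y]"
  and Dsp_1_fmult: "c \<in> Dsp 1 \<Longrightarrow> f \<in> Cinf \<Longrightarrow> X \<in> Sec \<Longrightarrow> c [f \<odot> X] = f \<odot> c [X]"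
  unfolding Dsp_1_iff by blast+

lemma Dsp_1_sum:
  assumes "c \<in> Dsp 1" "\<And>i. i \<in> I \<Longrightarrow> X i \<in> Sec" "\<And>i. i \<in> I \<Longrightarrow> f i \<in> Cinf"
  shows "c [\<Sum>i\<in>I. f i \<odot> X i] = (\<Sum>i\<in>I. f i \<odot> c [X i])"
  using assms(2,3)
proof (induction I rule: infinite_finite_induct)
  have "c [0] = c [0] + c [0]"
    using Dsp_1_add[OF assms(1) Sec_zero Sec_zero] by simp
  then have "c [0] = 0" by simp
  then show "\<And>I. infinite I \<Longrightarrow> c [\<Sum>i\<in>I. f i \<odot> X i] = (\<Sum>i\<in>I. f i \<odot> c [X i])"
    "c [\<Sum>i\<in>{}. f i \<odot> X i] = (\<Sum>i\<in>{}. f i \<odot> c [X i])" by simp_all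
next
  case (insert i I)
  then have "(\<Sum>i\<in>I. f i \<odot> X i) \<in> Sec" "f i \<odot> X i \<in> Sec"
    by (auto intro: Sec_sum Sec_fmult)
  then have "c [f i \<odot> X i + (\<Sum>i\<in>I. f i \<odot> X i)] = c [f i \<odot> X i] + c [\<Sum>i\<in>I. f i \<odot> X i]"
    using Dsp_1_add[OF assms(1)] by blast
  moreover have "c [f i \<odot> X i] = f i \<odot> c [X i]"
    using Dsp_1_fmult[OF assms(1)] insert.prems by blast
  moreover have "c [\<Sum>i\<in>I. f i \<odot> X i] = (\<Sum>i\<in>I. f i \<odot> c [X i])"
    using insert by blast
  ultimately show ?case
    by (simp only: sum.insert[OF insert.hyps])
qed

lemma DualSec_subset_Dsp_1: "DualSec \<subseteq> Dsp 1"
proof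
  fix l assume "l \<in> DualSec"
  then obtain l' where l': "smooth_dual l'" "l = pairing_op l'"
    unfolding DualSec_eq by blast
  have "l' p (v + w) = l' p v + l' p w" if "v \<in> E p" "w \<in> E p" for p v w
    using smooth_dual_sum[OF l'(1), of "{0, 1::nat}" "\<lambda>i. if i = 0 then v else w" p "\<lambda>_. 1"] that
    by auto
  moreover have "l' p (a *\<^sub>R v) = a * l' p v" if "v \<in> E p" for p v a
    using smooth_dual_sum[OF l'(1), of "{0::nat}" "\<lambda>_. v" p "\<lambda>_. a"] that by auto
  ultimately show "l \<in> Dsp 1"
    using smooth_dual_Cinf[OF l'(1)] unfolding Dsp_1_iff l'(2)
    by (auto simp: pairing_op_apply Sec_add Sec_fmult SecD)
      (auto simp: pairing_op_def fmult_def intro: SecD)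
qed

text \<open>
  Every section is, near a point, a combination of the frame with smooth coefficients. Hence a
  function-linear functional depends on its argument pointwise only.
\<close>

lemma Dsp_1_pointwise:
  assumes "c \<in> Dsp 1" "X \<in> Sec" "Y \<in> Sec" "X p = Y p"
  shows "c [X] p = c [Y] p"
proof -
  obtain \<eta> N and B :: "'r set" and s T where
    fr: "\<eta> \<in> Cinf" "open N" "p \<in> N" "\<And>q. q \<in> N \<Longrightarrow> \<eta> q = 1" "finite B"
      "\<And>e. e \<in> B \<Longrightarrow> s e \<in> Sec" "\<And>e. e \<in> B \<Longrightarrow> T e \<in> DualSec"
      "\<And>X. X \<in> Sec \<Longrightarrow> (\<eta> \<odot> \<eta>) \<odot> X = (\<Sum>e\<in>B. T e [X] \<odot> s e)"
      "\<And>l X. l \<in> DualSec \<Longrightarrow> X \<in> Sec \<Longrightarrow> (\<eta> \<odot> \<eta>) \<odot> l [X] = (\<Sum>e\<in>B. l [s e] \<odot> T e [X])"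
    by (rule local_frame[of p]; rule that; assumption)
  have ex: "c [Z] p = (\<Sum>e\<in>B. T e [Z] p * c [s e] p)" if "Z \<in> Sec" for Z
  proof -
    have "T e [Z] \<in> Cinf" if "e \<in> B" for e
      using Dsp_1_Cinf fr(7)[OF that] DualSec_subset_Dsp_1 \<open>Z \<in> Sec\<close> by blast
    then have "c [\<Sum>e\<in>B. T e [Z] \<odot> s e] = (\<Sum>e\<in>B. T e [Z] \<odot> c [s e])"
      using fr(6) by (intro Dsp_1_sum[OF assms(1)])
    moreover have "c [(\<eta> \<odot> \<eta>) \<odot> Z] = (\<eta> \<odot> \<eta>) \<odot> c [Z]"
      using Dsp_1_fmult[OF assms(1)] that fr(1) Cinf_fmult by blast
    ultimately have "((\<eta> \<odot> \<eta>) \<odot> c [Z]) p = (\<Sum>e\<in>B. T e [Z] \<odot> c [s e]) p"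
      using fr(8)[OF that] by simp
    then show ?thesis using fr(3,4) by (simp add: sum_fun_apply)
  qed
  have "T e [X] p = T e [Y] p" if "e \<in> B" for e
    using fr(7)[OF that] assms(2-4) unfolding DualSec_eq by (auto simp: pairing_op_apply)
  then show ?thesis using ex assms(2,3) by simp
qed

text \<open>
  By pointwise dependence, \<open>l p v\<close> can be defined as the value at \<open>p\<close> on any section through \<open>v\<close>.
\<close>

lemma Dsp_1_eq_DualSec: "Dsp 1 = DualSec"
proof
  show "Dsp 1 \<subseteq> DualSec"
  proof
    fix c assume c: "c \<in> Dsp 1"
    define l where "l p v = c [SOME X. X \<in> Sec \<and> X p = v] p" for p v
    have l: "l p (X p) = c [X] p" if "X \<in> Sec" for p X
    proof -
      have "(SOME Y. Y \<in> Sec \<and> Y p = X p) \<in> Sec \<and> (SOME Y. Y \<in> Sec \<and> Y p = X p) p = X p"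
        using that by (intro someI[of "\<lambda>Y. Y \<in> Sec \<and> Y p = X p" X]) auto
      then show ?thesis
        unfolding l_def using Dsp_1_pointwise[OF c _ that] by blast
    qed
    have "l p (a *\<^sub>R v + b *\<^sub>R w) = a * l p v + b * l p w" if "v \<in> E p" "w \<in> E p" for p v w a b
    proof -
      obtain X Y where X: "X \<in> Sec" "X p = v" "Y \<in> Sec" "Y p = w"
        using section_through \<open>v \<in> E p\<close> \<open>w \<in> E p\<close> by metis
      then have "c [(\<lambda>_. a) \<odot> X + (\<lambda>_. b) \<odot> Y] = (\<lambda>_. a) \<odot> c [X] + (\<lambda>_. b) \<odot> c [Y]"
        using Dsp_1_add[OF c, of "(\<lambda>_. a) \<odot> X" "(\<lambda>_. b) \<odot> Y"] Dsp_1_fmult[OF c Cinf_const]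
          Sec_fmult[OF Cinf_const] by metis
      then show ?thesis
        using l[of "(\<lambda>_. a) \<odot> X + (\<lambda>_. b) \<odot> Y" p] l[of X p] l[of Y p] X
        by (simp add: Sec_add Sec_fmult Cinf_const)
    qed
    moreover have "smooth_fun_on U (\<lambda>p. l p (inv_into (E p) (\<tau> p) w))" if U: "(U, \<tau>) \<in> triv" for U \<tau> w
    proof (rule smooth_fun_on_local)
      fix p assume "p \<in> U"
      then obtain X N where X: "X \<in> Sec" "open N" "p \<in> N" "N \<subseteq> U"
        "\<And>q. q \<in> N \<Longrightarrow> X q = inv_into (E q) (\<tau> q) w"
        using local_section[OF U] by metis
      have "c [X] \<in> Cinf" using c X(1) by (rule Dsp_1_Cinf)
      then have "smooth_fun_on N (c [X])"
        using smooth_fun_on_subset unfolding Cinf_def by blast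
      then have "smooth_fun_on N (\<lambda>p. l p (inv_into (E p) (\<tau> p) w))"
        using smooth_fun_on_cong[OF X(2), of "c [X]" "\<lambda>p. l p (inv_into (E p) (\<tau> p) w)"] X(5) l[OF X(1)]
        by metis
      then show "\<exists>N. open N \<and> p \<in> N \<and> smooth_fun_on N (\<lambda>p. l p (inv_into (E p) (\<tau> p) w))"
        using X(2,3) by blast
    qed
    ultimately have "smooth_dual l" unfolding smooth_dual_def by blast
    moreover have "c = pairing_op l"
    proof
      fix Xs
      show "c Xs = pairing_op l Xs"
      proof (cases "Xs \<in> args 1")
        case True
        then obtain X where "Xs = [X]" "X \<in> Sec" using args_1_iff by blast
        then show ?thesis using l by (auto simp: pairing_op_apply)
      next
        case False
        then show ?thesis using Dsp_1_outside[OF c] by (simp add: pairing_op_def)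
      qed
    qed
    ultimately show "c \<in> DualSec" unfolding DualSec_eq by blast
  qed
qed (rule DualSec_subset_Dsp_1)

text \<open>
  The coefficients of a section with respect to the cut off frame are values of dual sections.
\<close>

lemma DualSec_separates:
  assumes "X \<in> Sec" "Y \<in> Sec" "\<And>l. l \<in> DualSec \<Longrightarrow> l [X] p = l [Y] p"
  shows "X p = Y p"
proof -
  obtain \<eta> N and B :: "'r set" and s T where
    fr: "\<eta> \<in> Cinf" "open N" "p \<in> N" "\<And>q. q \<in> N \<Longrightarrow> \<eta> q = 1" "finite B"
      "\<And>e. e \<in> B \<Longrightarrow> s e \<in> Sec" "\<And>e. e \<in> B \<Longrightarrow> T e \<in> DualSec"
      "\<And>X. X \<in> Sec \<Longrightarrow> (\<eta> \<odot> \<eta>) \<odot> X = (\<Sum>e\<in>B. T e [X] \<odot> s e)"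
      "\<And>l X. l \<in> DualSec \<Longrightarrow> X \<in> Sec \<Longrightarrow> (\<eta> \<odot> \<eta>) \<odot> l [X] = (\<Sum>e\<in>B. l [s e] \<odot> T e [X])"
    by (rule local_frame[of p]; rule that; assumption)
  have "T e [X] p = T e [Y] p" if "e \<in> B" for e
    using assms(3) fr(7) that by blast
  then have "((\<eta> \<odot> \<eta>) \<odot> X) p = ((\<eta> \<odot> \<eta>) \<odot> Y) p"
    by (simp only: fr(8) assms(1,2)) (simp add: sum_fun_apply)
  then show ?thesis using fr(3,4) by simp
qed

lemma scal_Dsp_1: "f \<in> Cinf \<Longrightarrow> l \<in> Dsp 1 \<Longrightarrow> scal f l \<in> Dsp 1"
  unfolding Dsp_1_iff scal_def
  by (auto simp: Cinf_fmult fmult_add_right)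

lemma add_Dsp_1: "l \<in> Dsp 1 \<Longrightarrow> l' \<in> Dsp 1 \<Longrightarrow> l + l' \<in> Dsp 1"
  unfolding Dsp_1_iff by (auto simp: Cinf_add fmult_add_right)

lemma zero_Dsp_1: "0 \<in> Dsp 1"
  unfolding Dsp_1_iff by (auto simp: Cinf_zero)

text \<open>
  The double dual: a function-linear functional on sections of \<open>E\<^sup>*\<close> is the evaluation at a section.
\<close>

lemma DualSec_functional_eq_section:
  fixes F :: "(('m \<Rightarrow> 'f) list \<Rightarrow> 'm \<Rightarrow> real) \<Rightarrow> 'm \<Rightarrow> real"
  assumes Cinf: "\<And>l. l \<in> DualSec \<Longrightarrow> F l \<in> Cinf"
    and add: "\<And>l l'. l \<in> DualSec \<Longrightarrow> l' \<in> DualSec \<Longrightarrow> F (l + l') = F l + F l'"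
    and scal: "\<And>f l. f \<in> Cinf \<Longrightarrow> l \<in> DualSec \<Longrightarrow> F (scal f l) = f \<odot> F l"
  shows "\<exists>!Z. Z \<in> Sec \<and> (\<forall>l\<in>DualSec. l [Z] = F l)"
proof -
  note D = Dsp_1_eq_DualSec[symmetric]
  have "F 0 = F 0 + F 0" using add[of 0 0] zero_Dsp_1 by (simp add: D)
  then have F0: "F 0 = 0" by simp
  have sum: "F (\<Sum>i\<in>I. scal (f i) (l i)) = (\<Sum>i\<in>I. f i \<odot> F (l i))"
    if "\<And>i. i \<in> I \<Longrightarrow> f i \<in> Cinf" "\<And>i. i \<in> I \<Longrightarrow> l i \<in> DualSec" for I :: "'r set" and f l
    using that
  proof (induction I rule: infinite_finite_induct)
    case (insert i I)
    have "(\<Sum>i\<in>J. scal (f i) (l i)) \<in> DualSec" if "J \<subseteq> insert i I" for J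
      using that insert.prems
      by (induction J rule: infinite_finite_induct)
        (auto simp: D intro!: zero_Dsp_1 add_Dsp_1 scal_Dsp_1)
    then have "F (scal (f i) (l i) + (\<Sum>i\<in>I. scal (f i) (l i))) =
        F (scal (f i) (l i)) + F (\<Sum>i\<in>I. scal (f i) (l i))"
      using insert.prems scal_Dsp_1[of "f i" "l i"] unfolding D by (intro add) (auto simp: D)
    moreover have "F (scal (f i) (l i)) = f i \<odot> F (l i)"
      using insert.prems by (intro scal) auto
    moreover have "F (\<Sum>i\<in>I. scal (f i) (l i)) = (\<Sum>i\<in>I. f i \<odot> F (l i))"
      using insert by blast
    ultimately show ?case
      by (simp only: sum.insert[OF insert.hyps])
  qed (use F0 in auto)
  have local: "\<exists>Z N. Z \<in> Sec \<and> open N \<and> p \<in> N \<and> (\<forall>l\<in>DualSec. \<forall>q\<in>N. l [Z] q = F l q)" for p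
  proof -
    obtain \<eta> N and B :: "'r set" and s T where
      fr: "\<eta> \<in> Cinf" "open N" "p \<in> N" "\<And>q. q \<in> N \<Longrightarrow> \<eta> q = 1" "finite B"
        "\<And>e. e \<in> B \<Longrightarrow> s e \<in> Sec" "\<And>e. e \<in> B \<Longrightarrow> T e \<in> DualSec"
        "\<And>X. X \<in> Sec \<Longrightarrow> (\<eta> \<odot> \<eta>) \<odot> X = (\<Sum>e\<in>B. T e [X] \<odot> s e)"
        "\<And>l X. l \<in> DualSec \<Longrightarrow> X \<in> Sec \<Longrightarrow> (\<eta> \<odot> \<eta>) \<odot> l [X] = (\<Sum>e\<in>B. l [s e] \<odot> T e [X])"
      by (rule local_frame[of p]; rule that; assumption)
    define Z where "Z = (\<Sum>e\<in>B. F (T e) \<odot> s e)"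
    have "Z \<in> Sec" unfolding Z_def using fr(6,7) by (intro Sec_sum Sec_fmult Cinf)
    moreover have "l [Z] q = F l q" if l: "l \<in> DualSec" and q: "q \<in> N" for l q
    proof -
      have ls: "l [s e] \<in> Cinf" if "e \<in> B" for e
        using l fr(6)[OF that] Dsp_1_Cinf unfolding D by blast
      have "scal (\<eta> \<odot> \<eta>) l = (\<Sum>e\<in>B. scal (l [s e]) (T e))"
      proof
        fix Xs
        show "scal (\<eta> \<odot> \<eta>) l Xs = (\<Sum>e\<in>B. scal (l [s e]) (T e)) Xs"
        proof (cases "Xs \<in> args 1")
          case True
          then obtain X where "Xs = [X]" "X \<in> Sec" using args_1_iff by blast
          then show ?thesis using fr(9)[OF l] by (simp add: scal_def sum_fun_apply)
        next
          case False
          then have "l Xs = 0" "\<And>e. e \<in> B \<Longrightarrow> T e Xs = 0"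
            using l fr(7) Dsp_1_outside unfolding D by blast+
          then show ?thesis by (simp add: scal_def sum_fun_apply)
        qed
      qed
      then have "(\<eta> \<odot> \<eta>) \<odot> F l = (\<Sum>e\<in>B. l [s e] \<odot> F (T e))"
        using sum[of B "\<lambda>e. l [s e]" T, OF ls fr(7)] scal[OF Cinf_fmult[OF fr(1) fr(1)] l]
        by (simp only:)
      then have "((\<eta> \<odot> \<eta>) \<odot> F l) q = (\<Sum>e\<in>B. l [s e] \<odot> F (T e)) q" by simp
      moreover have "l [Z] = (\<Sum>e\<in>B. F (T e) \<odot> l [s e])"
        unfolding Z_def using l fr(6,7) Cinf by (intro Dsp_1_sum) (simp_all add: D)
      ultimately show ?thesis
        using fr(4)[OF q] by (simp add: sum_fun_apply mult.commute)
    qed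
    ultimately show ?thesis using fr(2,3) by blast
  qed
  define good where "good p P \<longleftrightarrow> fst P \<in> Sec \<and> open (snd P) \<and> p \<in> snd P \<and>
    (\<forall>l\<in>DualSec. \<forall>q\<in>snd P. l [fst P] q = F l q)" for p and P :: "('m \<Rightarrow> 'f) \<times> 'm set"
  define Z where "Z p = fst (SOME P. good p P)" for p
  define N where "N p = snd (SOME P. good p P)" for p
  have "\<exists>P. good p P" for p
    using local[of p] by (auto simp: good_def)
  then have "good p (SOME P. good p P)" for p
    by (rule someI_ex)
  then have ZN: "\<And>p. Z p \<in> Sec" "\<And>p. open (N p)" "\<And>p. p \<in> N p"
    "\<And>p l q. l \<in> DualSec \<Longrightarrow> q \<in> N p \<Longrightarrow> l [Z p] q = F l q"
    unfolding good_def Z_def N_def by blast+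
  \<comment> \<open>The local solutions agree on overlaps since dual sections separate points.\<close>
  define W where "W q = Z q q" for q
  have W: "W q = Z p q" if "q \<in> N p" for p q
    unfolding W_def
  proof (rule DualSec_separates[OF ZN(1) ZN(1)])
    fix l assume l: "l \<in> DualSec"
    show "l [Z q] q = l [Z p] q"
      using ZN(4)[OF l ZN(3)] ZN(4)[OF l that] by (rule trans[OF _ sym])
  qed
  have "W \<in> Sec"
  proof (rule Sec_local, intro exI conjI ballI)
    show "open (N p)" "p \<in> N p" "Z p \<in> Sec" "\<And>q. q \<in> N p \<Longrightarrow> W q = Z p q" for p
      using ZN(1-3) W by auto
  qed
  moreover have "l [W] = F l" if "l \<in> DualSec" for l
  proof
    fix q
    have "l [W] q = l [Z q] q"
      using Dsp_1_pointwise[of l W "Z q" q] that \<open>W \<in> Sec\<close> ZN(1) by (simp add: D W_def)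
    then show "l [W] q = F l q" using ZN(4)[OF that ZN(3)] by (rule trans)
  qed
  ultimately show ?thesis
  proof (intro ex1I[of _ W] conjI ballI)
    fix Y assume W: "W \<in> Sec" "\<And>l. l \<in> DualSec \<Longrightarrow> l [W] = F l"
      and Y: "Y \<in> Sec \<and> (\<forall>l\<in>DualSec. l [Y] = F l)"
    show "Y = W"
      by (rule ext, rule DualSec_separates) (use W Y in auto)
  qed
qed

end

section \<open>Recursion for the shuffle product\<close>

text \<open>
  A shuffle of \<open>{..<Suc n}\<close> attains \<open>0\<close> at the first place of one of its two blocks. Removing this
  place leaves a shuffle \<open>\<sigma>\<close> of \<open>{..<n}\<close>; \<open>lift\<close> and the cycle \<open>cyc p\<close> undo the removal.
\<close>

definition lift :: "(nat \<Rightarrow> nat) \<Rightarrow> nat \<Rightarrow> nat" where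
  "lift \<sigma> i = (case i of 0 \<Rightarrow> 0 | Suc j \<Rightarrow> Suc (\<sigma> j))"

definition cyc :: "nat \<Rightarrow> nat \<Rightarrow> nat" where
  "cyc p i = (if i < p then Suc i else if i = p then 0 else i)"

lemma lift_simps [simp]: "lift \<sigma> 0 = 0" "lift \<sigma> (Suc i) = Suc (\<sigma> i)"
  by (simp_all add: lift_def)

lemma lift_compose: "lift (\<sigma> \<circ> \<tau>) = lift \<sigma> \<circ> lift \<tau>"
  by (auto simp: fun_eq_iff lift_def split: nat.split)

lemma lift_id: "lift id = id"
  by (auto simp: fun_eq_iff lift_def split: nat.split)

lemma lift_transpose: "lift (Transposition.transpose a b) = Transposition.transpose (Suc a) (Suc b)"
  by (auto simp: fun_eq_iff lift_def Transposition.transpose_def split: nat.split)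

lemma lift_permutes_and_sign:
  assumes "\<sigma> permutes {..<n}"
  shows "lift \<sigma> permutes {..<Suc n}" "sign (lift \<sigma>) = sign \<sigma>"
proof -
  have "lift \<sigma> permutes {..<Suc n} \<and> sign (lift \<sigma>) = sign \<sigma>"
    using assms finite_lessThan
  proof (induction rule: permutes_induct)
    case id
    then show ?case unfolding lift_id using permutes_id sign_id by blast
  next
    case (swap a b p)
    have p: "permutation p" "permutation (lift p)"
      using swap permutes_imp_permutation[OF finite_lessThan] by blast+
    have "Transposition.transpose (Suc a) (Suc b) permutes {..<Suc n}"
      using swap by (intro permutes_swap_id) auto
    moreover have "sign (Transposition.transpose a b \<circ> p) = - sign p"
      using p swap.hyps by (subst sign_compose) (simp_all add: permutation_swap_id sign_swap_id)
    moreover have "sign (Transposition.transpose (Suc a) (Suc b) \<circ> lift p) = - sign (lift p)"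
      using p swap.hyps by (subst sign_compose) (simp_all add: permutation_swap_id sign_swap_id)
    ultimately show ?case
      unfolding lift_compose lift_transpose
      using swap.IH by (auto intro: permutes_compose simp del: o_apply)
  qed
  then show "lift \<sigma> permutes {..<Suc n}" "sign (lift \<sigma>) = sign \<sigma>" by auto
qed

lemma cyc_Suc: "cyc (Suc p) = cyc p \<circ> Transposition.transpose p (Suc p)"
  by (auto simp: fun_eq_iff cyc_def Transposition.transpose_def)

lemma cyc_permutes_and_sign:
  assumes "p < n"
  shows "cyc p permutes {..<n}" "sign (cyc p) = (-1) ^ p"
proof -
  have "cyc p permutes {..<n} \<and> sign (cyc p) = (-1) ^ p"
    using assms
  proof (induction p)
    case 0
    have "cyc 0 = id" by (auto simp: cyc_def)
    then show ?case using permutes_id[of "{..<n}"] by (simp only: sign_id power_0)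
  next
    case (Suc p)
    have tr: "Transposition.transpose p (Suc p) permutes {..<n}"
      using Suc by (intro permutes_swap_id) auto
    have "permutation (cyc p)"
      using Suc permutes_imp_permutation[of "{..<n}" "cyc p"] by simp
    then have "sign (cyc p \<circ> Transposition.transpose p (Suc p)) = - sign (cyc p)"
      by (subst sign_compose) (simp_all add: permutation_swap_id sign_swap_id)
    then show ?case
      unfolding cyc_Suc
      using Suc permutes_compose[OF tr, of "cyc p"] by (simp del: o_apply)
  qed
  then show "cyc p permutes {..<n}" "sign (cyc p) = (-1) ^ p" by auto
qed

lemma finite_shuffles_perm: "finite (shuffles_perm p q)"
  by (rule finite_subset[OF _ finite_permutations[of "{..<p + q}"]]) (auto simp: shuffles_perm_def)

lemma permutes_unlift:
  assumes "\<tau> permutes {..<Suc n}" "\<tau> 0 = 0"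
  obtains \<sigma> where "\<sigma> permutes {..<n}" "\<tau> = lift \<sigma>"
proof
  let ?\<sigma> = "\<lambda>i. \<tau> (Suc i) - 1"
  have inj: "\<tau> i = \<tau> j \<longleftrightarrow> i = j" for i j
    using permutes_inj[OF assms(1)] by (simp add: inj_eq)
  have pos: "\<tau> (Suc i) = Suc (?\<sigma> i)" for i
    using inj[of "Suc i" 0] assms(2) by simp
  show "\<tau> = lift ?\<sigma>"
    using pos assms(2) by (auto simp: fun_eq_iff lift_def split: nat.split)
  show "?\<sigma> permutes {..<n}"
    unfolding permutes_def
  proof (intro conjI allI impI)
    fix x assume "x \<notin> {..<n}"
    then show "?\<sigma> x = x" using permutes_not_in[OF assms(1), of "Suc x"] by simp
  next
    fix y
    obtain x where x: "\<tau> x = Suc y"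
      using permutes_surj[OF assms(1)] by (metis surjD)
    then obtain x' where "x = Suc x'"
      using assms(2) by (cases x) auto
    then show "\<exists>!x. ?\<sigma> x = y"
    proof (intro ex1I[of _ x'])
      show "?\<sigma> x' = y" using x \<open>x = Suc x'\<close> by simp
      fix z assume "?\<sigma> z = y"
      then have "\<tau> (Suc z) = \<tau> x" using pos[of z] x by simp
      then show "z = x'" using inj \<open>x = Suc x'\<close> by simp
    qed
  qed
qed

lemma shuffles_perm_Suc_left:
  "{\<tau> \<in> shuffles_perm (Suc p) q. \<tau> 0 = 0} = lift ` shuffles_perm p q"
proof (intro equalityI subsetI)
  fix \<tau> assume \<tau>: "\<tau> \<in> {\<tau> \<in> shuffles_perm (Suc p) q. \<tau> 0 = 0}"
  then obtain \<sigma> where \<sigma>: "\<sigma> permutes {..<p + q}" "\<tau> = lift \<sigma>"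
    using permutes_unlift[of \<tau> "p + q"] by (auto simp: shuffles_perm_def)
  have mono: "strict_mono_on {..<Suc p} (lift \<sigma>)" "strict_mono_on {Suc p..<Suc p + q} (lift \<sigma>)"
    using \<tau> by (auto simp: \<sigma>(2) shuffles_perm_def)
  have "strict_mono_on {..<p} \<sigma>"
    using strict_mono_onD[OF mono(1), of "Suc i" "Suc j" for i j] by (intro strict_mono_onI) auto
  moreover have "strict_mono_on {p..<p + q} \<sigma>"
    using strict_mono_onD[OF mono(2), of "Suc i" "Suc j" for i j] by (intro strict_mono_onI) auto
  moreover note \<sigma>
  ultimately show "\<tau> \<in> lift ` shuffles_perm p q"
    by (auto simp: shuffles_perm_def)
next
  fix \<tau> assume "\<tau> \<in> lift ` shuffles_perm p q"
  then obtain \<sigma> where \<sigma>: "\<sigma> \<in> shuffles_perm p q" "\<tau> = lift \<sigma>" by blast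
  then have "strict_mono_on {..<Suc p} \<tau>" "strict_mono_on {Suc p..<Suc p + q} \<tau>"
    by (auto simp: shuffles_perm_def strict_mono_on_def lift_def split: nat.splits)
  then show "\<tau> \<in> {\<tau> \<in> shuffles_perm (Suc p) q. \<tau> 0 = 0}"
    using \<sigma> lift_permutes_and_sign[of \<sigma> "p + q"] by (auto simp: shuffles_perm_def)
qed

lemma shuffles_perm_Suc_right:
  "{\<tau> \<in> shuffles_perm p (Suc q). \<tau> p = 0} = (\<lambda>\<sigma>. lift \<sigma> \<circ> cyc p) ` shuffles_perm p q"
proof (intro equalityI subsetI)
  fix \<tau> assume \<tau>: "\<tau> \<in> {\<tau> \<in> shuffles_perm p (Suc q). \<tau> p = 0}"
  have cyc: "cyc p permutes {..<Suc (p + q)}"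
    by (rule cyc_permutes_and_sign) simp
  have inv: "inv (cyc p) 0 = p" "\<And>i. i < p \<Longrightarrow> inv (cyc p) (Suc i) = i"
    using permutes_inverses(2)[OF cyc] by (auto simp: permutes_inv_eq[OF cyc] cyc_def)
  have "(\<tau> \<circ> inv (cyc p)) permutes {..<Suc (p + q)}"
    using \<tau> cyc by (intro permutes_compose permutes_inv) (auto simp: shuffles_perm_def)
  moreover have "(\<tau> \<circ> inv (cyc p)) 0 = 0" using \<tau> inv by simp
  ultimately obtain \<sigma> where \<sigma>: "\<sigma> permutes {..<p + q}" "\<tau> \<circ> inv (cyc p) = lift \<sigma>"
    by (rule permutes_unlift)
  then have eq: "\<tau> = lift \<sigma> \<circ> cyc p"
    using permutes_inverses(2)[OF cyc] by (metis comp_assoc comp_id fun.map_id0 id_apply inv_o_cancel permutes_inj[OF cyc])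
  have mono: "strict_mono_on {..<p} \<tau>" "strict_mono_on {p..<p + Suc q} \<tau>"
    using \<tau> by (auto simp: shuffles_perm_def)
  have 1: "\<tau> i = Suc (\<sigma> i)" if "i < p" for i using that by (simp add: eq cyc_def)
  have 2: "\<tau> (Suc i) = Suc (\<sigma> i)" if "i \<ge> p" for i using that by (simp add: eq cyc_def)
  have "strict_mono_on {..<p} \<sigma>"
    using strict_mono_onD[OF mono(1)] 1 by (intro strict_mono_onI) fastforce
  moreover have "strict_mono_on {p..<p + q} \<sigma>"
  proof (rule strict_mono_onI)
    fix i j assume "i \<in> {p..<p + q}" "j \<in> {p..<p + q}" "i < j"
    then show "\<sigma> i < \<sigma> j"
      using strict_mono_onD[OF mono(2), of "Suc i" "Suc j"] 2[of i] 2[of j] by simp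
  qed
  ultimately show "\<tau> \<in> (\<lambda>\<sigma>. lift \<sigma> \<circ> cyc p) ` shuffles_perm p q"
    using \<sigma>(1) by (auto simp: shuffles_perm_def eq)
next
  fix \<tau> assume "\<tau> \<in> (\<lambda>\<sigma>. lift \<sigma> \<circ> cyc p) ` shuffles_perm p q"
  then obtain \<sigma> where \<sigma>: "\<sigma> \<in> shuffles_perm p q" and \<tau>: "\<tau> = lift \<sigma> \<circ> cyc p" by blast
  have "strict_mono_on {..<p} \<tau>"
    using \<sigma> by (auto simp: \<tau> shuffles_perm_def strict_mono_on_def cyc_def)
  moreover have "strict_mono_on {p..<p + Suc q} \<tau>"
    using \<sigma> by (auto simp: \<tau> shuffles_perm_def strict_mono_on_def cyc_def lift_def split: nat.splits)
  moreover have "\<tau> permutes {..<Suc (p + q)}"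
    unfolding \<tau> using \<sigma> lift_permutes_and_sign[of \<sigma> "p + q"] cyc_permutes_and_sign[of p "Suc (p + q)"]
    by (intro permutes_compose) (auto simp: shuffles_perm_def)
  ultimately show "\<tau> \<in> {\<tau> \<in> shuffles_perm p (Suc q). \<tau> p = 0}"
    by (auto simp: shuffles_perm_def \<tau> cyc_def)
qed

lemma inj_lift: "inj lift"
proof (rule injI)
  fix \<sigma> \<tau> assume "lift \<sigma> = lift \<tau>"
  then have "lift \<sigma> (Suc i) = lift \<tau> (Suc i)" for i by simp
  then show "\<sigma> = \<tau>" by (auto simp: fun_eq_iff)
qed

lemma inj_lift_cyc: "inj (\<lambda>\<sigma>. lift \<sigma> \<circ> cyc p)"
proof (rule injI)
  fix \<sigma> \<tau> assume "lift \<sigma> \<circ> cyc p = lift \<tau> \<circ> cyc p"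
  moreover have "surj (cyc p)"
    using cyc_permutes_and_sign(1)[of p "Suc p"] permutes_surj by blast
  ultimately have "lift \<sigma> = lift \<tau>"
    by (metis (no_types, lifting) comp_apply ext surjD)
  then show "\<sigma> = \<tau>" using inj_lift by (simp add: inj_eq)
qed

lemma shuffle_zero_cases:
  assumes "\<sigma> \<in> shuffles_perm p q" "p + q > 0"
  shows "(p > 0 \<and> \<sigma> 0 = 0) \<noteq> (q > 0 \<and> \<sigma> p = 0)"
proof -
  have \<sigma>: "\<sigma> permutes {..<p + q}" "strict_mono_on {..<p} \<sigma>" "strict_mono_on {p..<p + q} \<sigma>"
    using assms(1) by (auto simp: shuffles_perm_def)
  obtain i where i: "\<sigma> i = 0" using permutes_surj[OF \<sigma>(1)] by (metis surjD)
  then have "i < p + q" using assms(2) permutes_not_in[OF \<sigma>(1), of i] by (cases "i < p + q") auto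
  have "i = 0" if "i < p" using strict_mono_onD[OF \<sigma>(2), of 0 i] i that by auto
  moreover have "i = p" if "i \<ge> p" using strict_mono_onD[OF \<sigma>(3), of p i] i that \<open>i < p + q\<close>
    by (cases "i = p") auto
  moreover have "\<sigma> 0 \<noteq> \<sigma> p" if "p > 0" using permutes_inj[OF \<sigma>(1)] that by (auto simp: inj_eq)
  ultimately show ?thesis
    using i \<open>i < p + q\<close> by (cases "i < p"; cases "p = 0") auto
qed

lemma sum_shuffles_Suc:
  fixes g :: "nat \<Rightarrow> (nat \<Rightarrow> nat) \<Rightarrow> 'a::comm_monoid_add"
  shows "(\<Sum>p\<le>Suc n. \<Sum>\<sigma>\<in>shuffles_perm p (Suc n - p). g p \<sigma>) =
    (\<Sum>p\<le>n. \<Sum>\<sigma>\<in>shuffles_perm p (n - p). g (Suc p) (lift \<sigma>)) +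
    (\<Sum>p\<le>n. \<Sum>\<sigma>\<in>shuffles_perm p (n - p). g p (lift \<sigma> \<circ> cyc p))"
proof -
  \<comment> \<open>The positivity conditions say that the block whose first place carries \<open>0\<close> is nonempty.\<close>
  define A where "A p = {\<sigma> \<in> shuffles_perm p (Suc n - p). p > 0 \<and> \<sigma> 0 = 0}" for p
  define B where "B p = {\<sigma> \<in> shuffles_perm p (Suc n - p). Suc n - p > 0 \<and> \<sigma> p = 0}" for p
  have "(\<Sum>\<sigma>\<in>shuffles_perm p (Suc n - p). g p \<sigma>) = sum (g p) (A p) + sum (g p) (B p)"
    if "p \<le> Suc n" for p
  proof -
    have "shuffles_perm p (Suc n - p) = A p \<union> B p" "A p \<inter> B p = {}"
      using shuffle_zero_cases[of _ p "Suc n - p"] that by (auto simp: A_def B_def)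
    moreover have "finite (A p)" "finite (B p)"
      by (simp_all add: A_def B_def finite_shuffles_perm)
    ultimately show ?thesis by (simp add: sum.union_disjoint)
  qed
  then have "(\<Sum>p\<le>Suc n. \<Sum>\<sigma>\<in>shuffles_perm p (Suc n - p). g p \<sigma>) =
      (\<Sum>p\<le>Suc n. sum (g p) (A p)) + (\<Sum>p\<le>Suc n. sum (g p) (B p))"
    by (simp add: sum.distrib del: sum.atMost_Suc)
  also have "(\<Sum>p\<le>Suc n. sum (g p) (A p)) = (\<Sum>p\<le>n. sum (g (Suc p)) (A (Suc p)))"
    by (subst sum.atMost_Suc_shift) (simp add: A_def)
  also have "(\<Sum>p\<le>n. sum (g (Suc p)) (A (Suc p))) =
      (\<Sum>p\<le>n. \<Sum>\<sigma>\<in>shuffles_perm p (n - p). g (Suc p) (lift \<sigma>))"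
  proof (rule sum.cong[OF refl])
    fix p
    have "A (Suc p) = lift ` shuffles_perm p (n - p)"
      using shuffles_perm_Suc_left[of p "n - p"] by (simp add: A_def)
    then show "sum (g (Suc p)) (A (Suc p)) = (\<Sum>\<sigma>\<in>shuffles_perm p (n - p). g (Suc p) (lift \<sigma>))"
      using inj_lift by (simp add: sum.reindex inj_on_subset)
  qed
  also have "(\<Sum>p\<le>Suc n. sum (g p) (B p)) = (\<Sum>p\<le>n. sum (g p) (B p))"
    by (simp add: B_def)
  also have "\<dots> = (\<Sum>p\<le>n. \<Sum>\<sigma>\<in>shuffles_perm p (n - p). g p (lift \<sigma> \<circ> cyc p))"
  proof (rule sum.cong[OF refl])
    fix p assume "p \<in> {..n}"
    then have "B p = (\<lambda>\<sigma>. lift \<sigma> \<circ> cyc p) ` shuffles_perm p (n - p)"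
      using shuffles_perm_Suc_right[of p "n - p"] by (simp add: B_def Suc_diff_le)
    then show "sum (g p) (B p) = (\<Sum>\<sigma>\<in>shuffles_perm p (n - p). g p (lift \<sigma> \<circ> cyc p))"
      using inj_lift_cyc[of p] by (simp add: sum.reindex inj_on_subset)
  qed
  finally show ?thesis .
qed

definition contr :: "'s \<Rightarrow> ('s list \<Rightarrow> 't) \<Rightarrow> 's list \<Rightarrow> 't" where
  "contr X c = (\<lambda>Xs. c (X # Xs))"

text \<open>
  The grading involution, \<open>(-1)\<^sup>k\<close> on operators of degree \<open>k\<close>. As an operation on inhomogeneous
  operators it allows sign rules to be stated without mentioning degrees.
\<close>

definition invol :: "('s list \<Rightarrow> 'm \<Rightarrow> real) \<Rightarrow> 's list \<Rightarrow> 'm \<Rightarrow> real" where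
  "invol c = (\<lambda>Xs x. (-1) ^ length Xs * c Xs x)"

lemma shuffles_perm_0_0: "shuffles_perm 0 0 = {id}"
  by (auto simp: shuffles_perm_def)

lemma shuffle_prod_Nil: "(c \<bowtie> c') [] x = c [] x * c' [] x"
  by (simp add: shuffle_prod_def shuffles_perm_0_0)

text \<open>
  Contraction with the first argument is a graded derivation of the shuffle product: a shuffle puts
  the first argument at the head of one of the two blocks. Together with the value on the empty list
  this determines the product by recursion on the argument list, with all signs absorbed by \<open>invol\<close>.
\<close>

lemma shuffle_prod_Cons:
  "(c \<bowtie> c') (X # Xs) x = (contr X c \<bowtie> c') Xs x + (invol c \<bowtie> contr X c') Xs x"
proof -
  define n where "n = length Xs"
  define g where "g p \<sigma> = of_int (sign \<sigma>) * c (map (\<lambda>i. (X # Xs) ! \<sigma> i) [0..<p]) x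
      * c' (map (\<lambda>i. (X # Xs) ! \<sigma> i) [p..<Suc n]) x" for p \<sigma>
  have "(c \<bowtie> c') (X # Xs) x = (\<Sum>p\<le>Suc n. \<Sum>\<sigma>\<in>shuffles_perm p (Suc n - p). g p \<sigma>)"
    by (simp add: shuffle_prod_def g_def n_def)
  also have "\<dots> = (\<Sum>p\<le>n. \<Sum>\<sigma>\<in>shuffles_perm p (n - p). g (Suc p) (lift \<sigma>)) +
    (\<Sum>p\<le>n. \<Sum>\<sigma>\<in>shuffles_perm p (n - p). g p (lift \<sigma> \<circ> cyc p))"
    by (rule sum_shuffles_Suc)
  also have "(\<Sum>p\<le>n. \<Sum>\<sigma>\<in>shuffles_perm p (n - p). g (Suc p) (lift \<sigma>)) = (contr X c \<bowtie> c') Xs x"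
    unfolding shuffle_prod_def n_def[symmetric]
  proof (intro sum.cong refl)
    fix p \<sigma> assume "p \<in> {..n}" "\<sigma> \<in> shuffles_perm p (n - p)"
    then have "\<sigma> permutes {..<n}" by (simp add: shuffles_perm_def)
    moreover have "map (\<lambda>i. (X # Xs) ! lift \<sigma> i) [0..<Suc p] = X # map (\<lambda>i. Xs ! \<sigma> i) [0..<p]"
      by (simp add: upt_conv_Cons map_Suc_upt[symmetric] o_def del: upt_Suc map_Suc_upt)
    moreover have "map (\<lambda>i. (X # Xs) ! lift \<sigma> i) [Suc p..<Suc n] = map (\<lambda>i. Xs ! \<sigma> i) [p..<n]"
      by (simp add: map_Suc_upt[symmetric] o_def del: upt_Suc map_Suc_upt)
    ultimately show "g (Suc p) (lift \<sigma>) = of_int (sign \<sigma>) * contr X c (map (\<lambda>i. Xs ! \<sigma> i) [0..<p]) x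
        * c' (map (\<lambda>i. Xs ! \<sigma> i) [p..<n]) x"
      by (simp add: g_def contr_def lift_permutes_and_sign del: upt_Suc)
  qed
  also have "(\<Sum>p\<le>n. \<Sum>\<sigma>\<in>shuffles_perm p (n - p). g p (lift \<sigma> \<circ> cyc p)) = (invol c \<bowtie> contr X c') Xs x"
    unfolding shuffle_prod_def n_def[symmetric]
  proof (intro sum.cong refl)
    fix p \<sigma> assume p: "p \<in> {..n}" and "\<sigma> \<in> shuffles_perm p (n - p)"
    then have \<sigma>: "\<sigma> permutes {..<n}" by (simp add: shuffles_perm_def)
    have "permutation (lift \<sigma>)" "permutation (cyc p)"
      using lift_permutes_and_sign(1)[OF \<sigma>] cyc_permutes_and_sign(1)[of p "Suc p"]
        permutes_imp_permutation[OF finite_lessThan] by blast+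
    then have sgn: "sign (lift \<sigma> \<circ> cyc p) = sign \<sigma> * (-1) ^ p"
      using lift_permutes_and_sign(2)[OF \<sigma>] cyc_permutes_and_sign(2)[of p "Suc p"]
      by (simp add: sign_compose)
    have 1: "map (\<lambda>i. (X # Xs) ! (lift \<sigma> \<circ> cyc p) i) [0..<p] = map (\<lambda>i. Xs ! \<sigma> i) [0..<p]"
      by (simp add: cyc_def)
    have "map (\<lambda>i. (X # Xs) ! (lift \<sigma> \<circ> cyc p) i) [Suc p..<Suc n] = map (\<lambda>i. Xs ! \<sigma> i) [p..<n]"
      by (simp add: map_Suc_upt[symmetric] o_def cyc_def del: upt_Suc map_Suc_upt)
    then have 2: "map (\<lambda>i. (X # Xs) ! (lift \<sigma> \<circ> cyc p) i) [p..<Suc n] = X # map (\<lambda>i. Xs ! \<sigma> i) [p..<n]"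
      using p by (simp add: upt_conv_Cons cyc_def del: upt_Suc)
    show "g p (lift \<sigma> \<circ> cyc p) = of_int (sign \<sigma>) * invol c (map (\<lambda>i. Xs ! \<sigma> i) [0..<p]) x
        * contr X c' (map (\<lambda>i. Xs ! \<sigma> i) [p..<n]) x"
      unfolding g_def 1 2 sgn contr_def invol_def by simp
  qed
  finally show ?thesis .
qed

section \<open>Total degree\<close>

lemma delta_add: "delta i f (\<lambda>Xs. D Xs + D' Xs) = (\<lambda>Xs. delta i f D Xs + delta i f D' Xs)"
  by (auto simp: delta_def fun_eq_iff algebra_simps)

lemma delta_fmult: "delta i f (\<lambda>Xs. g \<odot> D Xs) = (\<lambda>Xs. g \<odot> delta i f D Xs)"
  by (auto simp: delta_def fun_eq_iff algebra_simps)

context vector_bundle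
begin

lemma args_update: "Xs \<in> args k \<Longrightarrow> X \<in> Sec \<Longrightarrow> Xs[i := X] \<in> args k"
  using set_update_subset_insert[of Xs i X] by (auto simp: args_def)

lemma args_nth: "Xs \<in> args k \<Longrightarrow> i < k \<Longrightarrow> Xs ! i \<in> Sec"
  by (auto simp: args_def)

lemma args_update_fmult: "Xs \<in> args k \<Longrightarrow> f \<in> Cinf \<Longrightarrow> i < k \<Longrightarrow> Xs[i := f \<odot> Xs ! i] \<in> args k"
  by (intro args_update Sec_fmult args_nth)

text \<open>
  \<open>ann k n D\<close> says that all products of \<open>n\<close> operators \<open>\<delta>\<^sub>i(f)\<close> annihilate \<open>D\<close>, so that total degree
  \<open>\<le> m\<close> is \<open>ann k (Suc m)\<close>. Allowing \<open>n = 0\<close> (\<open>D\<close> vanishes) makes the degree of a product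
  additive without exceptions.
\<close>

primrec ann :: "nat \<Rightarrow> nat \<Rightarrow> (('m \<Rightarrow> 'f) list \<Rightarrow> 'm \<Rightarrow> 'v::real_vector) \<Rightarrow> bool" where
  "ann k 0 D \<longleftrightarrow> (\<forall>Xs\<in>args k. D Xs = 0)"
| "ann k (Suc n) D \<longleftrightarrow> (\<forall>i<k. \<forall>f\<in>Cinf. ann k n (delta i f D))"

lemma total_degree_le_iff_ann: "total_degree_le k m D \<longleftrightarrow> ann k (Suc m) D"
proof -
  have "(\<forall>ps. length ps = n \<and> set ps \<subseteq> {..<k} \<times> Cinf \<longrightarrow>
      (\<forall>Xs\<in>args k. foldr (\<lambda>(i, f). delta i f) ps D Xs = 0)) \<longleftrightarrow> ann k n D" for n
  proof (induction n arbitrary: D)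
    case (Suc n)
    have "(\<forall>ps. length ps = Suc n \<and> set ps \<subseteq> {..<k} \<times> Cinf \<longrightarrow> P ps) \<longleftrightarrow>
      (\<forall>i<k. \<forall>f\<in>Cinf. \<forall>qs. length qs = n \<and> set qs \<subseteq> {..<k} \<times> Cinf \<longrightarrow> P (qs @ [(i, f)]))" for P
    proof (intro iffI allI impI ballI)
      fix ps assume P: "\<forall>i<k. \<forall>f\<in>Cinf. \<forall>qs. length qs = n \<and> set qs \<subseteq> {..<k} \<times> Cinf \<longrightarrow>
          P (qs @ [(i, f)])" and ps: "length ps = Suc n \<and> set ps \<subseteq> {..<k} \<times> Cinf"
      obtain qs i f where "ps = qs @ [(i, f)]"
        using ps by (cases ps rule: rev_cases) auto
      then show "P ps" using P ps by auto
    qed auto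
    then show ?case
      unfolding ann.simps Suc.IH[symmetric] by (simp del: zero_fun_apply)
  qed simp
  from this[of "Suc m"] show ?thesis
    unfolding total_degree_le_def .
qed

lemma ann_cong:
  "(\<And>Xs. Xs \<in> args k \<Longrightarrow> D Xs = D' Xs) \<Longrightarrow> ann k n D \<Longrightarrow> ann k n D'"
proof (induction n arbitrary: D D')
  case (Suc n)
  have "ann k n (delta i f D')" if "i < k" "f \<in> Cinf" for i f
  proof (rule Suc.IH)
    show "ann k n (delta i f D)" using Suc.prems(2) that by simp
    show "delta i f D Xs = delta i f D' Xs" if "Xs \<in> args k" for Xs
      unfolding delta_def
      by (simp only: Suc.prems(1)[OF that]
          Suc.prems(1)[OF args_update_fmult[OF that \<open>f \<in> Cinf\<close> \<open>i < k\<close>]])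
  qed
  then show ?case by simp
qed simp

lemma ann_zero: "(\<And>Xs. Xs \<in> args k \<Longrightarrow> D Xs = 0) \<Longrightarrow> ann k n D"
proof (induction n arbitrary: D)
  case (Suc n)
  have "ann k n (delta i f D)" if "i < k" "f \<in> Cinf" for i f
    by (rule Suc.IH) (use Suc.prems that args_update_fmult in \<open>auto simp: delta_def\<close>)
  then show ?case by simp
qed simp

lemma ann_add: "ann k n D \<Longrightarrow> ann k n D' \<Longrightarrow> ann k n (\<lambda>Xs. D Xs + D' Xs)"
  by (induction n arbitrary: D D') (auto simp: delta_add)

lemma ann_fmult: "ann k n D \<Longrightarrow> ann k n (\<lambda>Xs. g \<odot> D Xs)"
  by (induction n arbitrary: D) (auto simp: delta_fmult)

lemma ann_sum: "(\<And>i. i \<in> I \<Longrightarrow> ann k n (D i)) \<Longrightarrow> ann k n (\<lambda>Xs. \<Sum>i\<in>I. D i Xs)"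
proof (induction I rule: infinite_finite_induct)
  case (insert i I)
  have "ann k n (\<lambda>Xs. D i Xs + (\<Sum>i\<in>I. D i Xs))"
    using insert by (intro ann_add) auto
  then show ?case by (simp only: sum.insert[OF insert.hyps])
qed (auto intro: ann_zero)

lemma multilinear_add:
  "multilinear_op k D \<Longrightarrow> multilinear_op k D' \<Longrightarrow> multilinear_op k (\<lambda>Xs. D Xs + D' Xs)"
  unfolding multilinear_op_def by (auto simp: fmult_add_right)

lemma multilinear_fmult: "multilinear_op k D \<Longrightarrow> multilinear_op k (\<lambda>Xs. g \<odot> D Xs)"
  unfolding multilinear_op_def by (auto simp: fmult_add_right)

lemma multilinear_zero: "multilinear_op k (\<lambda>Xs. 0)"
  unfolding multilinear_op_def by auto

lemma multilinear_sum:
  "(\<And>i. i \<in> I \<Longrightarrow> multilinear_op k (D i)) \<Longrightarrow> multilinear_op k (\<lambda>Xs. \<Sum>i\<in>I. D i Xs)"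
proof (induction I rule: infinite_finite_induct)
  case (insert i I)
  have "multilinear_op k (\<lambda>Xs. D i Xs + (\<Sum>i\<in>I. D i Xs))"
    using insert by (intro multilinear_add) auto
  then show ?case by (simp only: sum.insert[OF insert.hyps])
qed (auto intro: multilinear_zero)

lemma multilinear_cong:
  assumes "\<And>Xs. Xs \<in> args k \<Longrightarrow> D Xs = D' Xs" "multilinear_op k D"
  shows "multilinear_op k D'"
  unfolding multilinear_op_def
proof (intro ballI allI impI conjI)
  fix Xs i Y assume *: "Xs \<in> args k" "i < k"
  {
    assume "Y \<in> Sec"
    then have "Xs[i := Xs ! i + Y] \<in> args k" "Xs[i := Y] \<in> args k"
      using * by (auto intro!: args_update Sec_add args_nth)
    then show "D' (Xs[i := Xs ! i + Y]) = D' Xs + D' (Xs[i := Y])"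
      using assms(2) * \<open>Y \<in> Sec\<close> unfolding multilinear_op_def by (simp only: assms(1)[symmetric])
  }
  fix r
  have "Xs[i := (\<lambda>_. r) \<odot> Xs ! i] \<in> args k"
    using * by (auto intro!: args_update_fmult Cinf_const)
  then show "D' (Xs[i := (\<lambda>_. r) \<odot> Xs ! i]) = (\<lambda>_. r) \<odot> D' Xs"
    using assms(2) * unfolding multilinear_op_def by (simp only: assms(1)[symmetric])
qed

subsection \<open>The spaces of multidifferential operators\<close>

text \<open>
  The exponent \<open>max k 1\<close> puts functions (\<open>k = 0\<close>) on the same footing as operators of positive
  degree: there is no \<open>\<delta>\<^sub>i(f)\<close> on an operator without arguments, so one of them annihilates it.
\<close>

lemma Dsp_iff:
  "c \<in> Dsp k \<longleftrightarrow> (\<forall>Xs. Xs \<notin> args k \<longrightarrow> c Xs = 0) \<and> (\<forall>Xs\<in>args k. c Xs \<in> Cinf) \<and>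
     multilinear_op k c \<and> ann k (max k 1) c \<and>
     (k > 0 \<longrightarrow> (\<forall>f\<in>Cinf. \<forall>Xs\<in>args k. delta (k - 1) f c Xs = 0))"
proof (cases k)
  case 0
  then show ?thesis by (simp add: Dsp_def multilinear_op_def One_nat_def)
next
  case (Suc n)
  then show ?thesis
    unfolding Dsp_def total_degree_le_iff_ann by (simp add: One_nat_def max_def)
qed

lemma Dsp_outside: "c \<in> Dsp k \<Longrightarrow> Xs \<notin> args k \<Longrightarrow> c Xs = 0"
  and Dsp_Cinf: "c \<in> Dsp k \<Longrightarrow> Xs \<in> args k \<Longrightarrow> c Xs \<in> Cinf"
  and Dsp_multilinear: "c \<in> Dsp k \<Longrightarrow> multilinear_op k c"
  and Dsp_ann: "c \<in> Dsp k \<Longrightarrow> ann k (max k 1) c"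
  and Dsp_last: "c \<in> Dsp k \<Longrightarrow> k > 0 \<Longrightarrow> f \<in> Cinf \<Longrightarrow> Xs \<in> args k \<Longrightarrow> delta (k - 1) f c Xs = 0"
  unfolding Dsp_iff by blast+

lemma Dsp_add:
  assumes "c \<in> Dsp k" "c' \<in> Dsp k"
  shows "c + c' \<in> Dsp k"
  using assms unfolding Dsp_iff plus_fun_def[of c c']
  by (auto intro: Cinf_add multilinear_add ann_add simp: delta_add)

lemma Dsp_fmult_const:
  assumes "c \<in> Dsp k" "f \<in> Cinf"
  shows "(\<lambda>Xs. f \<odot> c Xs) \<in> Dsp k"
  using assms unfolding Dsp_iff
  by (auto intro: Cinf_fmult multilinear_fmult ann_fmult simp: delta_fmult)

lemma Dsp_zero: "0 \<in> Dsp k"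
  unfolding Dsp_iff zero_fun_def[where 'a = "('m \<Rightarrow> 'f) list"]
  by (auto intro: Cinf_zero multilinear_zero ann_zero simp: delta_def)

lemma DtotI: "(\<And>k. c k \<in> Dsp k) \<Longrightarrow> (\<Sum>k<n. c k) \<in> Dtot"
  unfolding Dtot_def by blast

lemma Dsp_subset_Dtot: "c \<in> Dsp k \<Longrightarrow> c \<in> Dtot"
proof -
  assume c: "c \<in> Dsp k"
  have "(\<Sum>j<Suc k. (if j = k then c else 0)) \<in> Dtot"
    by (rule DtotI) (use c Dsp_zero in auto)
  then show "c \<in> Dtot" by simp
qed

lemma Dtot_add:
  assumes "c \<in> Dtot" "c' \<in> Dtot"
  shows "c + c' \<in> Dtot"
proof -
  obtain a b n m where ab: "c = (\<Sum>k<n. a k)" "\<And>k. a k \<in> Dsp k" "c' = (\<Sum>k<m. b k)" "\<And>k. b k \<in> Dsp k"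
    using assms unfolding Dtot_def by blast
  define a' b' where "a' k = (if k < n then a k else 0)" and "b' k = (if k < m then b k else 0)" for k
  have "c = (\<Sum>k<max n m. a' k)" "c' = (\<Sum>k<max n m. b' k)"
    unfolding ab a'_def b'_def by (auto intro!: sum.mono_neutral_cong_left)
  then have "c + c' = (\<Sum>k<max n m. a' k + b' k)"
    by (simp only: sum.distrib)
  also have "\<dots> \<in> Dtot"
    by (rule DtotI) (auto simp: a'_def b'_def ab intro: Dsp_add Dsp_zero)
  finally show ?thesis .
qed

lemma Dtot_induct [consumes 1, case_names zero add]:
  assumes "c \<in> Dtot" "P 0" "\<And>k a b. a \<in> Dsp k \<Longrightarrow> b \<in> Dtot \<Longrightarrow> P b \<Longrightarrow> P (a + b)"
  shows "P c"
proof -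
  obtain a n where a: "c = (\<Sum>k<n. a k)" "\<And>k. a k \<in> Dsp k"
    using assms(1) unfolding Dtot_def by blast
  have "P (\<Sum>k<n. a k)"
  proof (induction n)
    case (Suc n)
    have "P (a n + (\<Sum>k<n. a k))"
      using a(2) Suc DtotI by (intro assms(3)) auto
    then show ?case by (simp only: sum.lessThan_Suc add.commute)
  next
    case 0
    show ?case using assms(2) by (simp only: lessThan_0 sum.empty)
  qed
  then show ?thesis using a by simp
qed

subsection \<open>The shuffle product of multidifferential operators\<close>

definition block :: "(nat \<Rightarrow> nat) \<Rightarrow> nat \<Rightarrow> nat \<Rightarrow> 's list \<Rightarrow> 's list" where
  "block \<sigma> a b Xs = map (\<lambda>i. Xs ! \<sigma> i) [a..<b]"

definition block_prod ::
  "(nat \<Rightarrow> nat) \<Rightarrow> nat \<Rightarrow> nat \<Rightarrow> ('s list \<Rightarrow> 'm \<Rightarrow> real) \<Rightarrow> ('s list \<Rightarrow> 'm \<Rightarrow> real) \<Rightarrow> 's list \<Rightarrow> 'm \<Rightarrow> real" where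
  "block_prod \<sigma> p q c c' Xs = c (block \<sigma> 0 p Xs) \<odot> c' (block \<sigma> p (p + q) Xs)"

lemma block_args:
  assumes "Xs \<in> args n" "\<sigma> permutes {..<n}" "b \<le> n"
  shows "block \<sigma> a b Xs \<in> args (b - a)"
proof -
  have "\<sigma> i < n" if "i < b" for i
    using permutes_in_image[OF assms(2), of i] that assms(3) by simp
  then show ?thesis using assms(1) by (auto simp: args_def block_def)
qed

lemma block_update:
  assumes "length Xs = n" "\<sigma> permutes {..<n}" "b \<le> n"
  shows "block \<sigma> a b (Xs[\<sigma> j := Z]) =
    (if a \<le> j \<and> j < b then (block \<sigma> a b Xs)[j - a := Z] else block \<sigma> a b Xs)"
proof (rule nth_equalityI)
  fix i assume "i < length (block \<sigma> a b (Xs[\<sigma> j := Z]))"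
  then have i: "i < b - a" by (simp add: block_def)
  have "\<sigma> (a + i) < n"
    using permutes_in_image[OF assms(2), of "a + i"] i assms(3) by simp
  moreover have "\<sigma> (a + i) = \<sigma> j \<longleftrightarrow> a + i = j"
    using permutes_inj[OF assms(2)] by (simp add: inj_eq)
  ultimately show "block \<sigma> a b (Xs[\<sigma> j := Z]) ! i =
      (if a \<le> j \<and> j < b then (block \<sigma> a b Xs)[j - a := Z] else block \<sigma> a b Xs) ! i"
    using i assms(1) by (auto simp: block_def nth_list_update)
qed (auto simp: block_def)

lemma block_nth: "a \<le> j \<Longrightarrow> j < b \<Longrightarrow> block \<sigma> a b Xs ! (j - a) = Xs ! \<sigma> j"
  using nth_upt[of a "j - a" b] by (simp add: block_def)

lemma block_prod_update:
  assumes "length Xs = p + q" "\<sigma> permutes {..<p + q}" "j < p + q"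
  shows "block_prod \<sigma> p q c c' (Xs[\<sigma> j := Z]) =
    (if j < p then c ((block \<sigma> 0 p Xs)[j := Z]) \<odot> c' (block \<sigma> p (p + q) Xs)
     else c (block \<sigma> 0 p Xs) \<odot> c' ((block \<sigma> p (p + q) Xs)[j - p := Z]))"
  using block_update[OF assms(1,2), of p 0 j] block_update[OF assms(1,2), of "p + q" p j] assms(3)
  by (simp add: block_prod_def)

lemma delta_block_prod:
  assumes "length Xs = p + q" "\<sigma> permutes {..<p + q}" "j < p + q"
  shows "delta (\<sigma> j) f (block_prod \<sigma> p q c c') Xs =
    (if j < p then block_prod \<sigma> p q (delta j f c) c' Xs else block_prod \<sigma> p q c (delta (j - p) f c') Xs)"
proof -
  show ?thesis
  proof (cases "j < p")
    case True
    have n: "block \<sigma> 0 p Xs ! j = Xs ! \<sigma> j"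
      using block_nth[of 0 j p] True by simp
    show ?thesis
      unfolding delta_def block_prod_update[OF assms] unfolding block_prod_def n using True
      by (auto simp: fun_eq_iff algebra_simps)
  next
    case False
    have n: "block \<sigma> p (p + q) Xs ! (j - p) = Xs ! \<sigma> j"
      using block_nth[of p j "p + q"] False assms(3) by simp
    show ?thesis
      unfolding delta_def block_prod_update[OF assms] unfolding block_prod_def n using False
      by (auto simp: fun_eq_iff algebra_simps)
  qed
qed

lemma permutes_preimage:
  assumes "\<sigma> permutes {..<n}" "i < n"
  obtains j where "j < n" "i = \<sigma> j"
  using assms permutes_in_image[OF assms(1)] permutes_surj[OF assms(1)] by (metis lessThan_iff surjD)

text \<open>
  Each \<open>\<delta>\<^sub>i(f)\<close> falls on exactly one of the two factors, so after \<open>n + n' - 1\<close> of them one factor is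
  annihilated.
\<close>

lemma ann_block_prod:
  assumes "\<sigma> permutes {..<p + q}"
  shows "ann p n c \<Longrightarrow> ann q n' c' \<Longrightarrow> n + n' \<le> Suc N \<Longrightarrow> ann (p + q) N (block_prod \<sigma> p q c c')"
proof (induction N arbitrary: n n' c c')
  case *: (0 n n' c c')
  then have "n = 0 \<or> n' = 0" by auto
  then show ?case
    using * block_args[OF _ assms, of _ p 0] block_args[OF _ assms, of _ "p + q" p]
    by (auto simp: block_prod_def)
next
  case (Suc N)
  show ?case
  proof (cases "n = 0 \<or> n' = 0")
    case True
    then show ?thesis
      using Suc.prems block_args[OF _ assms, of _ p 0] block_args[OF _ assms, of _ "p + q" p]
      by (intro ann_zero) (auto simp: block_prod_def)
  next
    case False
    then obtain m m' where m: "n = Suc m" "n' = Suc m'" by (metis not0_implies_Suc)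
    show ?thesis
      unfolding ann.simps
    proof (intro allI impI ballI)
      fix i f assume i: "i < p + q" and f: "f \<in> Cinf"
      obtain j where j: "j < p + q" "i = \<sigma> j" using permutes_preimage[OF assms i] .
      show "ann (p + q) N (delta i f (block_prod \<sigma> p q c c'))"
      proof (cases "j < p")
        case True
        have "ann (p + q) N (block_prod \<sigma> p q (delta j f c) c')"
          using Suc.prems m True f by (intro Suc.IH[of m _ n']) auto
        then show ?thesis
          using True j by (elim ann_cong[rotated]) (simp add: args_def delta_block_prod[OF _ assms])
      next
        case False
        have "ann (p + q) N (block_prod \<sigma> p q c (delta (j - p) f c'))"
          using Suc.prems m False f j by (intro Suc.IH[of n _ m']) auto
        then show ?thesis
          using False j by (elim ann_cong[rotated]) (simp add: args_def delta_block_prod[OF _ assms])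
      qed
    qed
  qed
qed

lemma multilinear_block_prod:
  assumes "\<sigma> permutes {..<p + q}" "multilinear_op p c" "multilinear_op q c'"
  shows "multilinear_op (p + q) (block_prod \<sigma> p q c c')"
  unfolding multilinear_op_def
proof (intro ballI allI impI)
  fix Xs i assume Xs: "Xs \<in> args (p + q)" and i: "i < p + q"
  obtain j where j: "j < p + q" "i = \<sigma> j" using permutes_preimage[OF assms(1) i] .
  have len: "length Xs = p + q" using Xs by (simp add: args_def)
  note upd = block_prod_update[OF len assms(1) j(1)]
  have a: "block \<sigma> 0 p Xs \<in> args p" "block \<sigma> p (p + q) Xs \<in> args q"
    using block_args[OF Xs assms(1), of p 0] block_args[OF Xs assms(1), of "p + q" p] by simp_all
  have n: "block \<sigma> 0 p Xs ! j = Xs ! \<sigma> j" if "j < p"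
    using block_nth[of 0 j p] that by simp
  have n': "block \<sigma> p (p + q) Xs ! (j - p) = Xs ! \<sigma> j" "j - p < q" if "\<not> j < p"
    using block_nth[of p j "p + q"] that j(1) by simp_all
  show "(\<forall>Y\<in>Sec. block_prod \<sigma> p q c c' (Xs[i := Xs ! i + Y]) =
        block_prod \<sigma> p q c c' Xs + block_prod \<sigma> p q c c' (Xs[i := Y])) \<and>
      (\<forall>r. block_prod \<sigma> p q c c' (Xs[i := (\<lambda>_. r) \<odot> Xs ! i]) = (\<lambda>_. r) \<odot> block_prod \<sigma> p q c c' Xs)"
  proof (cases "j < p")
    case True
    then have "\<forall>Y\<in>Sec. c ((block \<sigma> 0 p Xs)[j := Xs ! i + Y]) = c (block \<sigma> 0 p Xs) + c ((block \<sigma> 0 p Xs)[j := Y])"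
      "\<forall>r. c ((block \<sigma> 0 p Xs)[j := (\<lambda>_. r) \<odot> Xs ! i]) = (\<lambda>_. r) \<odot> c (block \<sigma> 0 p Xs)"
      using assms(2) a(1) n unfolding multilinear_op_def j(2) by force+
    then show ?thesis
      unfolding j(2) upd using True by (auto simp: block_prod_def fun_eq_iff algebra_simps)
  next
    case False
    then have "\<forall>Y\<in>Sec. c' ((block \<sigma> p (p + q) Xs)[j - p := Xs ! i + Y]) =
          c' (block \<sigma> p (p + q) Xs) + c' ((block \<sigma> p (p + q) Xs)[j - p := Y])"
      "\<forall>r. c' ((block \<sigma> p (p + q) Xs)[j - p := (\<lambda>_. r) \<odot> Xs ! i]) = (\<lambda>_. r) \<odot> c' (block \<sigma> p (p + q) Xs)"
      using assms(3) a(2) n' unfolding multilinear_op_def j(2) by force+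
    then show ?thesis
      unfolding j(2) upd using False by (auto simp: block_prod_def fun_eq_iff algebra_simps)
  qed
qed

text \<open>A shuffle leaves the last argument in the last place of one of the two factors.\<close>

lemma delta_last_block_prod:
  assumes "\<sigma> \<in> shuffles_perm p q" "p + q > 0" "c \<in> Dsp p" "c' \<in> Dsp q" "f \<in> Cinf" "Xs \<in> args (p + q)"
  shows "delta (p + q - 1) f (block_prod \<sigma> p q c c') Xs = 0"
proof -
  have \<sigma>: "\<sigma> permutes {..<p + q}" "strict_mono_on {..<p} \<sigma>" "strict_mono_on {p..<p + q} \<sigma>"
    using assms(1) by (auto simp: shuffles_perm_def)
  obtain j where j: "j < p + q" "p + q - 1 = \<sigma> j"
    using permutes_preimage[OF \<sigma>(1), of "p + q - 1"] assms(2) by auto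
  have le: "\<sigma> i \<le> \<sigma> j" if "i < p + q" for i
    using permutes_in_image[OF \<sigma>(1), of i] that j(2) by simp
  have len: "length Xs = p + q" using assms(6) by (simp add: args_def)
  have a: "block \<sigma> 0 p Xs \<in> args p" "block \<sigma> p (p + q) Xs \<in> args q"
    using block_args[OF assms(6) \<sigma>(1), of p 0] block_args[OF assms(6) \<sigma>(1), of "p + q" p] by simp_all
  show ?thesis
  proof (cases "j < p")
    case True
    have "p - 1 < p + q" using True by linarith
    then have "\<not> j < p - 1"
      using le[of "p - 1"] strict_mono_onD[OF \<sigma>(2), of j "p - 1"] True by auto
    then have "j = p - 1" using True by linarith
    then have "delta j f c (block \<sigma> 0 p Xs) = 0"
      using Dsp_last[OF assms(3) _ assms(5) a(1)] True by simp
    then show ?thesis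
      unfolding j(2) delta_block_prod[OF len \<sigma>(1) j(1)] using True
      by (auto simp: block_prod_def fun_eq_iff)
  next
    case False
    have "p + q - 1 < p + q" using j(1) by linarith
    then have "\<not> j < p + q - 1"
      using le[of "p + q - 1"] strict_mono_onD[OF \<sigma>(3), of j "p + q - 1"] False by auto
    then have "j = p + q - 1" using j(1) by linarith
    then have "j - p = q - 1" "q > 0" using False j(1) by auto
    then have "delta (j - p) f c' (block \<sigma> p (p + q) Xs) = 0"
      using Dsp_last[OF assms(4) _ assms(5) a(2)] by simp
    then show ?thesis
      unfolding j(2) delta_block_prod[OF len \<sigma>(1) j(1)] using False
      by (auto simp: block_prod_def fun_eq_iff)
  qed
qed

lemma shuffle_prod_homogeneous:
  assumes "c \<in> Dsp p" "c' \<in> Dsp q"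
  shows "(c \<bowtie> c') Xs = (if Xs \<in> args (p + q)
    then \<Sum>\<sigma>\<in>shuffles_perm p q. (\<lambda>_. of_int (sign \<sigma>)) \<odot> block_prod \<sigma> p q c c' Xs else 0)"
proof
  fix x
  define t where "t r \<sigma> = of_int (sign \<sigma>) * c (block \<sigma> 0 r Xs) x * c' (block \<sigma> r (length Xs) Xs) x" for r \<sigma>
  have eq: "(c \<bowtie> c') Xs x = (\<Sum>r\<le>length Xs. \<Sum>\<sigma>\<in>shuffles_perm r (length Xs - r). t r \<sigma>)"
    by (simp add: shuffle_prod_def t_def block_def)
  have z: "t r \<sigma> = 0" if "\<not> (Xs \<in> args (p + q) \<and> r = p)" "r \<le> length Xs"
    "\<sigma> \<in> shuffles_perm r (length Xs - r)" for r \<sigma>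
  proof (rule ccontr)
    assume "t r \<sigma> \<noteq> 0"
    then have "c (block \<sigma> 0 r Xs) \<noteq> 0" "c' (block \<sigma> r (length Xs) Xs) \<noteq> 0"
      by (auto simp: t_def)
    then have *: "block \<sigma> 0 r Xs \<in> args p" "block \<sigma> r (length Xs) Xs \<in> args q"
      using assms Dsp_outside by blast+
    then have len: "r = p" "length Xs = p + q"
      using that(2) by (auto simp: args_def block_def)
    have perm: "\<sigma> permutes {..<length Xs}"
      using that(2,3) by (simp add: shuffles_perm_def)
    have "Xs ! i \<in> Sec" if "i < length Xs" for i
    proof -
      obtain j where j: "j < length Xs" "i = \<sigma> j" using permutes_preimage[OF perm \<open>i < length Xs\<close>] .
      then have "Xs ! i \<in> set (block \<sigma> 0 r Xs) \<union> set (block \<sigma> r (length Xs) Xs)"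
        by (cases "j < r") (auto simp: block_def)
      then show ?thesis using * by (auto simp: args_def)
    qed
    then have "Xs \<in> args (p + q)"
      using len by (auto simp: args_def in_set_conv_nth)
    then show False using that(1) len by simp
  qed
  show "(c \<bowtie> c') Xs x = (if Xs \<in> args (p + q)
    then \<Sum>\<sigma>\<in>shuffles_perm p q. (\<lambda>_. of_int (sign \<sigma>)) \<odot> block_prod \<sigma> p q c c' Xs else 0) x"
  proof (cases "Xs \<in> args (p + q)")
    case False
    then have "(c \<bowtie> c') Xs x = 0"
      unfolding eq using z by (intro sum.neutral ballI) auto
    then show ?thesis using False by simp
  next
    case True
    then have len: "length Xs = p + q" by (simp add: args_def)
    have "(c \<bowtie> c') Xs x = (\<Sum>r\<in>{p}. \<Sum>\<sigma>\<in>shuffles_perm r (length Xs - r). t r \<sigma>)"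
      unfolding eq using z len by (intro sum.mono_neutral_right) (auto intro!: sum.neutral)
    also have "\<dots> = (\<Sum>\<sigma>\<in>shuffles_perm p q. t p \<sigma>)"
      using len by simp
    finally show ?thesis
      using True len by (simp add: sum_fun_apply t_def block_prod_def mult.assoc)
  qed
qed

lemma shuffle_prod_Dsp:
  assumes "c \<in> Dsp p" "c' \<in> Dsp q"
  shows "c \<bowtie> c' \<in> Dsp (p + q)"
proof -
  let ?D = "\<lambda>Xs. \<Sum>\<sigma>\<in>shuffles_perm p q. (\<lambda>_. of_int (sign \<sigma>)) \<odot> block_prod \<sigma> p q c c' Xs"
  have eq: "(c \<bowtie> c') Xs = ?D Xs" if "Xs \<in> args (p + q)" for Xs
    using shuffle_prod_homogeneous[OF assms, of Xs] that by (simp only: if_True)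
  have perm: "\<sigma> permutes {..<p + q}" if "\<sigma> \<in> shuffles_perm p q" for \<sigma>
    using that by (simp add: shuffles_perm_def)
  have A: "ann (p + q) (max (p + q) 1) ?D"
    using assms Dsp_ann perm
    by (intro ann_sum ann_fmult ann_block_prod[where n = "max p 1" and n' = "max q 1"]) auto
  have M: "multilinear_op (p + q) ?D"
    using assms Dsp_multilinear perm by (intro multilinear_sum multilinear_fmult multilinear_block_prod) auto
  have C: "?D Xs \<in> Cinf" if "Xs \<in> args (p + q)" for Xs
  proof (rule Cinf_sum, rule Cinf_fmult[OF Cinf_const])
    fix \<sigma> assume "\<sigma> \<in> shuffles_perm p q"
    then have "c (block \<sigma> 0 p Xs) \<in> Cinf" "c' (block \<sigma> p (p + q) Xs) \<in> Cinf"
      using block_args[OF that perm, of \<sigma> p 0] block_args[OF that perm, of \<sigma> "p + q" p]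
        Dsp_Cinf[OF assms(1)] Dsp_Cinf[OF assms(2)] by simp_all
    then show "block_prod \<sigma> p q c c' Xs \<in> Cinf"
      unfolding block_prod_def by (rule Cinf_fmult)
  qed
  have L: "delta (p + q - 1) f (c \<bowtie> c') Xs = 0"
    if "p + q > 0" "f \<in> Cinf" "Xs \<in> args (p + q)" for f Xs
  proof -
    have "delta (p + q - 1) f (c \<bowtie> c') Xs = ?D (Xs[p + q - 1 := f \<odot> Xs ! (p + q - 1)]) - f \<odot> ?D Xs"
      unfolding delta_def using that by (subst (1 2) eq) (auto intro!: args_update_fmult)
    also have "\<dots> = (\<Sum>\<sigma>\<in>shuffles_perm p q. (\<lambda>_. of_int (sign \<sigma>)) \<odot>
        delta (p + q - 1) f (block_prod \<sigma> p q c c') Xs)"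
      by (auto simp: fun_eq_iff delta_def sum_fun_apply sum_subtractf sum_distrib_left algebra_simps)
    also have "\<dots> = 0"
      using delta_last_block_prod[OF _ that(1) assms that(2,3)] by (intro sum.neutral) simp
    finally show ?thesis .
  qed
  show ?thesis
    unfolding Dsp_iff
  proof (intro conjI allI impI ballI)
    show "(c \<bowtie> c') Xs = 0" if "Xs \<notin> args (p + q)" for Xs
      using shuffle_prod_homogeneous[OF assms, of Xs] that by (simp only: if_False)
    show "(c \<bowtie> c') Xs \<in> Cinf" if "Xs \<in> args (p + q)" for Xs
      unfolding eq[OF that] by (rule C[OF that])
    show "multilinear_op (p + q) (c \<bowtie> c')"
      by (rule multilinear_cong[OF eq[symmetric] M])
    show "ann (p + q) (max (p + q) 1) (c \<bowtie> c')"
      by (rule ann_cong[OF eq[symmetric] A])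
  qed (rule L)
qed

end

lemma shuffle_prod_add_right: "c \<bowtie> (a + b) = c \<bowtie> a + c \<bowtie> b"
  by (auto simp: fun_eq_iff shuffle_prod_def algebra_simps sum.distrib)

lemma shuffle_prod_zero_right: "c \<bowtie> 0 = 0"
  by (auto simp: fun_eq_iff shuffle_prod_def)

lemma (in vector_bundle) shuffle_prod_Dtot: "c' \<in> Dtot \<Longrightarrow> c \<in> Dsp p \<Longrightarrow> c \<bowtie> c' \<in> Dtot"
proof (induction c' rule: Dtot_induct)
  case zero
  then show ?case using Dsp_zero[THEN Dsp_subset_Dtot] by (simp only: shuffle_prod_zero_right)
next
  case (add k a b)
  then show ?case
    unfolding shuffle_prod_add_right by (blast intro: Dtot_add Dsp_subset_Dtot shuffle_prod_Dsp)
qed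

section \<open>Anchors\<close>

definition omit :: "nat \<Rightarrow> 'a list \<Rightarrow> 'a list" where
  "omit i Xs = take i Xs @ drop (Suc i) Xs"

lemma omit_update_same: "omit i (Xs[i := Z]) = omit i Xs"
  by (simp add: omit_def)

lemma omit_update:
  assumes "l \<noteq> i" "l < length Xs" "i < length Xs"
  shows "omit i (Xs[l := Z]) = (omit i Xs)[(if l < i then l else l - 1) := Z]"
    "omit i Xs ! (if l < i then l else l - 1) = Xs ! l"
    "(if l < i then l else l - 1) < length Xs - 1"
  using assms
  by (auto simp: omit_def take_update_swap drop_update_swap list_update_append nth_append not_less list_update_beyond)

context vector_bundle
begin

text \<open>
  The anchor is encoded by its action on functions: \<open>\<rho> X\<close> is a derivation for each section \<open>X\<close>, and it
  depends on \<open>X\<close> function-linearly.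
\<close>

definition is_anchor :: "(('m \<Rightarrow> 'f) \<Rightarrow> ('m \<Rightarrow> real) \<Rightarrow> 'm \<Rightarrow> real) \<Rightarrow> bool" where
  "is_anchor \<rho> \<longleftrightarrow>
     (\<forall>X\<in>Sec. \<forall>f\<in>Cinf. \<rho> X f \<in> Cinf) \<and>
     (\<forall>X\<in>Sec. \<forall>f\<in>Cinf. \<forall>g\<in>Cinf. \<rho> X (f + g) = \<rho> X f + \<rho> X g) \<and>
     (\<forall>X\<in>Sec. \<forall>f\<in>Cinf. \<forall>g\<in>Cinf. \<rho> X (f \<odot> g) = f \<odot> \<rho> X g + \<rho> X f \<odot> g) \<and>
     (\<forall>X\<in>Sec. \<forall>Y\<in>Sec. \<forall>f\<in>Cinf. \<rho> (X + Y) f = \<rho> X f + \<rho> Y f) \<and>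
     (\<forall>X\<in>Sec. \<forall>f\<in>Cinf. \<forall>g\<in>Cinf. \<rho> (f \<odot> X) g = f \<odot> \<rho> X g) \<and>
     (\<forall>X\<in>Sec. \<forall>r. \<rho> X (\<lambda>_. r) = 0)"

lemma anchor_Cinf: "is_anchor \<rho> \<Longrightarrow> X \<in> Sec \<Longrightarrow> f \<in> Cinf \<Longrightarrow> \<rho> X f \<in> Cinf"
  and anchor_add: "is_anchor \<rho> \<Longrightarrow> X \<in> Sec \<Longrightarrow> f \<in> Cinf \<Longrightarrow> g \<in> Cinf \<Longrightarrow> \<rho> X (f + g) = \<rho> X f + \<rho> X g"
  and anchor_mult: "is_anchor \<rho> \<Longrightarrow> X \<in> Sec \<Longrightarrow> f \<in> Cinf \<Longrightarrow> g \<in> Cinf \<Longrightarrow>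
    \<rho> X (f \<odot> g) = f \<odot> \<rho> X g + \<rho> X f \<odot> g"
  and anchor_add_left: "is_anchor \<rho> \<Longrightarrow> X \<in> Sec \<Longrightarrow> Y \<in> Sec \<Longrightarrow> f \<in> Cinf \<Longrightarrow> \<rho> (X + Y) f = \<rho> X f + \<rho> Y f"
  and anchor_fmult_left: "is_anchor \<rho> \<Longrightarrow> X \<in> Sec \<Longrightarrow> f \<in> Cinf \<Longrightarrow> g \<in> Cinf \<Longrightarrow> \<rho> (f \<odot> X) g = f \<odot> \<rho> X g"
  and anchor_const: "is_anchor \<rho> \<Longrightarrow> X \<in> Sec \<Longrightarrow> \<rho> X (\<lambda>_. r) = 0"
  unfolding is_anchor_def by blast+

lemma anchor_zero: "is_anchor \<rho> \<Longrightarrow> X \<in> Sec \<Longrightarrow> \<rho> X 0 = 0"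
  using anchor_add[of \<rho> X 0 0] Cinf_zero by simp

lemma anchor_diff:
  assumes "is_anchor \<rho>" "X \<in> Sec" "f \<in> Cinf" "g \<in> Cinf"
  shows "\<rho> X (f - g) = \<rho> X f - \<rho> X g"
  using anchor_add[OF assms(1,2) Cinf_diff[OF assms(3,4)] assms(4)] by (simp add: algebra_simps)

lemma omit_args: "Xs \<in> args (Suc k) \<Longrightarrow> i \<le> k \<Longrightarrow> omit i Xs \<in> args k"
  using set_take_subset[of i Xs] set_drop_subset[of "Suc i" Xs] by (auto simp: args_def omit_def)

lemma ann_tensor_omit:
  assumes "\<And>X f. X \<in> Sec \<Longrightarrow> f \<in> Cinf \<Longrightarrow> T (f \<odot> X) = f \<odot> T X" "i \<le> k"
  shows "ann k n c \<Longrightarrow> ann (Suc k) n (\<lambda>Xs. T (Xs ! i) \<odot> c (omit i Xs))"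
proof (induction n arbitrary: c)
  case 0
  then show ?case using omit_args assms(2) by auto
next
  case (Suc n)
  show ?case
    unfolding ann.simps
  proof (intro allI impI ballI)
    fix l f assume l: "l < Suc k" and f: "f \<in> Cinf"
    show "ann (Suc k) n (delta l f (\<lambda>Xs. T (Xs ! i) \<odot> c (omit i Xs)))"
    proof (cases "l = i")
      case True
      show ?thesis
      proof (rule ann_zero)
        fix Xs assume "Xs \<in> args (Suc k)"
        then have "T (f \<odot> Xs ! i) = f \<odot> T (Xs ! i)" "length Xs = Suc k"
          using assms args_nth f by (auto simp: args_def)
        then show "delta l f (\<lambda>Xs. T (Xs ! i) \<odot> c (omit i Xs)) Xs = 0"
          using True l by (simp add: delta_def omit_update_same) (simp add: fmult_def mult_ac)
      qed
    next
      case False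
      define l' where "l' = (if l < i then l else l - 1)"
      have "l' < k" using False l assms(2) by (auto simp: l'_def)
      then have "ann (Suc k) n (\<lambda>Xs. T (Xs ! i) \<odot> delta l' f c (omit i Xs))"
        using Suc.prems f by (intro Suc.IH) auto
      then show ?thesis
      proof (rule ann_cong[rotated])
        fix Xs assume Xs: "Xs \<in> args (Suc k)"
        then have len: "length Xs = Suc k" by (simp add: args_def)
        have u: "omit i (Xs[l := Z]) = (omit i Xs)[l' := Z]" "omit i Xs ! l' = Xs ! l" for Z
          using omit_update[of l i Xs] False l assms(2) by (simp_all add: len l'_def)
        show "T (Xs ! i) \<odot> delta l' f c (omit i Xs) = delta l f (\<lambda>Xs. T (Xs ! i) \<odot> c (omit i Xs)) Xs"
          unfolding delta_def u using False by (auto simp: fun_eq_iff algebra_simps)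
      qed
    qed
  qed
qed

text \<open>
  Since \<open>\<rho>(X)\<close> is a vector field, \<open>\<delta>\<^sub>l(f)\<close> of the new operator is the operator built from \<open>\<delta>\<^sub>l(f) c\<close>
  plus the term \<open>\<rho>(X)(f) c\<close>, in which \<open>X\<close> enters tensorially. The degree grows by one.
\<close>

lemma ann_anchor_omit:
  assumes "is_anchor \<rho>" "i \<le> k"
  shows "ann k n c \<Longrightarrow> (\<And>Xs. Xs \<in> args k \<Longrightarrow> c Xs \<in> Cinf) \<Longrightarrow>
    ann (Suc k) (Suc n) (\<lambda>Xs. \<rho> (Xs ! i) (c (omit i Xs)))"
proof (induction n arbitrary: c)
  case 0
  have "\<rho> (Xs ! i) (c (omit i Xs)) = 0" if "Xs \<in> args (Suc k)" for Xs
    using 0 that omit_args[OF that assms(2)] args_nth[OF that, of i] assms anchor_zero[OF assms(1)] by simp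
  then show ?case by (intro ann_zero)
next
  case (Suc n)
  show ?case
    unfolding ann.simps(2)[of _ "Suc n"]
  proof (intro allI impI ballI)
    fix l f assume l: "l < Suc k" and f: "f \<in> Cinf"
    show "ann (Suc k) (Suc n) (delta l f (\<lambda>Xs. \<rho> (Xs ! i) (c (omit i Xs))))"
    proof (cases "l = i")
      case True
      show ?thesis
      proof (rule ann_zero)
        fix Xs assume Xs: "Xs \<in> args (Suc k)"
        then have "\<rho> (f \<odot> Xs ! i) (c (omit i Xs)) = f \<odot> \<rho> (Xs ! i) (c (omit i Xs))"
          using Suc.prems(2) omit_args[OF Xs assms(2)] args_nth[OF Xs, of i] f assms
          by (intro anchor_fmult_left) auto
        moreover have "length Xs = Suc k" using Xs by (simp add: args_def)
        ultimately show "delta l f (\<lambda>Xs. \<rho> (Xs ! i) (c (omit i Xs))) Xs = 0"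
          using True l by (simp add: delta_def omit_update_same)
      qed
    next
      case False
      define l' where "l' = (if l < i then l else l - 1)"
      have l': "l' < k" using False l assms(2) by (auto simp: l'_def)
      have \<delta>: "delta l' f c Xs \<in> Cinf" if "Xs \<in> args k" for Xs
        unfolding delta_def using Suc.prems(2) that args_update_fmult[OF that f l'] f
        by (intro Cinf_diff Cinf_fmult) auto
      have "ann (Suc k) (Suc n) (\<lambda>Xs. \<rho> (Xs ! i) (delta l' f c (omit i Xs)))"
        using Suc.prems f l' \<delta> by (intro Suc.IH) auto
      moreover have "ann (Suc k) (Suc n) (\<lambda>Xs. \<rho> (Xs ! i) f \<odot> c (omit i Xs))"
        using assms f Suc.prems(1) by (intro ann_tensor_omit anchor_fmult_left)
      ultimately have "ann (Suc k) (Suc n)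
          (\<lambda>Xs. \<rho> (Xs ! i) (delta l' f c (omit i Xs)) + \<rho> (Xs ! i) f \<odot> c (omit i Xs))"
        by (rule ann_add)
      then show ?thesis
      proof (rule ann_cong[rotated])
        fix Xs assume Xs: "Xs \<in> args (Suc k)"
        then have len: "length Xs = Suc k" by (simp add: args_def)
        have u: "omit i (Xs[l := Z]) = (omit i Xs)[l' := Z]" "omit i Xs ! l' = Xs ! l" for Z
          using omit_update[of l i Xs] False l assms(2) by (simp_all add: len l'_def)
        note o = omit_args[OF Xs assms(2)]
        have X: "Xs ! i \<in> Sec" using args_nth[OF Xs, of i] assms(2) by simp
        let ?Ys = "omit i Xs" let ?c = "c ((omit i Xs)[l' := f \<odot> Xs ! l])"
        have c: "c ?Ys \<in> Cinf" "?c \<in> Cinf"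
          using Suc.prems(2) o args_update_fmult[OF o f l'] u(2) by auto
        have "\<rho> (Xs ! i) (delta l' f c ?Ys) = \<rho> (Xs ! i) ?c - \<rho> (Xs ! i) (f \<odot> c ?Ys)"
          unfolding delta_def u(2) using assms(1) X c f by (intro anchor_diff Cinf_fmult)
        also have "\<rho> (Xs ! i) (f \<odot> c ?Ys) = f \<odot> \<rho> (Xs ! i) (c ?Ys) + \<rho> (Xs ! i) f \<odot> c ?Ys"
          using assms(1) X c f by (intro anchor_mult)
        finally have e: "\<rho> (Xs ! i) (delta l' f c ?Ys) =
            \<rho> (Xs ! i) ?c - (f \<odot> \<rho> (Xs ! i) (c ?Ys) + \<rho> (Xs ! i) f \<odot> c ?Ys)" .
        have e': "delta l f (\<lambda>Xs. \<rho> (Xs ! i) (c (omit i Xs))) Xs = \<rho> (Xs ! i) ?c - f \<odot> \<rho> (Xs ! i) (c ?Ys)"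
          unfolding delta_def u nth_list_update_neq[OF False] ..
        show "\<rho> (Xs ! i) (delta l' f c ?Ys) + \<rho> (Xs ! i) f \<odot> c ?Ys =
            delta l f (\<lambda>Xs. \<rho> (Xs ! i) (c (omit i Xs))) Xs"
          unfolding e e' by (auto simp: fun_eq_iff)
      qed
    qed
  qed
qed

section \<open>From homological vector fields to Loday algebroids\<close>

subsection \<open>Operators with few arguments\<close>

lemma args_0: "Xs \<in> args 0 \<longleftrightarrow> Xs = []"
  by (auto simp: args_def)

lemma args_2_iff: "Xs \<in> args 2 \<longleftrightarrow> (\<exists>X\<in>Sec. \<exists>Y\<in>Sec. Xs = [X, Y])"
  by (auto simp: args_def numeral_2_eq_2 length_Suc_conv)

lemma ball_args_2: "(\<forall>Xs\<in>args 2. P Xs) \<longleftrightarrow> (\<forall>X\<in>Sec. \<forall>Y\<in>Sec. P [X, Y])"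
  using args_2_iff by auto

lemma fun_op_Dsp_0: "f \<in> Cinf \<Longrightarrow> fun_op f \<in> Dsp 0"
  by (simp add: Dsp_def args_0 fun_op_def)

lemma fun_op_add: "fun_op (f + g) = fun_op f + fun_op g"
  by (auto simp: fun_op_def)

lemma fun_op_shuffle: "fun_op f \<bowtie> c = scal f c"
proof (intro ext)
  fix Xs :: "('m \<Rightarrow> 'f) list" and x
  show "(fun_op f \<bowtie> c) Xs x = scal f c Xs x"
  proof (induction Xs arbitrary: c)
    case Nil
    then show ?case by (simp add: shuffle_prod_Nil fun_op_def scal_def)
  next
    case (Cons X Xs)
    have "contr X (fun_op f) = 0" "invol (fun_op f) = fun_op f"
      by (auto simp: contr_def invol_def fun_op_def fun_eq_iff)
    moreover have "(0 \<bowtie> c) Xs x = 0"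
      by (simp add: shuffle_prod_def)
    ultimately show ?case
      by (simp only: shuffle_prod_Cons Cons.IH) (simp add: scal_def contr_def)
  qed
qed

lemma Sec_eqI:
  assumes "X \<in> Sec" "Y \<in> Sec" "\<And>l. l \<in> DualSec \<Longrightarrow> l [X] = l [Y]"
  shows "X = Y"
proof
  show "X p = Y p" for p
    using assms(1,2) by (rule DualSec_separates) (use assms(3) in auto)
qed

lemma multilinear_2_iff:
  "multilinear_op 2 c \<longleftrightarrow> (\<forall>X\<in>Sec. \<forall>Y\<in>Sec.
     (\<forall>Z\<in>Sec. c [X + Z, Y] = c [X, Y] + c [Z, Y]) \<and> (\<forall>r. c [(\<lambda>_. r) \<odot> X, Y] = (\<lambda>_. r) \<odot> c [X, Y]) \<and>
     (\<forall>Z\<in>Sec. c [X, Y + Z] = c [X, Y] + c [X, Z]) \<and> (\<forall>r. c [X, (\<lambda>_. r) \<odot> Y] = (\<lambda>_. r) \<odot> c [X, Y]))"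
proof -
  have "(\<forall>i<2. P i) \<longleftrightarrow> P 0 \<and> P 1" for P :: "nat \<Rightarrow> bool"
    by (auto simp: less_2_cases_iff One_nat_def)
  then show ?thesis
    unfolding multilinear_op_def ball_args_2 by (simp add: One_nat_def conj_assoc)
qed

text \<open>
  Dual sections are function-linear, hence commute with \<open>\<delta>\<^sub>i(f)\<close>, and they separate sections. Thus
  the degree of a section-valued operator can be tested after pairing.
\<close>

lemma ann_Sec_valued:
  fixes D :: "('m \<Rightarrow> 'f) list \<Rightarrow> 'm \<Rightarrow> 'f"
  shows "(\<And>Xs. Xs \<in> args k \<Longrightarrow> D Xs \<in> Sec) \<Longrightarrow> (\<And>l. l \<in> DualSec \<Longrightarrow> ann k n (\<lambda>Xs. l [D Xs])) \<Longrightarrow> ann k n D"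
proof (induction n arbitrary: D)
  case 0
  have "D Xs = 0" if Xs: "Xs \<in> args k" for Xs
  proof (rule Sec_eqI[OF 0(1)[OF Xs] Sec_zero])
    fix l assume l: "l \<in> DualSec"
    have "l [0] = l [0] + l [0]"
      using Dsp_1_add[of l 0 0] l Sec_zero by (simp add: Dsp_1_eq_DualSec)
    then show "l [D Xs] = l [0]" using 0(2)[OF l] Xs by simp
  qed
  then show ?case by simp
next
  case (Suc n)
  show ?case
    unfolding ann.simps
  proof (intro allI impI ballI, rule Suc.IH)
    fix i f assume i: "i < k" and f: "f \<in> Cinf"
    have S: "D (Xs[i := f \<odot> Xs ! i]) \<in> Sec" "f \<odot> D Xs \<in> Sec" "delta i f D Xs \<in> Sec" if "Xs \<in> args k" for Xs
      using Suc.prems(1) that args_update_fmult[OF that f i] f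
      by (auto simp: delta_def intro: Sec_diff Sec_fmult)
    show "delta i f D Xs \<in> Sec" if "Xs \<in> args k" for Xs
      by (rule S[OF that])
    fix l assume l: "l \<in> DualSec"
    have "ann k n (delta i f (\<lambda>Xs. l [D Xs]))"
      using Suc.prems(2)[OF l] i f by simp
    then show "ann k n (\<lambda>Xs. l [delta i f D Xs])"
    proof (rule ann_cong[rotated])
      fix Xs assume Xs: "Xs \<in> args k"
      have l1: "l \<in> Dsp 1" using l by (simp add: Dsp_1_eq_DualSec)
      have "l [delta i f D Xs + f \<odot> D Xs] = l [delta i f D Xs] + l [f \<odot> D Xs]"
        using S[OF Xs] by (intro Dsp_1_add[OF l1])
      moreover have "l [f \<odot> D Xs] = f \<odot> l [D Xs]"
        using Suc.prems(1)[OF Xs] f by (intro Dsp_1_fmult[OF l1])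
      moreover have "delta i f D Xs + f \<odot> D Xs = D (Xs[i := f \<odot> Xs ! i])"
        by (simp add: delta_def)
      ultimately show "delta i f (\<lambda>Xs. l [D Xs]) Xs = l [delta i f D Xs]"
        by (simp add: delta_def[of i f "\<lambda>Xs. l [D Xs]"])
    qed
  qed
qed

subsection \<open>The anchor and the bracket of a derivation\<close>

lemma derivation_Dsp: "deg1_derivation d \<Longrightarrow> c \<in> Dsp k \<Longrightarrow> d c \<in> Dsp (Suc k)"
  and derivation_add: "deg1_derivation d \<Longrightarrow> c \<in> Dtot \<Longrightarrow> c' \<in> Dtot \<Longrightarrow> d (c + c') = d c + d c'"
  and derivation_shuffle: "deg1_derivation d \<Longrightarrow> c \<in> Dsp k \<Longrightarrow> c' \<in> Dtot \<Longrightarrow>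
    d (c \<bowtie> c') = d c \<bowtie> c' + (\<lambda>Xs p. (-1) ^ k * (c \<bowtie> d c') Xs p)"
  unfolding deg1_derivation_def by blast+

lemma d_fun_op: "deg1_derivation d \<Longrightarrow> f \<in> Cinf \<Longrightarrow> d (fun_op f) \<in> Dsp 1"
  using derivation_Dsp[of d "fun_op f" 0] fun_op_Dsp_0 by (simp add: One_nat_def)

lemma d_DualSec: "deg1_derivation d \<Longrightarrow> l \<in> DualSec \<Longrightarrow> d l \<in> Dsp 2"
  using derivation_Dsp[of d l 1] unfolding Dsp_1_eq_DualSec Suc_1 by blast

lemma Dsp_1_zero_arg: "l \<in> Dsp 1 \<Longrightarrow> l [] = 0" "l \<in> Dsp 1 \<Longrightarrow> l [X, Y] = 0"
  by (rule Dsp_1_outside; simp add: args_def)+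

lemma Dsp_1_shuffle_Dsp_1:
  assumes "l \<in> Dsp 1" "l' \<in> Dsp 1"
  shows "(l \<bowtie> l') [X, Y] = l [X] \<odot> l' [Y] - l [Y] \<odot> l' [X]"
  using Dsp_1_zero_arg[OF assms(1)] Dsp_1_zero_arg[OF assms(2)]
  by (auto simp: fun_eq_iff shuffle_prod_Cons shuffle_prod_Nil contr_def invol_def)

text \<open>
  The Leibniz rule of \<open>\<rho>(X)\<close> is the derivation property of \<open>d\<close> on the product of two functions;
  function-linearity in \<open>X\<close> holds because \<open>d f\<close> is an operator of degree \<open>1\<close>.
\<close>

lemma is_anchor_anchor:
  assumes "deg1_derivation d"
  shows "is_anchor (anchor d)"
  unfolding is_anchor_def anchor_def
proof (intro conjI ballI allI)
  note D = d_fun_op[OF assms]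
  fix X assume X: "X \<in> Sec"
  {
    fix f assume f: "f \<in> Cinf"
    show "d (fun_op f) [X] \<in> Cinf" using D[OF f] X by (rule Dsp_1_Cinf)
    show "d (fun_op f) [X + Y] = d (fun_op f) [X] + d (fun_op f) [Y]" if "Y \<in> Sec" for Y
      using D[OF f] X that by (rule Dsp_1_add)
    fix g assume g: "g \<in> Cinf"
    note fg = Dsp_subset_Dtot[OF fun_op_Dsp_0[OF f]] Dsp_subset_Dtot[OF fun_op_Dsp_0[OF g]]
    show "d (fun_op (f + g)) [X] = d (fun_op f) [X] + d (fun_op g) [X]"
      unfolding fun_op_add derivation_add[OF assms fg] by simp
    show "d (fun_op g) [f \<odot> X] = f \<odot> d (fun_op g) [X]"
      using D[OF g] f X by (rule Dsp_1_fmult)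
    have "fun_op (f \<odot> g) = fun_op f \<bowtie> fun_op g"
      unfolding fun_op_shuffle by (auto simp: scal_def fun_op_def)
    then have "d (fun_op (f \<odot> g)) [X] p = (d (fun_op f) \<bowtie> fun_op g) [X] p + (fun_op f \<bowtie> d (fun_op g)) [X] p" for p
      using derivation_shuffle[OF assms fun_op_Dsp_0[OF f] fg(2)] by simp
    moreover have "(d (fun_op f) \<bowtie> fun_op g) [X] p = d (fun_op f) [X] p * g p" for p
      by (simp add: shuffle_prod_Cons shuffle_prod_Nil contr_def invol_def fun_op_def)
    ultimately show "d (fun_op (f \<odot> g)) [X] = f \<odot> d (fun_op g) [X] + d (fun_op f) [X] \<odot> g"
      by (auto simp: fun_eq_iff fun_op_shuffle scal_def)
  }
  note mult = this
  fix r
  have "d (fun_op ((\<lambda>_. 1) \<odot> (\<lambda>_. 1))) [X] =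
      (\<lambda>_. 1) \<odot> d (fun_op (\<lambda>_. 1)) [X] + d (fun_op (\<lambda>_. 1)) [X] \<odot> (\<lambda>_. 1)"
    by (rule mult[OF Cinf_const Cinf_const])
  then have one: "d (fun_op (\<lambda>_. 1)) [X] = 0"
    by (simp add: fmult_def fun_eq_iff)
  have "fun_op (\<lambda>_. r) = (\<lambda>Xs. (\<lambda>_. r) \<odot> fun_op (\<lambda>_. 1) Xs)"
    by (auto simp: fun_op_def fun_eq_iff)
  moreover have "d (\<lambda>Xs. (\<lambda>_. r) \<odot> fun_op (\<lambda>_. 1) Xs) = (\<lambda>Xs. (\<lambda>_. r) \<odot> d (fun_op (\<lambda>_. 1)) Xs)"
    using assms Dsp_subset_Dtot[OF fun_op_Dsp_0[OF Cinf_const]] unfolding deg1_derivation_def by blast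
  ultimately have "d (fun_op (\<lambda>_. r)) = (\<lambda>Xs. (\<lambda>_. r) \<odot> d (fun_op (\<lambda>_. 1)) Xs)"
    by (simp only:)
  then show "d (fun_op (\<lambda>_. r)) [X] = 0"
    using one by (auto simp: fun_eq_iff)
qed

lemma d_scal_DualSec:
  assumes "deg1_derivation d" "f \<in> Cinf" "l \<in> DualSec"
  shows "d (scal f l) [X, Y] = anchor d X f \<odot> l [Y] - anchor d Y f \<odot> l [X] + f \<odot> d l [X, Y]"
proof -
  have l: "l \<in> Dsp 1" using assms(3) by (simp add: Dsp_1_eq_DualSec)
  have "d (scal f l) = d (fun_op f) \<bowtie> l + scal f (d l)"
    using derivation_shuffle[OF assms(1) fun_op_Dsp_0[OF assms(2)] Dsp_subset_Dtot[OF l]]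
    by (simp add: fun_op_shuffle)
  then show ?thesis
    by (simp only: plus_fun_apply Dsp_1_shuffle_Dsp_1[OF d_fun_op[OF assms(1,2)] l] anchor_def)
      (simp add: scal_def)
qed

lemma DualSec_Cinf: "l \<in> DualSec \<Longrightarrow> X \<in> Sec \<Longrightarrow> l [X] \<in> Cinf"
  and DualSec_add: "l \<in> DualSec \<Longrightarrow> X \<in> Sec \<Longrightarrow> Y \<in> Sec \<Longrightarrow> l [X + Y] = l [X] + l [Y]"
  and DualSec_fmult: "l \<in> DualSec \<Longrightarrow> f \<in> Cinf \<Longrightarrow> X \<in> Sec \<Longrightarrow> l [f \<odot> X] = f \<odot> l [X]"
  using Dsp_1_Cinf Dsp_1_add Dsp_1_fmult unfolding Dsp_1_eq_DualSec by blast+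

lemma DualSec_diff:
  assumes "l \<in> DualSec" "X \<in> Sec" "Y \<in> Sec"
  shows "l [X - Y] = l [X] - l [Y]"
  using DualSec_add[OF assms(1) Sec_diff[OF assms(2,3)] assms(3)] by (simp add: algebra_simps)

text \<open>
  The defining expression of the bracket is function-linear in \<open>l\<close>: the derivatives of \<open>f\<close> produced by
  the two anchor terms cancel against \<open>d f \<bowtie> l\<close> in \<open>d (f l)\<close>. Hence it is given by a section.
\<close>

lemma bracket_spec:
  assumes "deg1_derivation d" "X \<in> Sec" "Y \<in> Sec"
  shows "bracket d X Y \<in> Sec"
    and "l \<in> DualSec \<Longrightarrow> l [bracket d X Y] = anchor d X (l [Y]) - anchor d Y (l [X]) - d l [X, Y]"
proof -
  note A = is_anchor_anchor[OF assms(1)]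
  have XY: "[X, Y] \<in> args 2" using assms by (auto simp: args_2_iff)
  define F where "F l = anchor d X (l [Y]) - anchor d Y (l [X]) - d l [X, Y]"
    for l :: "('m \<Rightarrow> 'f) list \<Rightarrow> 'm \<Rightarrow> real"
  have ex: "\<exists>!Z. Z \<in> Sec \<and> (\<forall>l\<in>DualSec. l [Z] = F l)"
  proof (rule DualSec_functional_eq_section)
    fix l assume l: "l \<in> DualSec"
    note lC = DualSec_Cinf[OF l assms(2)] DualSec_Cinf[OF l assms(3)]
    show "F l \<in> Cinf"
      unfolding F_def using lC assms
      by (intro Cinf_diff anchor_Cinf[OF A] Dsp_Cinf[OF d_DualSec[OF assms(1) l] XY])
    show "F (l + l') = F l + F l'" if l': "l' \<in> DualSec" for l'
    proof -
      have "l \<in> Dtot" "l' \<in> Dtot"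
        using l l' Dsp_subset_Dtot[of _ 1] by (auto simp: Dsp_1_eq_DualSec)
      then have "d (l + l') = d l + d l'" by (rule derivation_add[OF assms(1)])
      moreover have "anchor d X (l [Y] + l' [Y]) = anchor d X (l [Y]) + anchor d X (l' [Y])"
        "anchor d Y (l [X] + l' [X]) = anchor d Y (l [X]) + anchor d Y (l' [X])"
        using lC assms l' by (auto intro!: anchor_add[OF A] DualSec_Cinf)
      ultimately show ?thesis
        unfolding F_def by (simp only: plus_fun_apply) (simp add: algebra_simps)
    qed
    show "F (scal f l) = f \<odot> F l" if f: "f \<in> Cinf" for f
    proof -
      have "anchor d X (f \<odot> l [Y]) = f \<odot> anchor d X (l [Y]) + anchor d X f \<odot> l [Y]"
        "anchor d Y (f \<odot> l [X]) = f \<odot> anchor d Y (l [X]) + anchor d Y f \<odot> l [X]"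
        using anchor_mult[OF A _ f] lC assms by auto
      moreover have "scal f l [Y] = f \<odot> l [Y]" "scal f l [X] = f \<odot> l [X]"
        by (simp_all add: scal_def)
      ultimately show ?thesis
        unfolding F_def d_scal_DualSec[OF assms(1) f l]
        by (simp only:) (auto simp: fun_eq_iff algebra_simps)
    qed
  qed
  have "bracket d X Y = (THE Z. Z \<in> Sec \<and> (\<forall>l\<in>DualSec. l [Z] = F l))"
    unfolding bracket_def F_def using assms(2,3) by (simp only: if_True simp_thms)
  then have "bracket d X Y \<in> Sec \<and> (\<forall>l\<in>DualSec. l [bracket d X Y] = F l)"
    by (rule ssubst) (rule theI'[OF ex])
  then show "bracket d X Y \<in> Sec"
    "l \<in> DualSec \<Longrightarrow> l [bracket d X Y] = anchor d X (l [Y]) - anchor d Y (l [X]) - d l [X, Y]"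
    unfolding F_def by blast+
qed

text \<open>
  \<open>d l\<close> has degree \<open>0\<close> in its last argument, so only the first anchor term differentiates \<open>f\<close>.
\<close>

lemma bracket_fmult_right:
  assumes "deg1_derivation d" "X \<in> Sec" "Y \<in> Sec" "f \<in> Cinf"
  shows "bracket d X (f \<odot> Y) - f \<odot> bracket d X Y = anchor d X f \<odot> Y"
proof (rule Sec_eqI)
  note A = is_anchor_anchor[OF assms(1)]
  have fY: "f \<odot> Y \<in> Sec" using assms by (intro Sec_fmult)
  note S = bracket_spec(1)[OF assms(1,2) fY] bracket_spec(1)[OF assms(1-3)]
  show "bracket d X (f \<odot> Y) - f \<odot> bracket d X Y \<in> Sec" "anchor d X f \<odot> Y \<in> Sec"
    using S assms by (auto intro!: Sec_diff Sec_fmult anchor_Cinf[OF A])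
  fix l assume l: "l \<in> DualSec"
  have "delta (2 - 1) f (d l) [X, Y] = 0"
    using assms by (intro Dsp_last[OF d_DualSec[OF assms(1) l]]) (auto simp: args_2_iff)
  then have dl: "d l [X, f \<odot> Y] = f \<odot> d l [X, Y]"
    by (simp add: delta_def One_nat_def)
  have l1: "l [bracket d X (f \<odot> Y) - f \<odot> bracket d X Y] = l [bracket d X (f \<odot> Y)] - f \<odot> l [bracket d X Y]"
    using DualSec_diff[OF l S(1) Sec_fmult[OF assms(4) S(2)]] DualSec_fmult[OF l assms(4) S(2)] by simp
  have l2: "l [anchor d X f \<odot> Y] = anchor d X f \<odot> l [Y]"
    using assms by (intro DualSec_fmult[OF l] anchor_Cinf[OF A])
  have "anchor d X (l [f \<odot> Y]) = f \<odot> anchor d X (l [Y]) + anchor d X f \<odot> l [Y]"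
    unfolding DualSec_fmult[OF l assms(4,3)]
    using assms DualSec_Cinf[OF l assms(3)] by (intro anchor_mult[OF A])
  moreover have "anchor d (f \<odot> Y) (l [X]) = f \<odot> anchor d Y (l [X])"
    using assms DualSec_Cinf[OF l assms(2)] by (intro anchor_fmult_left[OF A])
  ultimately show "l [bracket d X (f \<odot> Y) - f \<odot> bracket d X Y] = l [anchor d X f \<odot> Y]"
    unfolding l1 l2 bracket_spec(2)[OF assms(1,2) fY l] bracket_spec(2)[OF assms(1-3) l] dl
    by (auto simp: fun_eq_iff algebra_simps)
qed

lemma d_DualSec_formula:
  assumes "deg1_derivation d" "X \<in> Sec" "Y \<in> Sec" "l \<in> DualSec"
  shows "d l [X, Y] = anchor d X (l [Y]) - anchor d Y (l [X]) - l [bracket d X Y]"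
  using bracket_spec(2)[OF assms] by simp

subsection \<open>The Loday identity\<close>

text \<open>
  \<open>d (d f) = 0\<close>, evaluated by the definition of the bracket for the dual section \<open>d f\<close>, says that the
  anchor is a homomorphism.
\<close>

lemma anchor_bracket:
  assumes "d \<in> homological_vector_fields" "X \<in> Sec" "Y \<in> Sec" "f \<in> Cinf"
  shows "anchor d (bracket d X Y) f = anchor d X (anchor d Y f) - anchor d Y (anchor d X f)"
proof -
  have d: "deg1_derivation d" and "d (d (fun_op f)) = 0"
    using assms(1) Dsp_subset_Dtot[OF fun_op_Dsp_0[OF assms(4)]]
    unfolding homological_vector_fields_def Der1_def by blast+
  moreover have "d (fun_op f) \<in> DualSec"
    using d_fun_op[OF d assms(4)] by (simp add: Dsp_1_eq_DualSec)
  ultimately show ?thesis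
    using bracket_spec(2)[OF d assms(2,3), of "d (fun_op f)"]
    by (auto simp: anchor_def fun_eq_iff)
qed

text \<open>
  \<open>d (d l) = 0\<close> for \<open>l\<close> in \<open>E\<^sup>*\<close>, evaluated by the formula for \<open>d\<close> on operators of degree \<open>2\<close>, is
  the Jacobi identity paired with \<open>l\<close>.
\<close>

lemma bracket_jacobi:
  assumes "d \<in> homological_vector_fields" "X \<in> Sec" "Y \<in> Sec" "Z \<in> Sec"
  shows "bracket d X (bracket d Y Z) = bracket d (bracket d X Y) Z + bracket d Y (bracket d X Z)"
proof -
  let ?B = "bracket d" let ?a = "anchor d"
  have d: "deg1_derivation d" and D1: "d \<in> Der1" and sq: "\<And>c. c \<in> Dtot \<Longrightarrow> d (d c) = 0"
    using assms(1) unfolding homological_vector_fields_def Der1_def by blast+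
  note A = is_anchor_anchor[OF d]
  note BS = bracket_spec(1)[OF d]
  have S: "?B X (?B Y Z) \<in> Sec" "?B (?B X Y) Z \<in> Sec" "?B Y (?B X Z) \<in> Sec"
    using assms BS by auto
  show ?thesis
  proof (rule Sec_eqI)
    show "?B X (?B Y Z) \<in> Sec" "?B (?B X Y) Z + ?B Y (?B X Z) \<in> Sec"
      using S Sec_add by auto
    fix l assume l: "l \<in> DualSec"
    have C: "l [W] \<in> Cinf" "?a V (l [W]) \<in> Cinf" if "W \<in> Sec" "V \<in> Sec" for V W
      using DualSec_Cinf[OF l that(1)] anchor_Cinf[OF A that(2)] by auto
    have F: "d l [V, W] = ?a V (l [W]) - ?a W (l [V]) - l [?B V W]" if "V \<in> Sec" "W \<in> Sec" for V W
      by (rule d_DualSec_formula[OF d that l])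
    have AF: "?a U (d l [V, W]) = ?a U (?a V (l [W])) - ?a U (?a W (l [V])) - ?a U (l [?B V W])"
      if "U \<in> Sec" "V \<in> Sec" "W \<in> Sec" for U V W
      unfolding F[OF that(2,3)]
      using that C BS by (simp add: anchor_diff[OF A] Cinf_diff)
    have main: "d (d l) [X, Y, Z] = ?a X (d l [Y, Z]) - ?a Y (d l [X, Z]) + ?a Z (d l [X, Y])
        - d l [?B X Y, Z] - d l [Y, ?B X Z] + d l [X, ?B Y Z]"
      using D1 d_DualSec[OF d l] assms(2-4) unfolding Der1_def anchor_def by blast
    have zero: "d (d l) = 0"
      using sq l Dsp_subset_Dtot[of l 1] by (simp add: Dsp_1_eq_DualSec)
    have hom: "?a (?B X Y) (l [Z]) = ?a X (?a Y (l [Z])) - ?a Y (?a X (l [Z]))"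
      "?a (?B X Z) (l [Y]) = ?a X (?a Z (l [Y])) - ?a Z (?a X (l [Y]))"
      "?a (?B Y Z) (l [X]) = ?a Y (?a Z (l [X])) - ?a Z (?a Y (l [X]))"
      using assms C by (auto intro!: anchor_bracket)
    note main' = main[unfolded AF[OF assms(2,3,4)] AF[OF assms(3,2,4)] AF[OF assms(4,2,3)]
        F[OF BS[OF assms(2,3)] assms(4)] F[OF assms(3) BS[OF assms(2,4)]] F[OF assms(2) BS[OF assms(3,4)]]
        zero]
    have "l [?B X (?B Y Z)] p = l [?B (?B X Y) Z] p + l [?B Y (?B X Z)] p" for p
      using fun_cong[OF main', of p] fun_cong[OF hom(1), of p] fun_cong[OF hom(2), of p]
        fun_cong[OF hom(3), of p]
      by simp
    then show "l [?B X (?B Y Z)] = l [?B (?B X Y) Z + ?B Y (?B X Z)]"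
      unfolding DualSec_add[OF l S(2,3)] by (auto simp: fun_eq_iff)
  qed
qed

subsection \<open>The Loday algebroid of a homological vector field\<close>

lemma multilinear_bracket:
  assumes "deg1_derivation d"
  shows "multilinear_op 2 (binary (bracket d))"
  unfolding multilinear_2_iff binary_def
proof (intro ballI conjI allI)
  fix X Y assume XY: "X \<in> Sec" "Y \<in> Sec"
  note A = is_anchor_anchor[OF assms]
  note BS = bracket_spec(1)[OF assms] note BF = bracket_spec(2)[OF assms]
  have M: "multilinear_op 2 (d l)" if "l \<in> DualSec" for l
    by (rule Dsp_multilinear[OF d_DualSec[OF assms that]])
  have R: "(\<lambda>_. r) \<odot> X \<in> Sec" "(\<lambda>_. r) \<odot> Y \<in> Sec" for r
    using XY by (auto intro!: Sec_fmult Cinf_const)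
  {
    fix Z assume Z: "Z \<in> Sec"
    show "bracket d ([X + Z, Y] ! 0) ([X + Z, Y] ! 1) = bracket d ([X, Y] ! 0) ([X, Y] ! 1) +
        bracket d ([Z, Y] ! 0) ([Z, Y] ! 1)"
      unfolding nth_Cons_0 One_nat_def nth_Cons_Suc
    proof (rule Sec_eqI)
      show "bracket d (X + Z) Y \<in> Sec" "bracket d X Y + bracket d Z Y \<in> Sec"
        using XY Z by (auto intro!: BS Sec_add)
      fix l assume l: "l \<in> DualSec"
      have "d l [X + Z, Y] = d l [X, Y] + d l [Z, Y]"
        using M[OF l] XY Z unfolding multilinear_2_iff by blast
      moreover have "anchor d (X + Z) (l [Y]) = anchor d X (l [Y]) + anchor d Z (l [Y])"
        using XY Z DualSec_Cinf[OF l] by (intro anchor_add_left[OF A])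
      moreover have "anchor d Y (l [X + Z]) = anchor d Y (l [X]) + anchor d Y (l [Z])"
        unfolding DualSec_add[OF l XY(1) Z] using XY Z DualSec_Cinf[OF l] by (intro anchor_add[OF A])
      ultimately show "l [bracket d (X + Z) Y] = l [bracket d X Y + bracket d Z Y]"
        unfolding DualSec_add[OF l BS[OF XY] BS[OF Z XY(2)]] BF[OF XY l] BF[OF Z XY(2) l]
          BF[OF Sec_add[OF XY(1) Z] XY(2) l]
        by (simp add: algebra_simps)
    qed
    show "bracket d ([X, Y + Z] ! 0) ([X, Y + Z] ! 1) = bracket d ([X, Y] ! 0) ([X, Y] ! 1) +
        bracket d ([X, Z] ! 0) ([X, Z] ! 1)"
      unfolding nth_Cons_0 One_nat_def nth_Cons_Suc
    proof (rule Sec_eqI)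
      show "bracket d X (Y + Z) \<in> Sec" "bracket d X Y + bracket d X Z \<in> Sec"
        using XY Z by (auto intro!: BS Sec_add)
      fix l assume l: "l \<in> DualSec"
      have "d l [X, Y + Z] = d l [X, Y] + d l [X, Z]"
        using M[OF l] XY Z unfolding multilinear_2_iff by blast
      moreover have "anchor d (Y + Z) (l [X]) = anchor d Y (l [X]) + anchor d Z (l [X])"
        using XY Z DualSec_Cinf[OF l] by (intro anchor_add_left[OF A])
      moreover have "anchor d X (l [Y + Z]) = anchor d X (l [Y]) + anchor d X (l [Z])"
        unfolding DualSec_add[OF l XY(2) Z] using XY Z DualSec_Cinf[OF l] by (intro anchor_add[OF A])
      ultimately show "l [bracket d X (Y + Z)] = l [bracket d X Y + bracket d X Z]"
        unfolding DualSec_add[OF l BS[OF XY] BS[OF XY(1) Z]] BF[OF XY l] BF[OF XY(1) Z l]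
          BF[OF XY(1) Sec_add[OF XY(2) Z] l]
        by (simp add: algebra_simps)
    qed
  }
  fix r
  show "bracket d ([X, (\<lambda>_. r) \<odot> Y] ! 0) ([X, (\<lambda>_. r) \<odot> Y] ! 1) =
      (\<lambda>_. r) \<odot> bracket d ([X, Y] ! 0) ([X, Y] ! 1)"
    unfolding nth_Cons_0 One_nat_def nth_Cons_Suc
    using bracket_fmult_right[OF assms XY Cinf_const, of r] anchor_const[OF A XY(1), of r]
    by (simp add: fun_eq_iff)
  show "bracket d ([(\<lambda>_. r) \<odot> X, Y] ! 0) ([(\<lambda>_. r) \<odot> X, Y] ! 1) =
      (\<lambda>_. r) \<odot> bracket d ([X, Y] ! 0) ([X, Y] ! 1)"
    unfolding nth_Cons_0 One_nat_def nth_Cons_Suc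
  proof (rule Sec_eqI)
    show "bracket d ((\<lambda>_. r) \<odot> X) Y \<in> Sec" "(\<lambda>_. r) \<odot> bracket d X Y \<in> Sec"
      using XY R by (auto intro!: BS Sec_fmult Cinf_const)
    fix l assume l: "l \<in> DualSec"
    have "d l [(\<lambda>_. r) \<odot> X, Y] = (\<lambda>_. r) \<odot> d l [X, Y]"
      using M[OF l] XY unfolding multilinear_2_iff by blast
    moreover have "anchor d ((\<lambda>_. r) \<odot> X) (l [Y]) = (\<lambda>_. r) \<odot> anchor d X (l [Y])"
      using XY DualSec_Cinf[OF l] by (intro anchor_fmult_left[OF A] Cinf_const)
    moreover have "anchor d Y (l [(\<lambda>_. r) \<odot> X]) = (\<lambda>_. r) \<odot> anchor d Y (l [X])"
      unfolding DualSec_fmult[OF l Cinf_const XY(1)]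
      using anchor_mult[OF A XY(2) Cinf_const DualSec_Cinf[OF l XY(1)], of r] anchor_const[OF A XY(2), of r]
      by (simp add: fun_eq_iff)
    ultimately show "l [bracket d ((\<lambda>_. r) \<odot> X) Y] = l [(\<lambda>_. r) \<odot> bracket d X Y]"
      unfolding DualSec_fmult[OF l Cinf_const BS[OF XY]] BF[OF XY l] BF[OF R(1) XY(2) l]
      by (simp only:) (auto simp: fun_eq_iff algebra_simps)
  qed
qed

text \<open>
  After pairing with \<open>l\<close>, the bracket is a sum of two anchor terms and of \<open>d l\<close>, all of total degree
  at most \<open>1\<close>.
\<close>

lemma ann_bracket:
  assumes "deg1_derivation d"
  shows "ann 2 2 (binary (bracket d))"
proof (rule ann_Sec_valued)
  note A = is_anchor_anchor[OF assms]
  show "binary (bracket d) Xs \<in> Sec" if "Xs \<in> args 2" for Xs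
    using that bracket_spec(1)[OF assms] by (auto simp: args_2_iff binary_def One_nat_def)
  fix l assume l: "l \<in> DualSec"
  have l1: "l \<in> Dsp 1" using l by (simp add: Dsp_1_eq_DualSec)
  have "ann 1 1 l" using Dsp_ann[OF l1] by simp
  then have "ann (Suc 1) (Suc 1) (\<lambda>Xs. anchor d (Xs ! i) (l (omit i Xs)))" if "i \<le> 1" for i
    using Dsp_Cinf[OF l1] that by (intro ann_anchor_omit[OF A])
  then have a: "ann 2 2 (\<lambda>Xs. anchor d (Xs ! i) (l (omit i Xs)))" if "i \<le> 1" for i
    using that by (simp only: Suc_1)
  have "ann 2 2 (\<lambda>Xs. anchor d (Xs ! 0) (l (omit 0 Xs)) + ((\<lambda>_. -1) \<odot> anchor d (Xs ! 1) (l (omit 1 Xs)) +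
      (\<lambda>_. -1) \<odot> d l Xs))"
    using a Dsp_ann[OF d_DualSec[OF assms l]] by (intro ann_add ann_fmult) auto
  then show "ann 2 2 (\<lambda>Xs. l [binary (bracket d) Xs])"
  proof (rule ann_cong[rotated])
    fix Xs assume "Xs \<in> args 2"
    then obtain X Y where XY: "X \<in> Sec" "Y \<in> Sec" "Xs = [X, Y]" by (auto simp: args_2_iff)
    have "omit 0 Xs = [Y]" "omit 1 Xs = [X]" "Xs ! 0 = X" "Xs ! 1 = Y"
      by (simp_all add: XY(3) omit_def One_nat_def)
    then show "anchor d (Xs ! 0) (l (omit 0 Xs)) + ((\<lambda>_. -1) \<odot> anchor d (Xs ! 1) (l (omit 1 Xs)) +
      (\<lambda>_. -1) \<odot> d l Xs) = l [binary (bracket d) Xs]"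
      unfolding binary_def XY(3) using bracket_spec(2)[OF assms XY(1,2) l]
      by (simp only: nth_Cons_0) (auto simp: fun_eq_iff)
  qed
qed

proposition bracket_loday_algebroid:
  assumes "d \<in> homological_vector_fields"
  shows "bracket d \<in> loday_algebroids"
proof -
  have d: "deg1_derivation d"
    using assms unfolding homological_vector_fields_def Der1_def by blast
  have "bracket d X Y = 0" if "X \<notin> Sec \<or> Y \<notin> Sec" for X Y
    using that by (auto simp: bracket_def)
  moreover have "\<exists>f'\<in>Cinf. \<forall>Y\<in>Sec. bracket d X (f \<odot> Y) - f \<odot> bracket d X Y = f' \<odot> Y"
    if "X \<in> Sec" "f \<in> Cinf" for X f
    using bracket_fmult_right[OF d] anchor_Cinf[OF is_anchor_anchor[OF d]] that by blast
  moreover have "total_degree_le 2 1 (binary (bracket d))"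
    unfolding total_degree_le_iff_ann using ann_bracket[OF d] by (simp only: Suc_1)
  ultimately show ?thesis
    unfolding loday_algebroids_def loday_bracket_def
    using bracket_jacobi[OF assms] multilinear_bracket[OF d] bracket_spec(1)[OF d] by blast
qed

text \<open>
  Where the fibre is not \<open>0\<close>, the anchor is the symbol of \<open>[X, \<cdot>]\<close>.
\<close>

lemma anchor_eqI:
  assumes "deg1_derivation d" "deg1_derivation d'" "bracket d = bracket d'" "X \<in> Sec" "f \<in> Cinf"
  shows "anchor d X f = anchor d' X f"
proof
  fix p
  show "anchor d X f p = anchor d' X f p"
  proof (cases "\<exists>v\<in>E p. v \<noteq> 0")
    case True
    then obtain Y where Y: "Y \<in> Sec" "Y p \<noteq> 0" using section_through by metis
    have "anchor d X f \<odot> Y = anchor d' X f \<odot> Y"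
      using bracket_fmult_right[OF assms(1,4) Y(1) assms(5)] bracket_fmult_right[OF assms(2,4) Y(1) assms(5)]
      by (simp only: assms(3))
    then have "(anchor d X f \<odot> Y) p = (anchor d' X f \<odot> Y) p" by (simp only:)
    then show ?thesis using Y(2) by simp
  next
    case False
    \<comment> \<open>At a point with fibre \<open>0\<close> the differential of a function vanishes.\<close>
    then have "X p = (0 \<odot> X) p" using SecD[OF assms(4), of p] by simp
    moreover have "0 \<odot> X \<in> Sec" using assms(4) Cinf_zero by (intro Sec_fmult)
    ultimately have "anchor e X f p = 0" if "deg1_derivation e" for e
      unfolding anchor_def
      using Dsp_1_pointwise[OF d_fun_op[OF that assms(5)] assms(4), of "0 \<odot> X" p]
        Dsp_1_fmult[OF d_fun_op[OF that assms(5)] Cinf_zero assms(4)] by simp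
    then show ?thesis using assms(1,2) by simp
  qed
qed

text \<open>
  The bracket determines the anchor, hence \<open>d\<close> on functions, and then also \<open>d\<close> on dual sections.
\<close>

proposition hvf_equiv_iff_bracket_eq:
  assumes "d \<in> homological_vector_fields" "d' \<in> homological_vector_fields"
  shows "(d, d') \<in> hvf_equiv \<longleftrightarrow> bracket d = bracket d'"
proof
  have d: "deg1_derivation d" "deg1_derivation d'"
    using assms unfolding homological_vector_fields_def Der1_def by blast+
  {
    assume "(d, d') \<in> hvf_equiv"
    then have eq: "\<And>f. f \<in> Cinf \<Longrightarrow> d (fun_op f) = d' (fun_op f)" "\<And>l. l \<in> DualSec \<Longrightarrow> d l = d' l"
      unfolding hvf_equiv_def by blast+
    show "bracket d = bracket d'"
    proof (intro ext)
      fix X Y p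
      show "bracket d X Y p = bracket d' X Y p"
      proof (cases "X \<in> Sec \<and> Y \<in> Sec")
        case True
        then have "bracket d X Y = bracket d' X Y"
          using DualSec_Cinf bracket_spec[OF d(1)] bracket_spec[OF d(2)]
          by (intro Sec_eqI) (simp_all add: anchor_def eq)
        then show ?thesis by simp
      qed (auto simp: bracket_def)
    qed
  }
  assume B: "bracket d = bracket d'"
  have a: "anchor d X f = anchor d' X f" if "X \<in> Sec" "f \<in> Cinf" for X f
    using anchor_eqI[OF d B that] .
  have "d (fun_op f) = d' (fun_op f)" if f: "f \<in> Cinf" for f
  proof
    show "d (fun_op f) Xs = d' (fun_op f) Xs" for Xs
    proof (cases "Xs \<in> args 1")
      case True
      then show ?thesis using a f args_1_iff[of Xs] by (auto simp: anchor_def)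
    next
      case False
      then show ?thesis using Dsp_1_outside[OF d_fun_op[OF _ f]] d by simp
    qed
  qed
  moreover have "d l = d' l" if l: "l \<in> DualSec" for l
  proof
    show "d l Xs = d' l Xs" for Xs
    proof (cases "Xs \<in> args 2")
      case True
      then obtain X Y where "X \<in> Sec" "Y \<in> Sec" "Xs = [X, Y]" using args_2_iff by blast
      then show ?thesis
        using d_DualSec_formula[OF d(1) _ _ l] d_DualSec_formula[OF d(2) _ _ l] a DualSec_Cinf[OF l]
        by (simp add: B)
    next
      case False
      then show ?thesis using Dsp_outside[OF d_DualSec[OF d(1) l]] Dsp_outside[OF d_DualSec[OF d(2) l]] by simp
    qed
  qed
  ultimately show "(d, d') \<in> hvf_equiv"
    unfolding hvf_equiv_def using assms by blast
qed

end

section \<open>Cartan calculus of a Loday algebroid\<close>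

text \<open>
  The Lie derivative and the Loday differential are given by recursion on the argument list. The
  recursive equations are the commutation rules with the contraction \<open>i\<^sub>X\<close> (\<open>contr X\<close>):
  \<open>[L\<^sub>X, i\<^sub>Y] = i\<^bsub>[X,Y]\<^esub>\<close> and Cartan's formula \<open>i\<^sub>X d + d i\<^sub>X = L\<^sub>X\<close>.
\<close>

fun lie :: "('s \<Rightarrow> ('m \<Rightarrow> real) \<Rightarrow> 'm \<Rightarrow> real) \<Rightarrow> ('s \<Rightarrow> 's \<Rightarrow> 's) \<Rightarrow> 's \<Rightarrow>
    ('s list \<Rightarrow> 'm \<Rightarrow> real) \<Rightarrow> 's list \<Rightarrow> 'm \<Rightarrow> real" where
  "lie \<rho> B X c [] = \<rho> X (c [])"
| "lie \<rho> B X c (Y # Ys) = lie \<rho> B X (contr Y c) Ys - c (B X Y # Ys)"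

fun cobd :: "('s \<Rightarrow> ('m \<Rightarrow> real) \<Rightarrow> 'm \<Rightarrow> real) \<Rightarrow> ('s \<Rightarrow> 's \<Rightarrow> 's) \<Rightarrow>
    ('s list \<Rightarrow> 'm \<Rightarrow> real) \<Rightarrow> 's list \<Rightarrow> 'm \<Rightarrow> real" where
  "cobd \<rho> B c [] = 0"
| "cobd \<rho> B c (X # Xs) = lie \<rho> B X c Xs - cobd \<rho> B (contr X c) Xs"

definition weight :: "(nat \<Rightarrow> real) \<Rightarrow> ('s list \<Rightarrow> 'm \<Rightarrow> real) \<Rightarrow> 's list \<Rightarrow> 'm \<Rightarrow> real" where
  "weight k c = (\<lambda>Xs. (\<lambda>_. k (length Xs)) \<odot> c Xs)"

lemma contr_weight: "contr X (weight k c) = weight (\<lambda>n. k (Suc n)) (contr X c)"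
  by (simp add: contr_def weight_def)

lemma invol_eq_weight: "invol c = weight (\<lambda>n. (-1) ^ n) c"
  by (auto simp: invol_def weight_def fun_eq_iff)

lemma contr_lie: "contr Y (lie \<rho> B X c) = (\<lambda>Ys. lie \<rho> B X (contr Y c) Ys - contr (B X Y) c Ys)"
  by (auto simp: contr_def)

lemma contr_cobd: "contr X (cobd \<rho> B c) = (\<lambda>Xs. lie \<rho> B X c Xs - cobd \<rho> B (contr X c) Xs)"
  by (auto simp: contr_def)

text \<open>
  Real-linear combinations of operators: one rule for \<open>comb\<close> replaces separate rules for sums,
  differences, negatives and multiples.
\<close>

definition comb :: "real \<Rightarrow> ('s list \<Rightarrow> 'm \<Rightarrow> real) \<Rightarrow> ('s list \<Rightarrow> 'm \<Rightarrow> real) \<Rightarrow> 's list \<Rightarrow> 'm \<Rightarrow> real" where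
  "comb r a b = (\<lambda>Xs. (\<lambda>_. r) \<odot> a Xs + b Xs)"

lemma contr_comb: "contr X (comb r a b) = comb r (contr X a) (contr X b)"
  by (simp add: contr_def comb_def)

lemma shuffle_prod_comb_left: "comb r a b \<bowtie> c = comb r (a \<bowtie> c) (b \<bowtie> c)"
  by (auto simp: fun_eq_iff shuffle_prod_def comb_def algebra_simps sum.distrib sum_distrib_left)

lemma shuffle_prod_comb_right: "c \<bowtie> comb r a b = comb r (c \<bowtie> a) (c \<bowtie> b)"
  by (auto simp: fun_eq_iff shuffle_prod_def comb_def algebra_simps sum.distrib sum_distrib_left)

lemma diff_eq_comb: "(\<lambda>Xs. a Xs - b Xs) = comb (-1) b a"
  by (auto simp: comb_def fun_eq_iff)

lemma contr_shuffle_prod: "contr X (c \<bowtie> c') = comb 1 (contr X c \<bowtie> c') (invol c \<bowtie> contr X c')"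
  by (auto simp: fun_eq_iff contr_def[of X "c \<bowtie> c'"] comb_def shuffle_prod_Cons)

locale anchored_loday = vector_bundle atlas E triv
  for atlas :: "('m::{t2_space, second_countable_topology} set \<times> ('m \<Rightarrow> 'b::real_inner)) set"
    and E :: "'m \<Rightarrow> 'f::real_vector set"
    and triv :: "('m set \<times> ('m \<Rightarrow> 'f \<Rightarrow> 'r::real_inner)) set" +
  fixes \<rho> :: "('m \<Rightarrow> 'f) \<Rightarrow> ('m \<Rightarrow> real) \<Rightarrow> 'm \<Rightarrow> real"
    and B :: "('m \<Rightarrow> 'f) \<Rightarrow> ('m \<Rightarrow> 'f) \<Rightarrow> 'm \<Rightarrow> 'f"
  assumes anchor: "is_anchor \<rho>"
    and B_Sec: "X \<in> Sec \<Longrightarrow> Y \<in> Sec \<Longrightarrow> B X Y \<in> Sec"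
    and B_add_left: "X \<in> Sec \<Longrightarrow> Y \<in> Sec \<Longrightarrow> Z \<in> Sec \<Longrightarrow> B (X + Y) Z = B X Z + B Y Z"
    and B_add_right: "X \<in> Sec \<Longrightarrow> Y \<in> Sec \<Longrightarrow> Z \<in> Sec \<Longrightarrow> B X (Y + Z) = B X Y + B X Z"
    and B_scale_left: "X \<in> Sec \<Longrightarrow> Y \<in> Sec \<Longrightarrow> B ((\<lambda>_. r) \<odot> X) Y = (\<lambda>_. r) \<odot> B X Y"
    and B_fmult_right: "X \<in> Sec \<Longrightarrow> Y \<in> Sec \<Longrightarrow> f \<in> Cinf \<Longrightarrow> B X (f \<odot> Y) = f \<odot> B X Y + \<rho> X f \<odot> Y"
    \<comment> \<open>\<open>\<delta>\<^sub>1(f) \<delta>\<^sub>1(g) B = 0\<close>\<close>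
    and B_degree: "X \<in> Sec \<Longrightarrow> Y \<in> Sec \<Longrightarrow> f \<in> Cinf \<Longrightarrow> g \<in> Cinf \<Longrightarrow>
      B (f \<odot> g \<odot> X) Y = f \<odot> B (g \<odot> X) Y + g \<odot> B (f \<odot> X) Y - f \<odot> g \<odot> B X Y"
    and B_loday: "X \<in> Sec \<Longrightarrow> Y \<in> Sec \<Longrightarrow> Z \<in> Sec \<Longrightarrow> B X (B Y Z) = B (B X Y) Z + B Y (B X Z)"
    and \<rho>_hom: "X \<in> Sec \<Longrightarrow> Y \<in> Sec \<Longrightarrow> f \<in> Cinf \<Longrightarrow> \<rho> (B X Y) f = \<rho> X (\<rho> Y f) - \<rho> Y (\<rho> X f)"
begin

abbreviation "L \<equiv> lie \<rho> B"
abbreviation "dd \<equiv> cobd \<rho> B"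

definition Cinf_valued :: "(('m \<Rightarrow> 'f) list \<Rightarrow> 'm \<Rightarrow> real) \<Rightarrow> bool" where
  "Cinf_valued c \<longleftrightarrow> (\<forall>Xs. set Xs \<subseteq> Sec \<longrightarrow> c Xs \<in> Cinf)"

text \<open>
  Multilinearity, stated for lists of all lengths at once, so that the class is closed under
  contractions as well as under \<open>L\<close> and \<open>dd\<close>.
\<close>

definition cochain :: "(('m \<Rightarrow> 'f) list \<Rightarrow> 'm \<Rightarrow> real) \<Rightarrow> bool" where
  "cochain c \<longleftrightarrow> Cinf_valued c \<and>
     (\<forall>Xs Ys X Y r. set Xs \<subseteq> Sec \<and> set Ys \<subseteq> Sec \<and> X \<in> Sec \<and> Y \<in> Sec \<longrightarrow>
        c (Xs @ ((\<lambda>_. r) \<odot> X + Y) # Ys) = (\<lambda>_. r) \<odot> c (Xs @ X # Ys) + c (Xs @ Y # Ys))"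

lemma Cinf_valuedD: "Cinf_valued c \<Longrightarrow> set Xs \<subseteq> Sec \<Longrightarrow> c Xs \<in> Cinf"
  by (simp add: Cinf_valued_def)

lemma Cinf_valued_contr: "Cinf_valued c \<Longrightarrow> X \<in> Sec \<Longrightarrow> Cinf_valued (contr X c)"
  by (simp add: Cinf_valued_def contr_def)

lemma Cinf_valued_comb: "Cinf_valued a \<Longrightarrow> Cinf_valued b \<Longrightarrow> Cinf_valued (comb r a b)"
  by (simp add: Cinf_valued_def comb_def Cinf_add Cinf_fmult Cinf_const)

lemma Cinf_valued_weight: "Cinf_valued c \<Longrightarrow> Cinf_valued (weight k c)"
  by (simp add: Cinf_valued_def weight_def Cinf_fmult Cinf_const)

lemma Cinf_valued_shuffle_prod:
  assumes "Cinf_valued c" "Cinf_valued c'"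
  shows "Cinf_valued (c \<bowtie> c')"
proof -
  have "(c \<bowtie> c') Xs \<in> Cinf" if "set Xs \<subseteq> Sec" for Xs
    using that assms
  proof (induction Xs arbitrary: c c')
    case Nil
    have "(c \<bowtie> c') [] = c [] \<odot> c' []" by (auto simp: shuffle_prod_Nil)
    then show ?case using Nil by (simp only: Cinf_fmult Cinf_valued_def)
  next
    case (Cons X Xs)
    have "(c \<bowtie> c') (X # Xs) = (contr X c \<bowtie> c') Xs + (invol c \<bowtie> contr X c') Xs"
      by (auto simp: shuffle_prod_Cons)
    moreover have "(contr X c \<bowtie> c') Xs \<in> Cinf" "(invol c \<bowtie> contr X c') Xs \<in> Cinf"
      using Cons by (auto intro!: Cons.IH Cinf_valued_contr Cinf_valued_weight simp: invol_eq_weight)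
    ultimately show ?case by (simp only: Cinf_add)
  qed
  then show ?thesis by (simp add: Cinf_valued_def)
qed

lemma cochain_valued: "cochain c \<Longrightarrow> Cinf_valued c"
  by (simp add: cochain_def)

lemma cochainD:
  "cochain c \<Longrightarrow> set Xs \<subseteq> Sec \<Longrightarrow> set Ys \<subseteq> Sec \<Longrightarrow> X \<in> Sec \<Longrightarrow> Y \<in> Sec \<Longrightarrow>
    c (Xs @ ((\<lambda>_. r) \<odot> X + Y) # Ys) = (\<lambda>_. r) \<odot> c (Xs @ X # Ys) + c (Xs @ Y # Ys)"
  unfolding cochain_def by blast

lemma cochain_contr:
  assumes "cochain c" "Z \<in> Sec"
  shows "cochain (contr Z c)"
proof -
  have "contr Z c (Xs @ ((\<lambda>_. r) \<odot> X + Y) # Ys) = (\<lambda>_. r) \<odot> contr Z c (Xs @ X # Ys) + contr Z c (Xs @ Y # Ys)"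
    if "set Xs \<subseteq> Sec" "set Ys \<subseteq> Sec" "X \<in> Sec" "Y \<in> Sec" for Xs Ys X Y r
    using cochainD[OF assms(1), of "Z # Xs" Ys X Y r] that assms(2) unfolding contr_def by simp
  then show ?thesis
    unfolding cochain_def using Cinf_valued_contr[OF cochain_valued] assms by blast
qed

lemma cochain_comb:
  assumes "cochain a" "cochain b"
  shows "cochain (comb s a b)"
proof -
  have "comb s a b (Xs @ ((\<lambda>_. r) \<odot> X + Y) # Ys) =
      (\<lambda>_. r) \<odot> comb s a b (Xs @ X # Ys) + comb s a b (Xs @ Y # Ys)"
    if "set Xs \<subseteq> Sec" "set Ys \<subseteq> Sec" "X \<in> Sec" "Y \<in> Sec" for Xs Ys X Y r
    unfolding comb_def cochainD[OF assms(1) that] cochainD[OF assms(2) that]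
    by (auto simp: fun_eq_iff algebra_simps)
  then show ?thesis
    unfolding cochain_def using Cinf_valued_comb cochain_valued assms by blast
qed

lemma cochain_add:
  assumes "cochain c" "X \<in> Sec" "Y \<in> Sec" "set Ys \<subseteq> Sec"
  shows "c ((X + Y) # Ys) = c (X # Ys) + c (Y # Ys)"
proof -
  have "(\<lambda>_. 1) \<odot> X = X" "(\<lambda>_. 1) \<odot> c (X # Ys) = c (X # Ys)"
    by (auto simp: fmult_def)
  then show ?thesis using cochainD[OF assms(1), of "[]" Ys X Y 1] assms by simp
qed

lemma anchor_comb:
  assumes "X \<in> Sec" "f \<in> Cinf" "g \<in> Cinf"
  shows "\<rho> X ((\<lambda>_. r) \<odot> f + g) = (\<lambda>_. r) \<odot> \<rho> X f + \<rho> X g"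
proof -
  have "\<rho> X ((\<lambda>_. r) \<odot> f + g) = \<rho> X ((\<lambda>_. r) \<odot> f) + \<rho> X g"
    using assms by (intro anchor_add[OF anchor] Cinf_fmult Cinf_const)
  also have "\<rho> X ((\<lambda>_. r) \<odot> f) = (\<lambda>_. r) \<odot> \<rho> X f + \<rho> X (\<lambda>_. r) \<odot> f"
    using assms by (intro anchor_mult[OF anchor] Cinf_const)
  finally have e: "\<rho> X ((\<lambda>_. r) \<odot> f + g) = (\<lambda>_. r) \<odot> \<rho> X f + \<rho> X (\<lambda>_. r) \<odot> f + \<rho> X g" .
  show ?thesis
    unfolding e anchor_const[OF anchor assms(1)] by (auto simp: fun_eq_iff)
qed

subsection \<open>Linearity\<close>

lemma lie_cong:
  "X \<in> Sec \<Longrightarrow> set Ys \<subseteq> Sec \<Longrightarrow> (\<And>Zs. set Zs \<subseteq> Sec \<Longrightarrow> c Zs = c' Zs) \<Longrightarrow> L X c Ys = L X c' Ys"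
proof (induction Ys arbitrary: c c')
  case (Cons Y Ys)
  have "L X (contr Y c) Ys = L X (contr Y c') Ys"
    using Cons.prems by (intro Cons.IH) (auto simp: contr_def)
  moreover have "c (B X Y # Ys) = c' (B X Y # Ys)"
    using Cons.prems B_Sec by (intro Cons.prems(3)) auto
  ultimately show ?case by (simp only: lie.simps)
next
  case Nil
  have "c [] = c' []" by (rule Nil(3)) simp
  then show ?case by (simp only: lie.simps)
qed

lemma cobd_cong:
  "set Xs \<subseteq> Sec \<Longrightarrow> (\<And>Zs. set Zs \<subseteq> Sec \<Longrightarrow> c Zs = c' Zs) \<Longrightarrow> dd c Xs = dd c' Xs"
proof (induction Xs arbitrary: c c')
  case (Cons X Xs)
  have "dd (contr X c) Xs = dd (contr X c') Xs"
    using Cons.prems by (intro Cons.IH) (auto simp: contr_def)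
  moreover have "L X c Xs = L X c' Xs"
    using Cons.prems by (intro lie_cong) auto
  ultimately show ?case by (simp only: cobd.simps)
qed simp

lemma shuffle_prod_cong:
  "set Xs \<subseteq> Sec \<Longrightarrow> (\<And>Zs. set Zs \<subseteq> Sec \<Longrightarrow> a Zs = a' Zs) \<Longrightarrow> (\<And>Zs. set Zs \<subseteq> Sec \<Longrightarrow> b Zs = b' Zs) \<Longrightarrow>
    (a \<bowtie> b) Xs = (a' \<bowtie> b') Xs"
proof (induction Xs arbitrary: a b a' b')
  case Nil
  have "a [] = a' []" "b [] = b' []" using Nil(2)[of "[]"] Nil(3)[of "[]"] by simp_all
  then show ?case by (auto simp: fun_eq_iff shuffle_prod_Nil)
next
  case (Cons X Xs)
  have "(contr X a \<bowtie> b) Xs = (contr X a' \<bowtie> b') Xs"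
    using Cons.prems by (intro Cons.IH) (auto simp: contr_def)
  moreover have "(invol a \<bowtie> contr X b) Xs = (invol a' \<bowtie> contr X b') Xs"
    using Cons.prems by (intro Cons.IH) (auto simp: contr_def invol_def)
  ultimately show ?case by (auto simp: fun_eq_iff shuffle_prod_Cons)
qed

lemma Cinf_valued_lie: "Cinf_valued c \<Longrightarrow> X \<in> Sec \<Longrightarrow> Cinf_valued (L X c)"
proof -
  assume X: "X \<in> Sec"
  have "Cinf_valued c \<Longrightarrow> set Ys \<subseteq> Sec \<Longrightarrow> L X c Ys \<in> Cinf" for Ys
  proof (induction Ys arbitrary: c)
    case Nil
    then show ?case using X Cinf_valuedD[of c "[]"] by (auto intro: anchor_Cinf[OF anchor])
  next
    case (Cons Y Ys)
    have "L X (contr Y c) Ys \<in> Cinf"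
      using Cons.prems by (intro Cons.IH Cinf_valued_contr) auto
    moreover have "c (B X Y # Ys) \<in> Cinf"
      using Cons.prems X B_Sec by (intro Cinf_valuedD) auto
    ultimately show ?case by (simp only: lie.simps Cinf_diff)
  qed
  then show "Cinf_valued c \<Longrightarrow> Cinf_valued (L X c)" by (simp add: Cinf_valued_def)
qed

lemma Cinf_valued_cobd: "Cinf_valued c \<Longrightarrow> Cinf_valued (dd c)"
proof -
  have "Cinf_valued c \<Longrightarrow> set Xs \<subseteq> Sec \<Longrightarrow> dd c Xs \<in> Cinf" for Xs
  proof (induction Xs arbitrary: c)
    case (Cons X Xs)
    have "dd (contr X c) Xs \<in> Cinf" "L X c Xs \<in> Cinf"
      using Cons by (auto intro!: Cons.IH Cinf_valued_contr Cinf_valued_lie Cinf_valuedD[of "L X c"])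
    then show ?case by (simp only: cobd.simps Cinf_diff)
  next
    case Nil
    show ?case unfolding cobd.simps by (rule Cinf_zero)
  qed
  then show "Cinf_valued c \<Longrightarrow> Cinf_valued (dd c)" by (simp add: Cinf_valued_def)
qed

lemma lie_comb:
  "X \<in> Sec \<Longrightarrow> set Ys \<subseteq> Sec \<Longrightarrow> Cinf_valued a \<Longrightarrow> Cinf_valued b \<Longrightarrow>
    L X (comb r a b) Ys = (\<lambda>_. r) \<odot> L X a Ys + L X b Ys"
proof (induction Ys arbitrary: a b)
  case Nil
  then show ?case
    unfolding lie.simps comb_def by (intro anchor_comb Cinf_valuedD) auto
next
  case (Cons Y Ys)
  have "L X (comb r (contr Y a) (contr Y b)) Ys = (\<lambda>_. r) \<odot> L X (contr Y a) Ys + L X (contr Y b) Ys"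
    using Cons by (intro Cons.IH Cinf_valued_contr) auto
  then show ?case
    unfolding lie.simps contr_comb by (simp only: comb_def) (auto simp: fun_eq_iff algebra_simps)
qed

lemma lie_diff:
  assumes "X \<in> Sec" "set Ys \<subseteq> Sec" "Cinf_valued a" "Cinf_valued b"
  shows "L X (\<lambda>Xs. a Xs - b Xs) Ys = L X a Ys - L X b Ys"
  unfolding diff_eq_comb lie_comb[OF assms(1,2,4,3)] by (auto simp: fun_eq_iff)

lemma cobd_comb:
  "set Xs \<subseteq> Sec \<Longrightarrow> Cinf_valued a \<Longrightarrow> Cinf_valued b \<Longrightarrow>
    dd (comb r a b) Xs = (\<lambda>_. r) \<odot> dd a Xs + dd b Xs"
proof (induction Xs arbitrary: a b)
  case Nil
  then show ?case by (auto simp: fun_eq_iff)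
next
  case (Cons X Xs)
  have "dd (comb r (contr X a) (contr X b)) Xs = (\<lambda>_. r) \<odot> dd (contr X a) Xs + dd (contr X b) Xs"
    using Cons by (intro Cons.IH Cinf_valued_contr) auto
  moreover have "L X (comb r a b) Xs = (\<lambda>_. r) \<odot> L X a Xs + L X b Xs"
    using Cons by (intro lie_comb) auto
  ultimately show ?case
    unfolding cobd.simps contr_comb by (simp only:) (auto simp: fun_eq_iff algebra_simps)
qed

lemma cobd_diff:
  assumes "set Xs \<subseteq> Sec" "Cinf_valued a" "Cinf_valued b"
  shows "dd (\<lambda>Xs. a Xs - b Xs) Xs = dd a Xs - dd b Xs"
  unfolding diff_eq_comb cobd_comb[OF assms(1,3,2)] by (auto simp: fun_eq_iff)

text \<open>
  A factor that depends on the degree passes through \<open>L\<^sub>X\<close> unchanged and through \<open>d\<close> with a shift by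
  one. The same rule covers real multiples, the grading involution and the projection to one degree.
\<close>

lemma lie_weight:
  "X \<in> Sec \<Longrightarrow> set Ys \<subseteq> Sec \<Longrightarrow> Cinf_valued c \<Longrightarrow>
    L X (weight k c) Ys = (\<lambda>_. k (length Ys)) \<odot> L X c Ys"
proof (induction Ys arbitrary: c k)
  case Nil
  have "\<rho> X ((\<lambda>_. k 0) \<odot> c [] + 0) = (\<lambda>_. k 0) \<odot> \<rho> X (c []) + \<rho> X 0"
    using Nil by (intro anchor_comb Cinf_valuedD Cinf_zero) auto
  then show ?case
    unfolding lie.simps weight_def list.size anchor_zero[OF anchor Nil(1)] by (simp only: add_0_right)
next
  case (Cons Y Ys)
  have "L X (weight (\<lambda>n. k (Suc n)) (contr Y c)) Ys = (\<lambda>_. k (Suc (length Ys))) \<odot> L X (contr Y c) Ys"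
    using Cons by (intro Cons.IH Cinf_valued_contr) auto
  then show ?case
    unfolding lie.simps contr_weight by (simp only: weight_def list.size fmult_diff_right add_0_right add_Suc_right)
qed

lemma cobd_weight:
  "set Xs \<subseteq> Sec \<Longrightarrow> Cinf_valued c \<Longrightarrow> dd (weight k c) Xs = (\<lambda>_. k (length Xs - 1)) \<odot> dd c Xs"
proof (induction Xs arbitrary: c k)
  case Nil
  then show ?case by (simp only: cobd.simps fmult_zero_right)
next
  case (Cons X Xs)
  have 1: "dd (weight (\<lambda>n. k (Suc n)) (contr X c)) Xs = (\<lambda>_. k (Suc (length Xs - 1))) \<odot> dd (contr X c) Xs"
    using Cons by (intro Cons.IH Cinf_valued_contr) auto
  have "\<dots> = (\<lambda>_. k (length Xs)) \<odot> dd (contr X c) Xs"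
    by (cases Xs) (simp_all only: cobd.simps fmult_zero_right list.size diff_Suc_1' One_nat_def
        add_0_right add_Suc_right)
  moreover have "L X (weight k c) Xs = (\<lambda>_. k (length Xs)) \<odot> L X c Xs"
    using Cons by (intro lie_weight) auto
  ultimately show ?case
    unfolding cobd.simps contr_weight 1 by (simp only: list.size fmult_diff_right diff_Suc_1' One_nat_def
        add_0_right add_Suc_right)
qed

subsection \<open>Derivation properties\<close>

text \<open>
  Induction on the arguments: both sides satisfy the same recursion, because \<open>i\<^sub>Y\<close> is a graded derivation
  of the product and the commutator \<open>i\<^bsub>[X,Y]\<^esub>\<close> of \<open>L\<^sub>X\<close> and \<open>i\<^sub>Y\<close> is one, too.
\<close>

lemma lie_shuffle_prod:
  "X \<in> Sec \<Longrightarrow> set Ys \<subseteq> Sec \<Longrightarrow> Cinf_valued c \<Longrightarrow> Cinf_valued c' \<Longrightarrow>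
    L X (c \<bowtie> c') Ys = (L X c \<bowtie> c') Ys + (c \<bowtie> L X c') Ys"
proof (induction Ys arbitrary: c c')
  case Nil
  have e: "(c \<bowtie> c') [] = c [] \<odot> c' []" by (auto simp: shuffle_prod_Nil)
  have e': "\<rho> X (c [] \<odot> c' []) = c [] \<odot> \<rho> X (c' []) + \<rho> X (c []) \<odot> c' []"
    using Nil by (intro anchor_mult[OF anchor] Cinf_valuedD) auto
  show ?case unfolding lie.simps e e' by (auto simp: fun_eq_iff shuffle_prod_Nil)
next
  case (Cons Y Ys)
  then have S: "X \<in> Sec" "Y \<in> Sec" "set Ys \<subseteq> Sec" "B X Y \<in> Sec" using B_Sec by auto
  note V = Cons.prems(3,4) Cinf_valued_contr[OF Cons.prems(3) S(2)] Cinf_valued_contr[OF Cons.prems(4) S(2)]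
    Cinf_valued_weight[OF Cons.prems(3), of "\<lambda>n. (-1) ^ n", folded invol_eq_weight]
  have inv: "L X (invol c) Zs = invol (L X c) Zs" if "set Zs \<subseteq> Sec" for Zs
    unfolding invol_eq_weight lie_weight[OF S(1) that V(1)] by (simp add: weight_def)
  have e: "L X (c \<bowtie> c') (Y # Ys) p = ((L X (contr Y c) \<bowtie> c') Ys p + (contr Y c \<bowtie> L X c') Ys p) +
      ((L X (invol c) \<bowtie> contr Y c') Ys p + (invol c \<bowtie> L X (contr Y c')) Ys p) -
      ((contr (B X Y) c \<bowtie> c') Ys p + (invol c \<bowtie> contr (B X Y) c') Ys p)" for p
    unfolding lie.simps contr_shuffle_prod
      lie_comb[OF S(1,3) Cinf_valued_shuffle_prod[OF V(3,2)] Cinf_valued_shuffle_prod[OF V(5,4)]]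
      Cons.IH[OF S(1,3) V(3,2)] Cons.IH[OF S(1,3) V(5,4)]
    by (simp add: shuffle_prod_Cons)
  have s: "(L X (invol c) \<bowtie> contr Y c') Ys = (invol (L X c) \<bowtie> contr Y c') Ys"
    using S(3) inv by (rule shuffle_prod_cong) auto
  show ?case
  proof
    show "L X (c \<bowtie> c') (Y # Ys) p = ((L X c \<bowtie> c') (Y # Ys) + (c \<bowtie> L X c') (Y # Ys)) p" for p
      unfolding e[unfolded s] plus_fun_apply shuffle_prod_Cons contr_lie diff_eq_comb shuffle_prod_comb_left
        shuffle_prod_comb_right by (simp add: comb_def)
  qed
qed

text \<open>
  By Cartan's formula the claim for \<open>X # Xs\<close> follows from the derivation property of \<open>L\<^sub>X\<close> and from the
  claim for \<open>Xs\<close> and the two products that make up \<open>i\<^sub>X (c \<bowtie> c')\<close>.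
\<close>

lemma cobd_shuffle_prod:
  "set Xs \<subseteq> Sec \<Longrightarrow> Cinf_valued c \<Longrightarrow> Cinf_valued c' \<Longrightarrow>
    dd (c \<bowtie> c') Xs = (dd c \<bowtie> c') Xs + (invol c \<bowtie> dd c') Xs"
proof (induction Xs arbitrary: c c')
  case Nil
  then show ?case by (auto simp: fun_eq_iff shuffle_prod_Nil)
next
  case (Cons X Xs)
  then have S: "X \<in> Sec" "set Xs \<subseteq> Sec" by auto
  note V = Cons.prems(2,3) Cinf_valued_contr[OF Cons.prems(2) S(1)] Cinf_valued_contr[OF Cons.prems(3) S(1)]
    Cinf_valued_weight[OF Cons.prems(2), of "\<lambda>n. (-1) ^ n", folded invol_eq_weight]
  have inv: "dd (invol c) Zs = comb (-1) (invol (dd c)) 0 Zs" if "set Zs \<subseteq> Sec" for Zs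
    unfolding invol_eq_weight cobd_weight[OF that V(1)]
    by (cases Zs) (auto simp: weight_def comb_def fun_eq_iff One_nat_def)
  have ii: "invol (invol c) = c" "contr X (invol c) = comb (-1) (invol (contr X c)) 0"
    by (auto simp: invol_def contr_def comb_def fun_eq_iff)
  have e: "dd (c \<bowtie> c') (X # Xs) p = ((L X c \<bowtie> c') Xs p + (c \<bowtie> L X c') Xs p) -
      (((dd (contr X c) \<bowtie> c') Xs p + (invol (contr X c) \<bowtie> dd c') Xs p) +
       ((dd (invol c) \<bowtie> contr X c') Xs p + (invol (invol c) \<bowtie> dd (contr X c')) Xs p))" for p
    unfolding cobd.simps contr_shuffle_prod lie_shuffle_prod[OF S V(1,2)]
      cobd_comb[OF S(2) Cinf_valued_shuffle_prod[OF V(3,2)] Cinf_valued_shuffle_prod[OF V(5,4)]]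
      Cons.IH[OF S(2) V(3,2)] Cons.IH[OF S(2) V(5,4)]
    by simp
  have s: "(dd (invol c) \<bowtie> contr X c') Xs = (comb (-1) (invol (dd c)) 0 \<bowtie> contr X c') Xs"
    using S(2) inv by (rule shuffle_prod_cong) auto
  have z: "(0 \<bowtie> a) Ys p = 0" for a Ys p by (simp add: shuffle_prod_def)
  show ?case
  proof
    show "dd (c \<bowtie> c') (X # Xs) p = ((dd c \<bowtie> c') (X # Xs) + (invol c \<bowtie> dd c') (X # Xs)) p" for p
      unfolding e[unfolded s] plus_fun_apply shuffle_prod_Cons contr_cobd ii diff_eq_comb
        shuffle_prod_comb_left shuffle_prod_comb_right by (simp add: comb_def z)
  qed
qed

subsection \<open>The differential squares to zero\<close>

text \<open>
  On functions this is the homomorphism property of the anchor. Commuting both sides with \<open>i\<^sub>Z\<close>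
  leaves the Jacobi identity, inserted into the first argument of \<open>c\<close>.
\<close>

lemma lie_commutator:
  "X \<in> Sec \<Longrightarrow> Y \<in> Sec \<Longrightarrow> set Zs \<subseteq> Sec \<Longrightarrow> cochain c \<Longrightarrow>
    L (B X Y) c Zs = L X (L Y c) Zs - L Y (L X c) Zs"
proof (induction Zs arbitrary: c)
  case Nil
  then show ?case using \<rho>_hom[OF Nil(1,2) Cinf_valuedD[OF cochain_valued[OF Nil(4)], of "[]"]] by simp
next
  case (Cons Z Zs)
  then have S: "X \<in> Sec" "Y \<in> Sec" "Z \<in> Sec" "set Zs \<subseteq> Sec" by auto
  note cZ = cochain_contr[OF Cons.prems(4) S(3)]
  have step: "L U (L V c) (Z # Zs) =
      L U (L V (contr Z c)) Zs - L U (contr (B V Z) c) Zs - (L V (contr (B U Z) c) Zs - c (B V (B U Z) # Zs))"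
    if "U \<in> Sec" "V \<in> Sec" for U V
  proof -
    have "L U (contr Z (L V c)) Zs = L U (L V (contr Z c)) Zs - L U (contr (B V Z) c) Zs"
      unfolding contr_lie using that S Cons.prems(4) cZ
      by (intro lie_diff Cinf_valued_lie Cinf_valued_contr cochain_valued B_Sec)
    then show ?thesis by (simp only: lie.simps)
  qed
  have "c (B X (B Y Z) # Zs) = c (B (B X Y) Z # Zs) + c (B Y (B X Z) # Zs)"
    unfolding B_loday[OF S(1-3)] using Cons.prems(4) S by (intro cochain_add B_Sec)
  moreover have "L (B X Y) (contr Z c) Zs = L X (L Y (contr Z c)) Zs - L Y (L X (contr Z c)) Zs"
    by (rule Cons.IH[OF S(1,2,4) cZ])
  ultimately show ?case
    unfolding step[OF S(1,2)] step[OF S(2,1)] lie.simps(2)[of _ _ "B X Y"]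
    by (auto simp: fun_eq_iff)
qed

text \<open>
  Contracting with \<open>Y\<close> and using Cartan's formula on both sides reduces the claim for \<open>c\<close> to the one for
  \<open>i\<^sub>Y c\<close> and to the commutator of \<open>L\<^sub>X\<close> and \<open>L\<^sub>Y\<close>.
\<close>

lemma lie_cobd_commute:
  "X \<in> Sec \<Longrightarrow> set Ys \<subseteq> Sec \<Longrightarrow> cochain c \<Longrightarrow> L X (dd c) Ys = dd (L X c) Ys"
proof (induction Ys arbitrary: c)
  case Nil
  then show ?case using anchor_zero[OF anchor Nil(1)] by simp
next
  case (Cons Y Ys)
  then have S: "X \<in> Sec" "Y \<in> Sec" "set Ys \<subseteq> Sec" by auto
  note cV = cochain_valued[OF Cons.prems(3)] and cY = cochain_contr[OF Cons.prems(3) S(2)]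
  have "L X (contr Y (dd c)) Ys = L X (L Y c) Ys - L X (dd (contr Y c)) Ys"
    unfolding contr_cobd using S cV cochain_valued[OF cY]
    by (intro lie_diff Cinf_valued_lie Cinf_valued_cobd)
  moreover have "dd (contr Y (L X c)) Ys = dd (L X (contr Y c)) Ys - dd (contr (B X Y) c) Ys"
    unfolding contr_lie using S cV cochain_valued[OF cY]
    by (intro cobd_diff Cinf_valued_lie Cinf_valued_contr B_Sec)
  moreover have "L X (dd (contr Y c)) Ys = dd (L X (contr Y c)) Ys"
    by (rule Cons.IH[OF S(1,3) cY])
  ultimately show ?case
    unfolding lie.simps(2)[of _ _ X] cobd.simps(2)
    using lie_commutator[OF S Cons.prems(3)] by (auto simp: fun_eq_iff)
qed

text \<open>
  \<open>i\<^sub>X d d = L\<^sub>X d - d i\<^sub>X d = L\<^sub>X d - d L\<^sub>X + d d i\<^sub>X = d d i\<^sub>X\<close>.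
\<close>

lemma cobd_cobd:
  "set Xs \<subseteq> Sec \<Longrightarrow> cochain c \<Longrightarrow> dd (dd c) Xs = 0"
proof (induction Xs arbitrary: c)
  case (Cons X Xs)
  then have S: "X \<in> Sec" "set Xs \<subseteq> Sec" by auto
  note cV = cochain_valued[OF Cons.prems(2)] and cX = cochain_contr[OF Cons.prems(2) S(1)]
  have "dd (contr X (dd c)) Xs = dd (L X c) Xs - dd (dd (contr X c)) Xs"
    unfolding contr_cobd using S cV cochain_valued[OF cX]
    by (intro cobd_diff Cinf_valued_lie Cinf_valued_cobd)
  moreover have "dd (dd (contr X c)) Xs = 0"
    by (rule Cons.IH[OF S(2) cX])
  moreover have "L X (dd c) Xs = dd (L X c) Xs"
    by (rule lie_cobd_commute[OF S Cons.prems(2)])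
  ultimately show ?case by (simp only: cobd.simps) simp
qed simp

subsection \<open>Multilinearity and linearity over functions in the last argument\<close>

lemma lie_comb_left:
  "X \<in> Sec \<Longrightarrow> Y \<in> Sec \<Longrightarrow> set Zs \<subseteq> Sec \<Longrightarrow> cochain c \<Longrightarrow>
    L ((\<lambda>_. r) \<odot> X + Y) c Zs = (\<lambda>_. r) \<odot> L X c Zs + L Y c Zs"
proof (induction Zs arbitrary: c)
  case Nil
  then have "c [] \<in> Cinf" using cochain_valued Cinf_valuedD[of c "[]"] by simp
  then show ?case
    using Nil anchor_add_left[OF anchor, of "(\<lambda>_. r) \<odot> X" Y "c []"]
      anchor_fmult_left[OF anchor Nil(1) Cinf_const, of "c []" r] Sec_fmult[OF Cinf_const]
    by (simp only: lie.simps)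
next
  case (Cons Z Zs)
  then have S: "X \<in> Sec" "Y \<in> Sec" "Z \<in> Sec" "set Zs \<subseteq> Sec" "(\<lambda>_. r) \<odot> X \<in> Sec"
    using Sec_fmult[OF Cinf_const] by auto
  have "B ((\<lambda>_. r) \<odot> X + Y) Z = (\<lambda>_. r) \<odot> B X Z + B Y Z"
    unfolding B_add_left[OF S(5,2,3)] B_scale_left[OF S(1,3)] ..
  moreover have "c (((\<lambda>_. r) \<odot> B X Z + B Y Z) # Zs) = (\<lambda>_. r) \<odot> c (B X Z # Zs) + c (B Y Z # Zs)"
    using cochainD[OF Cons.prems(4), of "[]" Zs "B X Z" "B Y Z" r] S B_Sec by simp
  moreover have "L ((\<lambda>_. r) \<odot> X + Y) (contr Z c) Zs = (\<lambda>_. r) \<odot> L X (contr Z c) Zs + L Y (contr Z c) Zs"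
    using Cons.prems S by (intro Cons.IH cochain_contr)
  ultimately show ?case
    by (simp only: lie.simps) (auto simp: fun_eq_iff algebra_simps)
qed

lemma contr_linear:
  assumes "cochain c" "X \<in> Sec" "Y \<in> Sec" "set Zs \<subseteq> Sec"
  shows "contr ((\<lambda>_. r) \<odot> X + Y) c Zs = comb r (contr X c) (contr Y c) Zs"
  using cochainD[OF assms(1), of "[]" Zs X Y r] assms(2-4) by (simp add: contr_def comb_def)

lemma B_scale_right:
  assumes "X \<in> Sec" "Y \<in> Sec"
  shows "B X ((\<lambda>_. r) \<odot> Y) = (\<lambda>_. r) \<odot> B X Y"
  using B_fmult_right[OF assms Cinf_const, of r] anchor_const[OF anchor assms(1), of r]
  by (auto simp: fun_eq_iff)

lemma cochain_lie:
  assumes "X \<in> Sec" "cochain c"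
  shows "cochain (L X c)"
proof -
  have "cochain c \<Longrightarrow> set Ys \<subseteq> Sec \<Longrightarrow> set Zs \<subseteq> Sec \<Longrightarrow> Y \<in> Sec \<Longrightarrow> Z \<in> Sec \<Longrightarrow>
    L X c (Ys @ ((\<lambda>_. r) \<odot> Y + Z) # Zs) = (\<lambda>_. r) \<odot> L X c (Ys @ Y # Zs) + L X c (Ys @ Z # Zs)"
    for Ys Zs Y Z r
  proof (induction Ys arbitrary: c)
    case Nil
    note cV = cochain_valued[OF cochain_contr[OF Nil(1) Nil(4)]] cochain_valued[OF cochain_contr[OF Nil(1) Nil(5)]]
    have rY: "(\<lambda>_. r) \<odot> Y \<in> Sec" using Nil by (intro Sec_fmult Cinf_const)
    have "L X (contr ((\<lambda>_. r) \<odot> Y + Z) c) Zs = L X (comb r (contr Y c) (contr Z c)) Zs"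
      using assms(1) Nil by (intro lie_cong contr_linear)
    also have "\<dots> = (\<lambda>_. r) \<odot> L X (contr Y c) Zs + L X (contr Z c) Zs"
      using assms(1) Nil cV by (intro lie_comb)
    finally have 1: "L X (contr ((\<lambda>_. r) \<odot> Y + Z) c) Zs = \<dots>" .
    have "B X ((\<lambda>_. r) \<odot> Y + Z) = (\<lambda>_. r) \<odot> B X Y + B X Z"
      unfolding B_add_right[OF assms(1) rY Nil(5)] B_scale_right[OF assms(1) Nil(4)] ..
    moreover have "c (((\<lambda>_. r) \<odot> B X Y + B X Z) # Zs) = (\<lambda>_. r) \<odot> c (B X Y # Zs) + c (B X Z # Zs)"
      using cochainD[OF Nil(1), of "[]" Zs "B X Y" "B X Z" r] Nil B_Sec assms(1) by simp
    ultimately show ?case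
      by (simp only: append_Nil lie.simps 1) (auto simp: fun_eq_iff algebra_simps)
  next
    case (Cons U Ys)
    have U: "U \<in> Sec" "set Ys \<subseteq> Sec" "B X U \<in> Sec" using Cons.prems assms(1) B_Sec by auto
    have "L X (contr U c) (Ys @ ((\<lambda>_. r) \<odot> Y + Z) # Zs) =
        (\<lambda>_. r) \<odot> L X (contr U c) (Ys @ Y # Zs) + L X (contr U c) (Ys @ Z # Zs)"
      using Cons.prems U by (intro Cons.IH cochain_contr)
    moreover have "c (B X U # Ys @ ((\<lambda>_. r) \<odot> Y + Z) # Zs) =
        (\<lambda>_. r) \<odot> c (B X U # Ys @ Y # Zs) + c (B X U # Ys @ Z # Zs)"
      using cochainD[OF Cons.prems(1), of "B X U # Ys" Zs Y Z r] Cons.prems U by simp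
    ultimately show ?case
      by (simp only: append_Cons lie.simps) (auto simp: fun_eq_iff algebra_simps)
  qed
  then show ?thesis
    unfolding cochain_def[of "L X c"] using Cinf_valued_lie[OF cochain_valued] assms by blast
qed

lemma cochain_cobd:
  assumes "cochain c"
  shows "cochain (dd c)"
proof -
  have "cochain c \<Longrightarrow> set Ys \<subseteq> Sec \<Longrightarrow> set Zs \<subseteq> Sec \<Longrightarrow> Y \<in> Sec \<Longrightarrow> Z \<in> Sec \<Longrightarrow>
    dd c (Ys @ ((\<lambda>_. r) \<odot> Y + Z) # Zs) = (\<lambda>_. r) \<odot> dd c (Ys @ Y # Zs) + dd c (Ys @ Z # Zs)"
    for Ys Zs Y Z r
  proof (induction Ys arbitrary: c)
    case Nil
    note cV = cochain_valued[OF cochain_contr[OF Nil(1) Nil(4)]] cochain_valued[OF cochain_contr[OF Nil(1) Nil(5)]]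
    have "dd (contr ((\<lambda>_. r) \<odot> Y + Z) c) Zs = dd (comb r (contr Y c) (contr Z c)) Zs"
      using Nil by (intro cobd_cong contr_linear)
    also have "\<dots> = (\<lambda>_. r) \<odot> dd (contr Y c) Zs + dd (contr Z c) Zs"
      using Nil cV by (intro cobd_comb)
    finally have 1: "dd (contr ((\<lambda>_. r) \<odot> Y + Z) c) Zs = \<dots>" .
    have "L ((\<lambda>_. r) \<odot> Y + Z) c Zs = (\<lambda>_. r) \<odot> L Y c Zs + L Z c Zs"
      using Nil by (intro lie_comb_left)
    then show ?case
      by (simp only: append_Nil cobd.simps 1) (auto simp: fun_eq_iff algebra_simps)
  next
    case (Cons U Ys)
    have U: "U \<in> Sec" "set Ys \<subseteq> Sec" using Cons.prems by auto
    have "dd (contr U c) (Ys @ ((\<lambda>_. r) \<odot> Y + Z) # Zs) =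
        (\<lambda>_. r) \<odot> dd (contr U c) (Ys @ Y # Zs) + dd (contr U c) (Ys @ Z # Zs)"
      using Cons.prems U by (intro Cons.IH cochain_contr)
    moreover have "L U c (Ys @ ((\<lambda>_. r) \<odot> Y + Z) # Zs) =
        (\<lambda>_. r) \<odot> L U c (Ys @ Y # Zs) + L U c (Ys @ Z # Zs)"
      using Cons.prems U by (intro cochainD[OF cochain_lie])
    ultimately show ?case
      by (simp only: append_Cons cobd.simps) (auto simp: fun_eq_iff algebra_simps)
  qed
  then show ?thesis
    unfolding cochain_def[of "dd c"] using Cinf_valued_cobd[OF cochain_valued] assms by blast
qed

definition last_linear :: "(('m \<Rightarrow> 'f) list \<Rightarrow> 'm \<Rightarrow> real) \<Rightarrow> bool" where
  "last_linear c \<longleftrightarrow> (\<forall>Xs X f. set Xs \<subseteq> Sec \<and> X \<in> Sec \<and> f \<in> Cinf \<longrightarrow> c (Xs @ [f \<odot> X]) = f \<odot> c (Xs @ [X]))"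

lemma last_linearD:
  "last_linear c \<Longrightarrow> set Xs \<subseteq> Sec \<Longrightarrow> X \<in> Sec \<Longrightarrow> f \<in> Cinf \<Longrightarrow> c (Xs @ [f \<odot> X]) = f \<odot> c (Xs @ [X])"
  unfolding last_linear_def by blast

lemma last_linear_contr:
  assumes "last_linear c" "Z \<in> Sec"
  shows "last_linear (contr Z c)"
proof -
  have "contr Z c (Xs @ [f \<odot> X]) = f \<odot> contr Z c (Xs @ [X])" if "set Xs \<subseteq> Sec" "X \<in> Sec" "f \<in> Cinf" for Xs X f
    using last_linearD[OF assms(1), of "Z # Xs" X f] that assms(2) unfolding contr_def by simp
  then show ?thesis unfolding last_linear_def by blast
qed

text \<open>The derivatives of \<open>f\<close> that come from \<open>\<rho>(X)\<close> and from the bracket \<open>[X, f Y]\<close> cancel.\<close>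

lemma lie_last:
  "X \<in> Sec \<Longrightarrow> cochain c \<Longrightarrow> last_linear c \<Longrightarrow> set Ys \<subseteq> Sec \<Longrightarrow> Y \<in> Sec \<Longrightarrow> f \<in> Cinf \<Longrightarrow>
    L X c (Ys @ [f \<odot> Y]) = f \<odot> L X c (Ys @ [Y])"
proof (induction Ys arbitrary: c)
  case Nil
  have B: "B X Y \<in> Sec" "\<rho> X f \<in> Cinf" using Nil B_Sec anchor_Cinf[OF anchor] by auto
  have l: "c [g \<odot> Z] = g \<odot> c [Z]" if "g \<in> Cinf" "Z \<in> Sec" for g Z
    using last_linearD[OF Nil(3), of "[]" Z g] that by simp
  have "\<rho> X (f \<odot> c [Y]) = f \<odot> \<rho> X (c [Y]) + \<rho> X f \<odot> c [Y]"
    using Nil Cinf_valuedD[OF cochain_valued[OF Nil(2)], of "[Y]"]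
    by (intro anchor_mult[OF anchor]) auto
  moreover have "c [f \<odot> B X Y + \<rho> X f \<odot> Y] = c [f \<odot> B X Y] + c [\<rho> X f \<odot> Y]"
    using Nil B by (intro cochain_add Sec_fmult) auto
  ultimately show ?case
    by (simp only: append_Nil lie.simps contr_def B_fmult_right[OF Nil(1,5,6)]
        l[OF Nil(6,5)] l[OF Nil(6) B(1)] l[OF B(2) Nil(5)]) (auto simp: fun_eq_iff algebra_simps)
next
  case (Cons U Ys)
  have U: "U \<in> Sec" "set Ys \<subseteq> Sec" "B X U \<in> Sec" using Cons.prems B_Sec by auto
  have "L X (contr U c) (Ys @ [f \<odot> Y]) = f \<odot> L X (contr U c) (Ys @ [Y])"
    using Cons.prems U by (intro Cons.IH cochain_contr last_linear_contr)
  moreover have "c (B X U # Ys @ [f \<odot> Y]) = f \<odot> c (B X U # Ys @ [Y])"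
    using last_linearD[OF Cons.prems(3), of "B X U # Ys" Y f] Cons.prems U by simp
  ultimately show ?case
    by (simp only: append_Cons lie.simps fmult_diff_right)
qed

lemma cobd_last:
  "cochain c \<Longrightarrow> last_linear c \<Longrightarrow> set Ys \<subseteq> Sec \<Longrightarrow> Y \<in> Sec \<Longrightarrow> f \<in> Cinf \<Longrightarrow>
    dd c (Ys @ [f \<odot> Y]) = f \<odot> dd c (Ys @ [Y])"
proof (induction Ys arbitrary: c)
  case Nil
  have "\<rho> (f \<odot> Y) (c []) = f \<odot> \<rho> Y (c [])"
    using Nil Cinf_valuedD[OF cochain_valued[OF Nil(1)], of "[]"]
    by (intro anchor_fmult_left[OF anchor]) auto
  then show ?case by (simp only: append_Nil cobd.simps lie.simps fmult_diff_right fmult_zero_right)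
next
  case (Cons U Ys)
  have U: "U \<in> Sec" "set Ys \<subseteq> Sec" using Cons.prems by auto
  have "dd (contr U c) (Ys @ [f \<odot> Y]) = f \<odot> dd (contr U c) (Ys @ [Y])"
    using Cons.prems U by (intro Cons.IH cochain_contr last_linear_contr)
  moreover have "L U c (Ys @ [f \<odot> Y]) = f \<odot> L U c (Ys @ [Y])"
    using Cons.prems U by (intro lie_last)
  ultimately show ?case
    by (simp only: append_Cons cobd.simps fmult_diff_right)
qed

end

section \<open>The degree of the Loday differential\<close>

text \<open>
  The \<open>i\<close>-th argument is removed and absorbed into the \<open>m\<close>-th of the remaining ones. With \<open>A\<close> the
  bracket these are the bracket terms of the classical formula for the Loday differential.
\<close>

definition insert_op :: "nat \<Rightarrow> nat \<Rightarrow> ('s \<Rightarrow> 's \<Rightarrow> 's) \<Rightarrow> ('s list \<Rightarrow> 't) \<Rightarrow> 's list \<Rightarrow> 't" where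
  "insert_op i m A c Xs = c ((omit i Xs)[m := A (Xs ! i) (omit i Xs ! m)])"

lemma lie_explicit:
  "lie \<rho> B X c Ys = \<rho> X (c Ys) - (\<Sum>j<length Ys. c (Ys[j := B X (Ys ! j)]))"
proof (induction Ys arbitrary: c)
  case Nil
  show ?case by (simp only: lie.simps list.size lessThan_0 sum.empty diff_0_right)
next
  case (Cons Y Ys)
  have "(\<Sum>j<length (Y # Ys). c ((Y # Ys)[j := B X ((Y # Ys) ! j)])) =
      c (B X Y # Ys) + (\<Sum>j<length Ys. contr Y c (Ys[j := B X (Ys ! j)]))"
    by (simp only: list.size add_0_right add_Suc_right sum.lessThan_Suc_shift nth_Cons_0 nth_Cons_Suc
        list_update_code contr_def)
  then show ?case
    by (simp only: lie.simps Cons.IH) (simp only: contr_def diff_diff_eq add.commute)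
qed

text \<open>
  Unfolding Cartan's formula along the list gives the classical sum, which is what the count of
  derivatives needs: in it every argument can be varied separately.
\<close>

lemma cobd_explicit:
  "cobd \<rho> B c Xs = (\<Sum>i<length Xs.
    (\<lambda>_. (-1) ^ i) \<odot> lie \<rho> B (Xs ! i) (\<lambda>Ys. c (take i Xs @ Ys)) (drop (Suc i) Xs))"
proof (induction Xs arbitrary: c)
  case Nil
  show ?case by (simp only: cobd.simps list.size lessThan_0 sum.empty)
next
  case (Cons X Xs)
  show ?case
    unfolding list.size add_0_right add_Suc_right sum.lessThan_Suc_shift cobd.simps Cons.IH
    by (auto simp: fun_eq_iff sum_fun_apply contr_def sum_negf)
qed

lemma lie_omit:
  assumes "length Xs = Suc k" "i \<le> k"
  shows "lie \<rho> B (Xs ! i) (\<lambda>Ys. c (take i Xs @ Ys)) (drop (Suc i) Xs) =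
    \<rho> (Xs ! i) (c (omit i Xs)) + (\<Sum>j<k - i. (\<lambda>_. -1) \<odot> insert_op i (i + j) B c Xs)"
proof -
  have "take i Xs @ (drop (Suc i) Xs)[j := Z] = (omit i Xs)[i + j := Z]"
    "drop (Suc i) Xs ! j = omit i Xs ! (i + j)" for j Z
    using assms by (simp_all add: omit_def list_update_append nth_append)
  then have "lie \<rho> B (Xs ! i) (\<lambda>Ys. c (take i Xs @ Ys)) (drop (Suc i) Xs) =
      \<rho> (Xs ! i) (c (omit i Xs)) - (\<Sum>j<k - i. insert_op i (i + j) B c Xs)"
    unfolding lie_explicit insert_op_def using assms by (simp only: omit_def length_drop diff_Suc_Suc)
  then show ?thesis by (auto simp: fun_eq_iff sum_fun_apply sum_negf)
qed

context vector_bundle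
begin

text \<open>
  A factor \<open>f\<close> in front of either argument of the tensor \<open>A\<close> comes out of \<open>A\<close> and sits in front of the
  \<open>m\<close>-th argument of \<open>c\<close>. So \<open>\<delta>\<^sub>l(f)\<close> of the insertion is an insertion into some \<open>\<delta>(f) c\<close>, and the degree
  does not grow.
\<close>

lemma ann_insert_tensor:
  assumes "i \<le> k" "m < k"
    and A: "\<And>X Y. X \<in> Sec \<Longrightarrow> Y \<in> Sec \<Longrightarrow> A X Y \<in> Sec"
      "\<And>X Y f. X \<in> Sec \<Longrightarrow> Y \<in> Sec \<Longrightarrow> f \<in> Cinf \<Longrightarrow> A (f \<odot> X) Y = f \<odot> A X Y"
      "\<And>X Y f. X \<in> Sec \<Longrightarrow> Y \<in> Sec \<Longrightarrow> f \<in> Cinf \<Longrightarrow> A X (f \<odot> Y) = f \<odot> A X Y"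
  shows "ann k n c \<Longrightarrow> ann (Suc k) n (insert_op i m A c)"
proof (induction n arbitrary: c)
  case 0
  have "(omit i Xs)[m := A (Xs ! i) (omit i Xs ! m)] \<in> args k" if "Xs \<in> args (Suc k)" for Xs
    using omit_args[OF that assms(1)] args_nth[OF that, of i]
      args_nth[OF omit_args[OF that assms(1)], of m] assms(1,2)
    by (intro args_update A(1)) auto
  then show ?case using 0 unfolding ann.simps insert_op_def by blast
next
  case (Suc n)
  show ?case
    unfolding ann.simps
  proof (intro allI impI ballI)
    fix l f assume l: "l < Suc k" and f: "f \<in> Cinf"
    define l' where "l' = (if l < i then l else l - 1)"
    define l'' where "l'' = (if l = i then m else l')"
    have "l'' < k" using l assms(1,2) by (auto simp: l'_def l''_def)
    then have "ann (Suc k) n (insert_op i m A (delta l'' f c))"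
      using Suc.prems f by (intro Suc.IH) auto
    then show "ann (Suc k) n (delta l f (insert_op i m A c))"
    proof (rule ann_cong[rotated])
      fix Xs assume Xs: "Xs \<in> args (Suc k)"
      then have len: "length Xs = Suc k" "length (omit i Xs) = k"
        using omit_args[OF Xs assms(1)] by (simp_all add: args_def)
      have S: "Xs ! i \<in> Sec" "omit i Xs ! m \<in> Sec"
        using args_nth[OF Xs, of i] args_nth[OF omit_args[OF Xs assms(1)], of m] assms by auto
      define Ys where "Ys = omit i Xs"
      define W where "W = Ys[m := A (Xs ! i) (Ys ! m)]"
      have "(omit i (Xs[l := f \<odot> Xs ! l]))[m := A (Xs[l := f \<odot> Xs ! l] ! i) (omit i (Xs[l := f \<odot> Xs ! l]) ! m)] =
          W[l'' := f \<odot> W ! l'']"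
      proof (cases "l = i")
        case True
        then show ?thesis
          using A(2)[OF S f] l len assms(2) by (simp add: omit_update_same W_def l''_def Ys_def)
      next
        case False
        have u: "omit i (Xs[l := Z]) = Ys[l' := Z]" "Ys ! l' = Xs ! l" for Z
          using omit_update[of l i Xs] False l assms(1) by (simp_all add: len l'_def Ys_def)
        have "Xs[l := f \<odot> Xs ! l] ! i = Xs ! i" using False by simp
        moreover have "(Ys[l' := f \<odot> Xs ! l])[m := A (Xs ! i) (Ys[l' := f \<odot> Xs ! l] ! m)] = W[l' := f \<odot> W ! l']"
        proof (cases "l' = m")
          case True
          then show ?thesis
            using A(3)[OF S f] len assms(2) u(2) unfolding W_def Ys_def[symmetric] by simp
        next
          case False
          then show ?thesis
            using u(2) unfolding W_def by (simp add: list_update_swap)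
        qed
        ultimately show ?thesis using False u(1) by (simp only: l''_def if_False)
      qed
      then show "insert_op i m A (delta l'' f c) Xs = delta l f (insert_op i m A c) Xs"
        unfolding delta_def insert_op_def by (simp only: W_def Ys_def)
    qed
  qed
qed

text \<open>
  Additivity in each argument, in a form that is inherited by \<open>\<delta>\<^sub>j(f) c\<close>.
\<close>

definition slot_additive :: "nat \<Rightarrow> (('m \<Rightarrow> 'f) list \<Rightarrow> 'm \<Rightarrow> real) \<Rightarrow> bool" where
  "slot_additive k c \<longleftrightarrow> (\<forall>Ys\<in>args k. \<forall>m<k. \<forall>U\<in>Sec. \<forall>V\<in>Sec.
     c (Ys[m := U + V]) = c (Ys[m := U]) + c (Ys[m := V]))"

lemma slot_additive_multilinear:
  assumes "multilinear_op k c"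
  shows "slot_additive k c"
  unfolding slot_additive_def
proof (intro ballI allI impI)
  fix Ys m U V assume *: "Ys \<in> args k" "m < k" "U \<in> Sec" "V \<in> Sec"
  have a: "Ys[m := U] \<in> args k" using * by (intro args_update)
  have "c ((Ys[m := U])[m := (Ys[m := U]) ! m + V]) = c (Ys[m := U]) + c ((Ys[m := U])[m := V])"
    using assms a *(2,4) unfolding multilinear_op_def by blast
  then show "c (Ys[m := U + V]) = c (Ys[m := U]) + c (Ys[m := V])"
    using * by (simp only: list_update_overwrite nth_list_update_eq args_def mem_Collect_eq)
qed

lemma slot_additive_delta:
  assumes "slot_additive k c" "j < k" "f \<in> Cinf"
  shows "slot_additive k (delta j f c)"
  unfolding slot_additive_def
proof (intro ballI allI impI)
  fix Ys m U V assume *: "Ys \<in> args k" "m < k" "U \<in> Sec" "V \<in> Sec"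
  have len: "length Ys = k" using * by (simp add: args_def)
  have add: "c (Zs[n := P + Q]) = c (Zs[n := P]) + c (Zs[n := Q])"
    if "Zs \<in> args k" "n < k" "P \<in> Sec" "Q \<in> Sec" for Zs n P Q
    using assms(1) that unfolding slot_additive_def by blast
  show "delta j f c (Ys[m := U + V]) = delta j f c (Ys[m := U]) + delta j f c (Ys[m := V])"
  proof (cases "j = m")
    case True
    have "c (Ys[m := f \<odot> U + f \<odot> V]) = c (Ys[m := f \<odot> U]) + c (Ys[m := f \<odot> V])"
      using * assms(3) by (intro add Sec_fmult)
    then show ?thesis
      using True * len unfolding delta_def add[OF *]
      by (simp only: list_update_overwrite nth_list_update_eq fmult_add_right) (auto simp: fun_eq_iff)
  next
    case False
    have Z: "Ys[j := f \<odot> Ys ! j] \<in> args k" using * assms by (intro args_update_fmult)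
    have "(Ys[m := P])[j := f \<odot> (Ys[m := P]) ! j] = (Ys[j := f \<odot> Ys ! j])[m := P]" for P
      using False by (simp add: list_update_swap)
    then show ?thesis
      unfolding delta_def by (simp only: add[OF *] add[OF Z *(2-4)]) (auto simp: fun_eq_iff algebra_simps)
  qed
qed

end

context anchored_loday
begin

text \<open>
  The bracket itself is a first order operator: a factor \<open>f\<close> comes out of it up to a tensor, which is
  \<open>\<delta>\<^sub>1(f) B\<close> for the first argument and \<open>\<rho>(X)(f) Y\<close> for the second one. Inserting these tensors does not
  raise the degree, so inserting the bracket raises it by one.
\<close>

lemma ann_insert_bracket:
  assumes "i \<le> k" "m < k"
  shows "ann k n c \<Longrightarrow> slot_additive k c \<Longrightarrow> ann (Suc k) (Suc n) (insert_op i m B c)"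
proof (induction n arbitrary: c)
  case 0
  have "(omit i Xs)[m := B (Xs ! i) (omit i Xs ! m)] \<in> args k" if "Xs \<in> args (Suc k)" for Xs
    using omit_args[OF that assms(1)] args_nth[OF that, of i]
      args_nth[OF omit_args[OF that assms(1)], of m] assms
    by (intro args_update B_Sec) auto
  then have "insert_op i m B c Xs = 0" if "Xs \<in> args (Suc k)" for Xs
    using 0 that unfolding ann.simps insert_op_def by blast
  then show ?case by (intro ann_zero)
next
  case (Suc n)
  show ?case
    unfolding ann.simps(2)[of _ "Suc n"]
  proof (intro allI impI ballI)
    fix l f assume l: "l < Suc k" and f: "f \<in> Cinf"
    define l' where "l' = (if l < i then l else l - 1)"
    define l'' where "l'' = (if l = i then m else l')"
    define T where "T X Y = B (f \<odot> X) Y - f \<odot> B X Y" for X Y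
    define T' where "T' X Y = \<rho> X f \<odot> Y" for X and Y :: "'m \<Rightarrow> 'f"
    have l'': "l'' < k" using l assms by (auto simp: l'_def l''_def)
    then have 1: "ann (Suc k) (Suc n) (insert_op i m B (delta l'' f c))"
      using Suc.prems f by (intro Suc.IH slot_additive_delta) auto
    have T_Sec: "T X Y \<in> Sec" "T' X Y \<in> Sec" if "X \<in> Sec" "Y \<in> Sec" for X Y
      using that f unfolding T_def T'_def
      by (auto intro!: Sec_diff B_Sec Sec_fmult anchor_Cinf[OF anchor])
    have 2: "ann (Suc k) (Suc n) (insert_op i m T c)"
    proof (rule ann_insert_tensor[OF assms T_Sec(1) _ _ Suc.prems(1)])
      fix X Y g assume *: "X \<in> Sec" "Y \<in> Sec" "g \<in> Cinf"
      show "T (g \<odot> X) Y = g \<odot> T X Y"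
        unfolding T_def B_degree[OF *(1,2) f *(3)] by (auto simp: fun_eq_iff algebra_simps)
      have fX: "f \<odot> X \<in> Sec" using * f by (intro Sec_fmult)
      show "T X (g \<odot> Y) = g \<odot> T X Y"
        unfolding T_def B_fmult_right[OF *] B_fmult_right[OF fX *(2,3)] anchor_fmult_left[OF anchor *(1) f *(3)]
        by (auto simp: fun_eq_iff algebra_simps)
    qed
    have 3: "ann (Suc k) (Suc n) (insert_op i m T' c)"
    proof (rule ann_insert_tensor[OF assms T_Sec(2) _ _ Suc.prems(1)])
      fix X and Y :: "'m \<Rightarrow> 'f" and g assume *: "X \<in> Sec" "Y \<in> Sec" "g \<in> Cinf"
      show "T' (g \<odot> X) Y = g \<odot> T' X Y"
        unfolding T'_def anchor_fmult_left[OF anchor *(1,3) f] by (auto simp: fun_eq_iff algebra_simps)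
      show "T' X (g \<odot> Y) = g \<odot> T' X Y"
        unfolding T'_def by (auto simp: fun_eq_iff algebra_simps)
    qed
    have len: "length Xs = Suc k" "length (omit i Xs) = k"
      and S: "Xs ! i \<in> Sec" "omit i Xs ! m \<in> Sec" "omit i Xs \<in> args k" if "Xs \<in> args (Suc k)" for Xs
      using that omit_args[OF that assms(1)] args_nth[OF that, of i]
        args_nth[OF omit_args[OF that assms(1)], of m] assms by (auto simp: args_def)
    have add: "c (Zs[m := P + Q]) = c (Zs[m := P]) + c (Zs[m := Q])"
      if "Zs \<in> args k" "P \<in> Sec" "Q \<in> Sec" for Zs P Q
      using Suc.prems(2) that assms(2) unfolding slot_additive_def by blast
    show "ann (Suc k) (Suc n) (delta l f (insert_op i m B c))"
    proof (cases "l = i")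
      case True
      have "ann (Suc k) (Suc n) (\<lambda>Xs. insert_op i m B (delta l'' f c) Xs + insert_op i m T c Xs)"
        by (rule ann_add[OF 1 2])
      then show ?thesis
      proof (rule ann_cong[rotated])
        fix Xs assume Xs: "Xs \<in> args (Suc k)"
        note S = S[OF Xs] and len = len[OF Xs]
        let ?Z = "B (Xs ! i) (omit i Xs ! m)"
        have "B (f \<odot> Xs ! i) (omit i Xs ! m) = f \<odot> ?Z + T (Xs ! i) (omit i Xs ! m)"
          by (simp add: T_def)
        then have "c ((omit i Xs)[m := B (f \<odot> Xs ! i) (omit i Xs ! m)]) =
            c ((omit i Xs)[m := f \<odot> ?Z]) + c ((omit i Xs)[m := T (Xs ! i) (omit i Xs ! m)])"
          using add[OF S(3), of "f \<odot> ?Z" "T (Xs ! i) (omit i Xs ! m)"] S f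
          by (simp only: Sec_fmult B_Sec T_Sec)
        then show "insert_op i m B (delta l'' f c) Xs + insert_op i m T c Xs =
            delta l f (insert_op i m B c) Xs"
          unfolding insert_op_def delta_def using True len l assms(2)
          by (simp only: l''_def if_True omit_update_same nth_list_update_eq list_update_overwrite)
            (auto simp: fun_eq_iff)
      qed
    next
      case ne: False
      have u: "omit i (Xs[l := Z]) = (omit i Xs)[l' := Z]" "omit i Xs ! l' = Xs ! l"
        "Xs[l := Z] ! i = Xs ! i" if "Xs \<in> args (Suc k)" for Xs Z
        using omit_update[of l i Xs] ne l assms(1) len[OF that] by (simp_all add: l'_def)
      show ?thesis
      proof (cases "l' = m")
        case True
        have "ann (Suc k) (Suc n) (\<lambda>Xs. insert_op i m B (delta l'' f c) Xs + insert_op i m T' c Xs)"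
          by (rule ann_add[OF 1 3])
        then show ?thesis
        proof (rule ann_cong[rotated])
          fix Xs assume Xs: "Xs \<in> args (Suc k)"
          note S = S[OF Xs] and len = len[OF Xs] and u = u[OF Xs]
          let ?Z = "B (Xs ! i) (omit i Xs ! m)"
          have "B (Xs ! i) (f \<odot> omit i Xs ! m) = f \<odot> ?Z + T' (Xs ! i) (omit i Xs ! m)"
            unfolding T'_def by (rule B_fmult_right[OF S(1,2) f])
          then have "c ((omit i Xs)[m := B (Xs ! i) (f \<odot> omit i Xs ! m)]) =
              c ((omit i Xs)[m := f \<odot> ?Z]) + c ((omit i Xs)[m := T' (Xs ! i) (omit i Xs ! m)])"
            using add[OF S(3), of "f \<odot> ?Z" "T' (Xs ! i) (omit i Xs ! m)"] S f
            by (simp only: Sec_fmult B_Sec T_Sec)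
          then show "insert_op i m B (delta l'' f c) Xs + insert_op i m T' c Xs =
              delta l f (insert_op i m B c) Xs"
            unfolding insert_op_def delta_def u using True ne len assms(2) u(2)[symmetric]
            by (simp only: l''_def if_False nth_list_update_eq list_update_overwrite)
              (auto simp: fun_eq_iff)
        qed
      next
        case False
        show ?thesis
        proof (rule ann_cong[OF _ 1])
          fix Xs assume Xs: "Xs \<in> args (Suc k)"
          note u = u[OF Xs]
          have "((omit i Xs)[m := Z])[l' := f \<odot> (omit i Xs)[m := Z] ! l'] = (omit i Xs)[l' := f \<odot> Xs ! l, m := Z]"
            for Z using False u(2) by (simp add: list_update_swap)
          moreover have "(omit i Xs)[l' := f \<odot> Xs ! l] ! m = omit i Xs ! m" using False by simp
          ultimately show "insert_op i m B (delta l'' f c) Xs = delta l f (insert_op i m B c) Xs"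
            unfolding insert_op_def delta_def u using ne by (simp only: l''_def if_False)
        qed
      qed
    qed
  qed
qed

lemma ann_cobd:
  assumes "c \<in> Dsp k"
  shows "ann (Suc k) (Suc (max k 1)) (dd c)"
proof -
  have a: "ann k (max k 1) c" by (rule Dsp_ann[OF assms])
  have "ann (Suc k) (Suc (max k 1)) (\<lambda>Xs. \<Sum>i<Suc k. (\<lambda>_. (-1) ^ i) \<odot>
      (\<rho> (Xs ! i) (c (omit i Xs)) + (\<Sum>j<k - i. (\<lambda>_. -1) \<odot> insert_op i (i + j) B c Xs)))"
    using Dsp_Cinf[OF assms] slot_additive_multilinear[OF Dsp_multilinear[OF assms]] a
    by (intro ann_sum ann_fmult ann_add ann_anchor_omit[OF anchor] ann_insert_bracket) auto
  then show ?thesis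
  proof (rule ann_cong[rotated])
    fix Xs assume "Xs \<in> args (Suc k)"
    then have len: "length Xs = Suc k" by (simp add: args_def)
    show "(\<Sum>i<Suc k. (\<lambda>_. (-1) ^ i) \<odot>
        (\<rho> (Xs ! i) (c (omit i Xs)) + (\<Sum>j<k - i. (\<lambda>_. -1) \<odot> insert_op i (i + j) B c Xs))) = dd c Xs"
      unfolding cobd_explicit len
    proof (rule sum.cong[OF refl])
      fix i assume "i \<in> {..<Suc k}"
      then have "i \<le> k" by simp
      show "(\<lambda>_. (-1) ^ i) \<odot>
          (\<rho> (Xs ! i) (c (omit i Xs)) + (\<Sum>j<k - i. (\<lambda>_. -1) \<odot> insert_op i (i + j) B c Xs)) =
          (\<lambda>_. (-1) ^ i) \<odot> L (Xs ! i) (\<lambda>Ys. c (take i Xs @ Ys)) (drop (Suc i) Xs)"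
        unfolding lie_omit[OF len \<open>i \<le> k\<close>] ..
    qed
  qed
qed

section \<open>The homological vector field of a Loday algebroid\<close>

lemma Dsp_cochain:
  assumes "c \<in> Dsp k"
  shows "cochain c"
proof -
  have "Cinf_valued c"
    unfolding Cinf_valued_def
    using Dsp_Cinf[OF assms] Dsp_outside[OF assms] Cinf_zero by metis
  moreover have "c (Xs @ ((\<lambda>_. r) \<odot> X + Y) # Ys) = (\<lambda>_. r) \<odot> c (Xs @ X # Ys) + c (Xs @ Y # Ys)"
    if *: "set Xs \<subseteq> Sec" "set Ys \<subseteq> Sec" "X \<in> Sec" "Y \<in> Sec" for Xs Ys X Y r
  proof (cases "length Xs + Suc (length Ys) = k")
    case True
    have rX: "(\<lambda>_. r) \<odot> X \<in> Sec" using * by (intro Sec_fmult Cinf_const)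
    have a: "Xs @ Z # Ys \<in> args k" if "Z \<in> Sec" for Z
      using * that True by (auto simp: args_def)
    note M = Dsp_multilinear[OF assms, unfolded multilinear_op_def]
    have lt: "length Xs < k" using True by simp
    have "c ((Xs @ ((\<lambda>_. r) \<odot> X) # Ys)[length Xs := (Xs @ ((\<lambda>_. r) \<odot> X) # Ys) ! length Xs + Y]) =
      c (Xs @ ((\<lambda>_. r) \<odot> X) # Ys) + c ((Xs @ ((\<lambda>_. r) \<odot> X) # Ys)[length Xs := Y])"
      using M a[OF rX] lt *(4) by blast
    moreover have "c ((Xs @ X # Ys)[length Xs := (\<lambda>_. r) \<odot> (Xs @ X # Ys) ! length Xs]) = (\<lambda>_. r) \<odot> c (Xs @ X # Ys)"
      using M a[OF *(3)] lt by blast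
    ultimately show ?thesis
      by (simp only: list_update_length nth_append_length)
  next
    case False
    then have "Xs @ Z # Ys \<notin> args k" for Z by (auto simp: args_def)
    then show ?thesis using Dsp_outside[OF assms] by (auto simp: fun_eq_iff)
  qed
  ultimately show ?thesis unfolding cochain_def by blast
qed

lemma cochain_zero: "cochain 0"
  by (rule Dsp_cochain[OF Dsp_zero])

lemma Dtot_cochain: "c \<in> Dtot \<Longrightarrow> cochain c"
proof (induction rule: Dtot_induct)
  case zero
  show ?case by (rule cochain_zero)
next
  case (add k a b)
  have "a + b = comb 1 a b" by (auto simp: comb_def fun_eq_iff)
  then show ?case using cochain_comb[OF Dsp_cochain[OF add(1)] add(3), of 1] by (simp only:)
qed

lemma Dtot_outside: "c \<in> Dtot \<Longrightarrow> \<not> set Xs \<subseteq> Sec \<Longrightarrow> c Xs = 0"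
proof (induction rule: Dtot_induct)
  case (add k a b)
  then show ?case using Dsp_outside[OF add(1), of Xs] by (simp add: args_def)
qed simp

lemma last_linear_Dsp:
  assumes "c \<in> Dsp k"
  shows "last_linear c"
  unfolding last_linear_def
proof (intro allI impI)
  fix Xs X f assume *: "set Xs \<subseteq> Sec \<and> X \<in> Sec \<and> f \<in> Cinf"
  show "c (Xs @ [f \<odot> X]) = f \<odot> c (Xs @ [X])"
  proof (cases "length Xs + 1 = k")
    case True
    then have "Xs @ [X] \<in> args k" "k > 0" "k - 1 = length Xs" using * by (auto simp: args_def)
    then have "delta (length Xs) f c (Xs @ [X]) = 0"
      using Dsp_last[OF assms] * by metis
    then show ?thesis by (simp add: delta_def)
  next
    case False
    then have "Xs @ [Z] \<notin> args k" for Z by (auto simp: args_def One_nat_def)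
    then show ?thesis using Dsp_outside[OF assms] by (auto simp: fun_eq_iff)
  qed
qed

definition differential ::
  "(('m \<Rightarrow> 'f) list \<Rightarrow> 'm \<Rightarrow> real) \<Rightarrow> ('m \<Rightarrow> 'f) list \<Rightarrow> 'm \<Rightarrow> real" where
  "differential c = (if c \<in> Dtot then (\<lambda>Xs. if set Xs \<subseteq> Sec then dd c Xs else 0) else 0)"

lemma differential_eq: "c \<in> Dtot \<Longrightarrow> set Xs \<subseteq> Sec \<Longrightarrow> differential c Xs = dd c Xs"
  and differential_outside: "\<not> set Xs \<subseteq> Sec \<Longrightarrow> differential c Xs = 0"
  by (auto simp: differential_def)

lemma differential_Dsp:
  assumes "c \<in> Dsp k"
  shows "differential c \<in> Dsp (Suc k)"
proof -
  note cT = Dsp_subset_Dtot[OF assms] and cc = Dsp_cochain[OF assms] and cl = last_linear_Dsp[OF assms]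
  note eq = differential_eq[OF cT]
  have dc: "cochain (dd c)" by (rule cochain_cobd[OF cc])
  have out: "differential c Xs = 0" if "Xs \<notin> args (Suc k)" for Xs
  proof (cases "set Xs \<subseteq> Sec")
    case True
    \<comment> \<open>The projection to degree \<open>k\<close> fixes \<open>c\<close>; pushing it through \<open>dd\<close> locates the degree of \<open>dd c\<close>.\<close>
    have "weight (\<lambda>n. if n = k then 1 else 0) c = c"
      using Dsp_outside[OF assms] by (auto simp: weight_def args_def fun_eq_iff)
    then have "dd c Xs = (\<lambda>_. if length Xs - 1 = k then 1 else 0) \<odot> dd c Xs"
      using cobd_weight[OF True cochain_valued[OF cc], of "\<lambda>n. if n = k then 1 else 0"] by (simp only:)
    moreover have "length Xs - 1 \<noteq> k \<or> Xs = []"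
      using that True by (cases Xs) (auto simp: args_def)
    ultimately have "dd c Xs = 0" by (auto simp: fun_eq_iff)
    then show ?thesis using eq[OF True] by simp
  qed (rule differential_outside)
  have D: "dd c Xs = differential c Xs" if "Xs \<in> args (Suc k)" for Xs
    using eq that by (simp add: args_def)
  have val: "differential c Xs \<in> Cinf" if "Xs \<in> args (Suc k)" for Xs
    using D[OF that] Cinf_valuedD[OF cochain_valued[OF dc], of Xs] that by (simp add: args_def)
  have mult: "multilinear_op (Suc k) (dd c)"
    unfolding multilinear_op_def
  proof (intro ballI allI impI)
    fix Xs i assume Xs: "Xs \<in> args (Suc k)" and i: "i < Suc k"
    let ?P = "take i Xs" and ?S = "drop (Suc i) Xs"
    have len: "i < length Xs" using Xs i by (simp add: args_def)
    have S: "set ?P \<subseteq> Sec" "set ?S \<subseteq> Sec" "Xs ! i \<in> Sec"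
      using Xs args_nth[OF Xs i] set_take_subset[of i Xs] set_drop_subset[of "Suc i" Xs]
      by (auto simp: args_def)
    have u: "Xs[i := Z] = ?P @ Z # ?S" for Z using len by (rule upd_conv_take_nth_drop)
    have Xs_eq: "dd c Xs = dd c (?P @ Xs ! i # ?S)" using id_take_nth_drop[OF len] by simp
    have one: "(\<lambda>_. 1) \<odot> Z = Z" for Z :: "'m \<Rightarrow> 'v::real_vector" by (auto simp: fmult_def)
    have "dd c (?P @ (Xs ! i + Y) # ?S) = dd c (?P @ Xs ! i # ?S) + dd c (?P @ Y # ?S)" if "Y \<in> Sec" for Y
      using cochainD[OF dc S(1,2,3) that, of 1] unfolding one .
    moreover have "dd c (?P @ ((\<lambda>_. r) \<odot> Xs ! i) # ?S) = (\<lambda>_. r) \<odot> dd c (?P @ Xs ! i # ?S)" for r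
    proof -
      have "dd c (?P @ ((\<lambda>_. 1) \<odot> 0 + 0) # ?S) = (\<lambda>_. 1) \<odot> dd c (?P @ 0 # ?S) + dd c (?P @ 0 # ?S)"
        by (rule cochainD[OF dc S(1,2) Sec_zero Sec_zero])
      then have "dd c (?P @ 0 # ?S) = 0" unfolding one by simp
      then show ?thesis
        using cochainD[OF dc S(1,2,3) Sec_zero, of r] by simp
    qed
    ultimately show "(\<forall>Y\<in>Sec. dd c (Xs[i := Xs ! i + Y]) = dd c Xs + dd c (Xs[i := Y])) \<and>
        (\<forall>r. dd c (Xs[i := (\<lambda>_. r) \<odot> Xs ! i]) = (\<lambda>_. r) \<odot> dd c Xs)"
      unfolding u Xs_eq by blast
  qed
  have last: "delta (Suc k - 1) f (differential c) Xs = 0" if f: "f \<in> Cinf" and Xs: "Xs \<in> args (Suc k)" for f Xs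
  proof -
    obtain Ys Y where Y: "Xs = Ys @ [Y]" "length Ys = k"
      using Xs by (cases Xs rule: rev_cases) (auto simp: args_def)
    then have S: "set Ys \<subseteq> Sec" "Y \<in> Sec" using Xs by (auto simp: args_def)
    have "dd c (Ys @ [f \<odot> Y]) = f \<odot> dd c (Ys @ [Y])"
      by (rule cobd_last[OF cc cl S f])
    moreover have "Xs ! k = Y" "Xs[k := Z] = Ys @ [Z]" for Z
      unfolding Y(1) Y(2)[symmetric] by simp_all
    moreover have "set (Ys @ [f \<odot> Y]) \<subseteq> Sec" "set (Ys @ [Y]) \<subseteq> Sec"
      using S Sec_fmult[OF f S(2)] by auto
    ultimately show ?thesis
      unfolding delta_def diff_Suc_1 by (simp only: eq Y(1)) simp
  qed
  have ann: "ann (Suc k) (max (Suc k) 1) (differential c)"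
  proof (cases "k = 0")
    case False
    then have "Suc (max k 1) = max (Suc k) 1" by simp
    then have "ann (Suc k) (max (Suc k) 1) (dd c)" using ann_cobd[OF assms] by (simp only:)
    then show ?thesis by (rule ann_cong[rotated]) (rule D)
  next
    case True
    \<comment> \<open>Over a function \<open>c\<close>, linearity over functions in the only argument is total degree \<open>0\<close>.\<close>
    have "ann 1 1 (differential c)"
      using last True by (simp add: One_nat_def)
    then show ?thesis using True by (simp add: One_nat_def)
  qed
  show ?thesis
    unfolding Dsp_iff
  proof (intro conjI allI impI ballI)
    show "multilinear_op (Suc k) (differential c)" by (rule multilinear_cong[OF D mult])
    show "delta (Suc k - 1) f (differential c) Xs = 0" if "f \<in> Cinf" "Xs \<in> args (Suc k)" for f Xs
      by (rule last[OF that])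
  qed (fact out val ann)+
qed

lemma differential_add:
  assumes "c \<in> Dtot" "c' \<in> Dtot"
  shows "differential (c + c') = differential c + differential c'"
proof
  fix Xs
  have e: "c + c' = comb 1 c c'" by (auto simp: comb_def fun_eq_iff)
  show "differential (c + c') Xs = (differential c + differential c') Xs"
  proof (cases "set Xs \<subseteq> Sec")
    case True
    have "dd (c + c') Xs = (\<lambda>_. 1) \<odot> dd c Xs + dd c' Xs"
      unfolding e using True assms by (intro cobd_comb cochain_valued Dtot_cochain)
    then show ?thesis
      unfolding plus_fun_apply differential_eq[OF Dtot_add[OF assms] True]
        differential_eq[OF assms(1) True] differential_eq[OF assms(2) True]
      by (simp only:) (auto simp: fun_eq_iff)
  qed (simp add: differential_outside)
qed

lemma Dtot_scale: "c \<in> Dtot \<Longrightarrow> (\<lambda>Xs. (\<lambda>_. r) \<odot> c Xs) \<in> Dtot"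
proof (induction rule: Dtot_induct)
  case zero
  have "(\<lambda>Xs. (\<lambda>_. r) \<odot> 0 Xs) = (0 :: ('m \<Rightarrow> 'f) list \<Rightarrow> 'm \<Rightarrow> real)" by (auto simp: fun_eq_iff)
  then show ?case using Dsp_subset_Dtot[OF Dsp_zero] by (simp only:)
next
  case (add k a b)
  have "(\<lambda>Xs. (\<lambda>_. r) \<odot> (a + b) Xs) = (\<lambda>Xs. (\<lambda>_. r) \<odot> a Xs) + (\<lambda>Xs. (\<lambda>_. r) \<odot> b Xs)"
    by (auto simp: fun_eq_iff algebra_simps)
  then show ?case
    using Dtot_add[OF Dsp_subset_Dtot[OF Dsp_fmult_const[OF add(1) Cinf_const]] add(3)] by (simp only:)
qed

lemma differential_scale:
  assumes "c \<in> Dtot"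
  shows "differential (\<lambda>Xs. (\<lambda>_. r) \<odot> c Xs) = (\<lambda>Xs. (\<lambda>_. r) \<odot> differential c Xs)"
proof
  fix Xs
  show "differential (\<lambda>Xs. (\<lambda>_. r) \<odot> c Xs) Xs = (\<lambda>_. r) \<odot> differential c Xs"
  proof (cases "set Xs \<subseteq> Sec")
    case True
    have "dd (weight (\<lambda>_. r) c) Xs = (\<lambda>_. r) \<odot> dd c Xs"
      using True assms by (intro cobd_weight cochain_valued Dtot_cochain)
    then show ?thesis
      unfolding differential_eq[OF Dtot_scale[OF assms] True] differential_eq[OF assms True] weight_def .
  qed (auto simp: differential_outside)
qed

lemma differential_Dtot: "c \<in> Dtot \<Longrightarrow> differential c \<in> Dtot"
proof (induction rule: Dtot_induct)
  case zero
  show ?case by (rule Dsp_subset_Dtot[OF differential_Dsp[OF Dsp_zero]])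
next
  case (add k a b)
  show ?case
    unfolding differential_add[OF Dsp_subset_Dtot[OF add(1)] add(2)]
    by (rule Dtot_add[OF Dsp_subset_Dtot[OF differential_Dsp[OF add(1)]] add(3)])
qed

lemma differential_shuffle_prod:
  assumes "c \<in> Dsp k" "c' \<in> Dtot"
  shows "differential (c \<bowtie> c') = differential c \<bowtie> c' + (\<lambda>Xs p. (-1) ^ k * (c \<bowtie> differential c') Xs p)"
proof
  fix Xs
  note cT = Dsp_subset_Dtot[OF assms(1)]
  have T: "c \<bowtie> c' \<in> Dtot" "differential c \<bowtie> c' \<in> Dtot" "c \<bowtie> differential c' \<in> Dtot"
    using shuffle_prod_Dtot assms differential_Dsp differential_Dtot by blast+
  show "differential (c \<bowtie> c') Xs =
      (differential c \<bowtie> c' + (\<lambda>Xs p. (-1) ^ k * (c \<bowtie> differential c') Xs p)) Xs"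
  proof (cases "set Xs \<subseteq> Sec")
    case False
    then show ?thesis
      using Dtot_outside[OF T(2) False] Dtot_outside[OF T(3) False] by (auto simp: fun_eq_iff differential_outside)
  next
    case True
    have inv: "invol c = comb ((-1) ^ k) c 0"
    proof (intro ext)
      fix Ys p
      show "invol c Ys p = comb ((-1) ^ k) c 0 Ys p"
        using Dsp_outside[OF assms(1), of Ys]
        by (cases "length Ys = k") (auto simp: invol_def comb_def args_def)
    qed
    have "differential (c \<bowtie> c') Xs = (dd c \<bowtie> c') Xs + (invol c \<bowtie> dd c') Xs"
      unfolding differential_eq[OF T(1) True]
      using True assms by (intro cobd_shuffle_prod cochain_valued Dsp_cochain Dtot_cochain)
    also have "(dd c \<bowtie> c') Xs = (differential c \<bowtie> c') Xs"
      using True differential_eq[OF cT] by (intro shuffle_prod_cong) auto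
    also have "(invol c \<bowtie> dd c') Xs = (invol c \<bowtie> differential c') Xs"
      using True differential_eq[OF assms(2)] by (intro shuffle_prod_cong) auto
    also have "(invol c \<bowtie> differential c') Xs = (\<lambda>p. (-1) ^ k * (c \<bowtie> differential c') Xs p)"
      unfolding inv shuffle_prod_comb_left by (auto simp: comb_def fun_eq_iff shuffle_prod_def)
    finally show ?thesis by (auto simp: fun_eq_iff)
  qed
qed

lemma deg1_derivation_differential: "deg1_derivation differential"
  unfolding deg1_derivation_def
  using differential_Dsp differential_add differential_scale differential_shuffle_prod
  by (simp add: differential_def)

lemma differential_fun_op: "f \<in> Cinf \<Longrightarrow> X \<in> Sec \<Longrightarrow> differential (fun_op f) [X] = \<rho> X f"
  using differential_eq[OF Dsp_subset_Dtot[OF fun_op_Dsp_0], of f "[X]"] by (simp add: fun_op_def)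

lemma bracket_differential:
  assumes "X \<in> Sec" "Y \<in> Sec"
  shows "bracket differential X Y = B X Y"
proof (rule Sec_eqI)
  note D = deg1_derivation_differential
  show "bracket differential X Y \<in> Sec" "B X Y \<in> Sec"
    using bracket_spec(1)[OF D assms] B_Sec assms by auto
  fix l assume l: "l \<in> DualSec"
  have "l \<in> Dtot" using l Dsp_subset_Dtot[of l 1] by (simp add: Dsp_1_eq_DualSec)
  then have "differential l [X, Y] = dd l [X, Y]"
    using assms by (intro differential_eq) auto
  also have "\<dots> = \<rho> X (l [Y]) - l [B X Y] - \<rho> Y (l [X])"
    by (auto simp: contr_def fun_eq_iff)
  finally show "l [bracket differential X Y] = l [B X Y]"
    unfolding bracket_spec(2)[OF D assms l] anchor_def
    using assms DualSec_Cinf[OF l] by (simp add: differential_fun_op)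
qed

proposition differential_homological: "differential \<in> homological_vector_fields"
proof -
  have "differential c [X, Y, Z] =
      differential (fun_op (c [Y, Z])) [X] - differential (fun_op (c [X, Z])) [Y]
        + differential (fun_op (c [X, Y])) [Z]
      - c [bracket differential X Y, Z] - c [Y, bracket differential X Z] + c [X, bracket differential Y Z]"
    if c: "c \<in> Dsp 2" and S: "X \<in> Sec" "Y \<in> Sec" "Z \<in> Sec" for c X Y Z
  proof -
    have C: "c [U, V] \<in> Cinf" if "U \<in> Sec" "V \<in> Sec" for U V
      using Dsp_Cinf[OF c] that by (simp add: args_def)
    have "differential c [X, Y, Z] = dd c [X, Y, Z]"
      using S by (intro differential_eq[OF Dsp_subset_Dtot[OF c]]) auto
    then show ?thesis
      using S C by (simp add: bracket_differential differential_fun_op) (auto simp: contr_def fun_eq_iff)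
  qed
  moreover have "differential (differential c) = 0" if c: "c \<in> Dtot" for c
  proof
    fix Xs
    show "differential (differential c) Xs = 0 Xs"
    proof (cases "set Xs \<subseteq> Sec")
      case True
      have "dd (differential c) Xs = dd (dd c) Xs"
        using True differential_eq[OF c] by (intro cobd_cong)
      also have "\<dots> = 0" by (rule cobd_cobd[OF True Dtot_cochain[OF c]])
      finally show ?thesis using differential_eq[OF differential_Dtot[OF c] True] by simp
    qed (simp add: differential_outside)
  qed
  ultimately show ?thesis
    unfolding homological_vector_fields_def Der1_def using deg1_derivation_differential by blast
qed

end

section \<open>The anchor of a Loday algebroid\<close>

context vector_bundle
begin

text \<open>
  If \<open>E\<close> has rank \<open>0\<close>, then every function could serve as \<open>f'\<close>, and the choice \<open>0\<close> is made; in
  positive rank \<open>f'\<close> is unique.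
\<close>

definition anchor_of :: "(('m \<Rightarrow> 'f) \<Rightarrow> ('m \<Rightarrow> 'f) \<Rightarrow> 'm \<Rightarrow> 'f) \<Rightarrow> ('m \<Rightarrow> 'f) \<Rightarrow> ('m \<Rightarrow> real) \<Rightarrow> 'm \<Rightarrow> real" where
  "anchor_of B X f = (if \<exists>X\<in>Sec. X \<noteq> 0
     then SOME f'. f' \<in> Cinf \<and> (\<forall>Y\<in>Sec. B X (f \<odot> Y) - f \<odot> B X Y = f' \<odot> Y) else 0)"

text \<open>
  All fibres are isomorphic to the same vector space, so a nonzero section makes every fibre nonzero.
\<close>

lemma Sec_faithful:
  assumes "\<exists>X\<in>Sec. X \<noteq> 0" "\<And>Y. Y \<in> Sec \<Longrightarrow> f \<odot> Y = g \<odot> Y"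
  shows "f = g"
proof
  fix q
  obtain X p where X: "X \<in> Sec" "X p \<noteq> 0" using assms(1) by (auto simp: fun_eq_iff)
  obtain U \<tau> where U: "(U, \<tau>) \<in> triv" "p \<in> U" using triv_cover by fast
  obtain V \<sigma> where V: "(V, \<sigma>) \<in> triv" "q \<in> V" using triv_cover by fast
  have "\<tau> p (X p) \<noteq> 0"
    using triv_inv_left[OF U SecD[OF X(1)]] triv_inv_left[OF U, of 0] triv_zero[OF U] X(2)
      fibre_subspace[of p] by (metis subspace_0)
  then have "inv_into (E q) (\<sigma> q) (\<tau> p (X p)) \<noteq> 0"
    using triv_inv_right[OF V, of "\<tau> p (X p)"] triv_zero[OF V] by metis
  then obtain Y where "Y \<in> Sec" "Y q \<noteq> 0"
    using section_through[OF triv_inv_in[OF V]] by metis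
  then show "f q = g q"
    using fun_cong[OF assms(2), of Y q] by simp
qed

text \<open>
  Each identity for the anchor says that two functions have the same product with all sections.
  The products are computed by expanding a bracket: of a sum or a product of functions for the
  derivation property, with \<open>\<delta>\<^sub>1(f) \<delta>\<^sub>2(g) B = 0\<close> for function-linearity, and with the Loday identity for
  the homomorphism property.
\<close>

lemma anchored_loday_anchor_of:
  assumes "B \<in> loday_algebroids"
  shows "anchored_loday atlas E triv (anchor_of B) B"
proof -
  let ?\<rho> = "anchor_of B"
  have lb: "loday_bracket B" and deg: "total_degree_le 2 1 (binary B)"
    and ex: "\<And>X f. X \<in> Sec \<Longrightarrow> f \<in> Cinf \<Longrightarrow>
      \<exists>f'\<in>Cinf. \<forall>Y\<in>Sec. B X (f \<odot> Y) - f \<odot> B X Y = f' \<odot> Y"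
    using assms unfolding loday_algebroids_def by blast+
  have BS: "B X Y \<in> Sec" if "X \<in> Sec" "Y \<in> Sec" for X Y
    using lb that unfolding loday_bracket_def by blast
  have jac: "B X (B Y Z) = B (B X Y) Z + B Y (B X Z)" if "X \<in> Sec" "Y \<in> Sec" "Z \<in> Sec" for X Y Z
    using lb that unfolding loday_bracket_def by blast
  have "multilinear_op 2 (binary B)"
    using lb unfolding loday_bracket_def by blast
  then have addL: "B (X + Z) Y = B X Y + B Z Y" and scL: "B ((\<lambda>_. r) \<odot> X) Y = (\<lambda>_. r) \<odot> B X Y"
    and addR: "B X (Y + Z) = B X Y + B X Z" and scR: "B X ((\<lambda>_. r) \<odot> Y) = (\<lambda>_. r) \<odot> B X Y"
    if "X \<in> Sec" "Y \<in> Sec" "Z \<in> Sec" for X Y Z r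
    using that unfolding multilinear_2_iff binary_def by (simp_all add: One_nat_def)
  have "ann 2 (Suc 1) (binary B)" using deg by (simp only: total_degree_le_iff_ann)
  then have d2: "delta i f (delta j g (binary B)) [X, Y] = 0"
    if "i < 2" "j < 2" "f \<in> Cinf" "g \<in> Cinf" "X \<in> Sec" "Y \<in> Sec" for i j f g X Y
    using that by (simp add: One_nat_def args_2_iff)
  have \<rho>: "?\<rho> X f \<in> Cinf \<and> (\<forall>Y\<in>Sec. B X (f \<odot> Y) - f \<odot> B X Y = ?\<rho> X f \<odot> Y)" if "X \<in> Sec" "f \<in> Cinf" for X f
  proof (cases "\<exists>X\<in>Sec. X \<noteq> 0")
    case True
    then have eq: "?\<rho> X f = (SOME f'. f' \<in> Cinf \<and> (\<forall>Y\<in>Sec. B X (f \<odot> Y) - f \<odot> B X Y = f' \<odot> Y))"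
      unfolding anchor_of_def by (simp only: if_True)
    show ?thesis
      unfolding eq using ex[OF that] unfolding Bex_def by (rule someI_ex)
  next
    case False
    then have "Z = 0" if "Z \<in> Sec" for Z using that by blast
    then have "B X (f \<odot> Y) = 0" "B X Y = 0" if "Y \<in> Sec" for Y
      using that \<open>X \<in> Sec\<close> \<open>f \<in> Cinf\<close> by (auto intro: BS Sec_fmult)
    then show ?thesis
      using False Cinf_zero unfolding anchor_of_def by (auto simp: fun_eq_iff)
  qed
  have \<rho>C: "?\<rho> X f \<in> Cinf" if "X \<in> Sec" "f \<in> Cinf" for X f using \<rho>[OF that] by blast
  have fR: "B X (f \<odot> Y) = f \<odot> B X Y + ?\<rho> X f \<odot> Y" if "X \<in> Sec" "Y \<in> Sec" "f \<in> Cinf" for X Y f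
    using \<rho>[OF that(1,3)] that(2) by (metis add.commute diff_add_cancel)
  have \<rho>_eq: "?\<rho> X f = g"
    if "X \<in> Sec" "f \<in> Cinf" "\<not> (\<exists>X\<in>Sec. X \<noteq> 0) \<Longrightarrow> g = 0"
      "\<And>Y. Y \<in> Sec \<Longrightarrow> B X (f \<odot> Y) = f \<odot> B X Y + g \<odot> Y" for X f g
  proof (cases "\<exists>X\<in>Sec. X \<noteq> 0")
    case True
    show ?thesis
    proof (rule Sec_faithful[OF True])
      fix Y assume Y: "Y \<in> Sec"
      show "?\<rho> X f \<odot> Y = g \<odot> Y"
        using that(4)[OF Y] fR[OF that(1) Y that(2)] by simp
    qed
  next
    case False
    then show ?thesis using that(3) unfolding anchor_of_def by simp
  qed
  have \<rho>0: "?\<rho> X f = 0" if "\<not> (\<exists>X\<in>Sec. X \<noteq> 0)" for X f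
    using that unfolding anchor_of_def by simp
  have anchor: "is_anchor ?\<rho>"
    unfolding is_anchor_def
  proof (intro conjI ballI allI)
    fix X assume X: "X \<in> Sec"
    {
      fix f assume f: "f \<in> Cinf"
      show "?\<rho> X f \<in> Cinf" by (rule \<rho>C[OF X f])
      fix g assume g: "g \<in> Cinf"
      show "?\<rho> X (f + g) = ?\<rho> X f + ?\<rho> X g"
      proof (rule \<rho>_eq[OF X Cinf_add[OF f g]])
        fix Y assume Y: "Y \<in> Sec"
        have "(f + g) \<odot> Y = f \<odot> Y + g \<odot> Y" by (auto simp: fun_eq_iff algebra_simps)
        then have "B X ((f + g) \<odot> Y) = B X (f \<odot> Y) + B X (g \<odot> Y)"
          using addR[OF X Sec_fmult[OF f Y] Sec_fmult[OF g Y]] by (simp only:)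
        then show "B X ((f + g) \<odot> Y) = (f + g) \<odot> B X Y + (?\<rho> X f + ?\<rho> X g) \<odot> Y"
          unfolding fR[OF X Y f] fR[OF X Y g] by (auto simp: fun_eq_iff algebra_simps)
      qed (simp add: \<rho>0)
      show "?\<rho> X (f \<odot> g) = f \<odot> ?\<rho> X g + ?\<rho> X f \<odot> g"
      proof (rule \<rho>_eq[OF X Cinf_fmult[OF f g]])
        fix Y assume Y: "Y \<in> Sec"
        have "(f \<odot> g) \<odot> Y = f \<odot> g \<odot> Y" by (auto simp: fun_eq_iff)
        then show "B X ((f \<odot> g) \<odot> Y) = (f \<odot> g) \<odot> B X Y + (f \<odot> ?\<rho> X g + ?\<rho> X f \<odot> g) \<odot> Y"
          using fR[OF X Sec_fmult[OF g Y] f] unfolding fR[OF X Y g]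
          by (simp only:) (auto simp: fun_eq_iff algebra_simps)
      next
        assume z: "\<not> (\<exists>X\<in>Sec. X \<noteq> 0)"
        show "f \<odot> ?\<rho> X g + ?\<rho> X f \<odot> g = 0" unfolding \<rho>0[OF z] by (auto simp: fun_eq_iff)
      qed
      show "?\<rho> (f \<odot> X) g = f \<odot> ?\<rho> X g"
      proof (rule \<rho>_eq[OF Sec_fmult[OF f X] g])
        fix Y assume Y: "Y \<in> Sec"
        have "delta 0 f (delta 1 g (binary B)) [X, Y] = 0"
          by (rule d2[OF _ _ f g X Y]) simp_all
        then have "B (f \<odot> X) (g \<odot> Y) - g \<odot> B (f \<odot> X) Y - f \<odot> (B X (g \<odot> Y) - g \<odot> B X Y) = 0"
          by (simp add: delta_def binary_def One_nat_def)
        then show "B (f \<odot> X) (g \<odot> Y) = g \<odot> B (f \<odot> X) Y + (f \<odot> ?\<rho> X g) \<odot> Y"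
          unfolding fR[OF X Y g] by (auto simp: fun_eq_iff algebra_simps)
      next
        assume z: "\<not> (\<exists>X\<in>Sec. X \<noteq> 0)"
        show "f \<odot> ?\<rho> X g = 0" unfolding \<rho>0[OF z] by (auto simp: fun_eq_iff)
      qed
    }
    show "?\<rho> (X + Y) f = ?\<rho> X f + ?\<rho> Y f" if Y: "Y \<in> Sec" and f: "f \<in> Cinf" for Y f
    proof (rule \<rho>_eq[OF Sec_add[OF X Y] f])
      fix Z assume Z: "Z \<in> Sec"
      show "B (X + Y) (f \<odot> Z) = f \<odot> B (X + Y) Z + (?\<rho> X f + ?\<rho> Y f) \<odot> Z"
        unfolding addL[OF X Sec_fmult[OF f Z] Y] addL[OF X Z Y] fR[OF X Z f] fR[OF Y Z f]
        by (auto simp: fun_eq_iff algebra_simps)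
    qed (simp add: \<rho>0)
    show "?\<rho> X (\<lambda>_. r) = 0" for r
      by (rule \<rho>_eq[OF X Cinf_const]) (auto simp: scR[OF X _ X] fun_eq_iff)
  qed
  show ?thesis
  proof unfold_locales
    show "is_anchor ?\<rho>" by (rule anchor)
    fix X Y assume X: "X \<in> Sec" and Y: "Y \<in> Sec"
    show "B X Y \<in> Sec" by (rule BS[OF X Y])
    show "B ((\<lambda>_. r) \<odot> X) Y = (\<lambda>_. r) \<odot> B X Y" for r by (rule scL[OF X Y Y])
    {
      fix Z assume Z: "Z \<in> Sec"
      show "B (X + Y) Z = B X Z + B Y Z" by (rule addL[OF X Z Y])
      show "B X (Y + Z) = B X Y + B X Z" by (rule addR[OF X Y Z])
      show "B X (B Y Z) = B (B X Y) Z + B Y (B X Z)" by (rule jac[OF X Y Z])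
    }
    fix f assume f: "f \<in> Cinf"
    show "B X (f \<odot> Y) = f \<odot> B X Y + ?\<rho> X f \<odot> Y" by (rule fR[OF X Y f])
    show "B (f \<odot> g \<odot> X) Y = f \<odot> B (g \<odot> X) Y + g \<odot> B (f \<odot> X) Y - f \<odot> g \<odot> B X Y" if g: "g \<in> Cinf" for g
    proof -
      have "delta 0 g (delta 0 f (binary B)) [X, Y] = 0"
        by (rule d2[OF _ _ g f X Y]) simp_all
      then have "B (f \<odot> g \<odot> X) Y - f \<odot> B (g \<odot> X) Y - g \<odot> (B (f \<odot> X) Y - f \<odot> B X Y) = 0"
        by (simp add: delta_def binary_def One_nat_def)
      then show ?thesis by (auto simp: fun_eq_iff algebra_simps)
    qed
    show "?\<rho> (B X Y) f = ?\<rho> X (?\<rho> Y f) - ?\<rho> Y (?\<rho> X f)"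
    proof (rule \<rho>_eq[OF BS[OF X Y] f])
      fix Z assume Z: "Z \<in> Sec"
      have br: "B (B X Y) W = B X (B Y W) - B Y (B X W)" if "W \<in> Sec" for W
        using jac[OF X Y that] by simp
      have two: "B U (B V (f \<odot> Z)) = (f \<odot> B U (B V Z) + ?\<rho> U f \<odot> B V Z) +
          (?\<rho> V f \<odot> B U Z + ?\<rho> U (?\<rho> V f) \<odot> Z)" if "U \<in> Sec" "V \<in> Sec" for U V
        unfolding fR[OF that(2) Z f] using that Z f
        by (simp only: addR Sec_fmult BS \<rho>C fR)
      show "B (B X Y) (f \<odot> Z) = f \<odot> B (B X Y) Z + (?\<rho> X (?\<rho> Y f) - ?\<rho> Y (?\<rho> X f)) \<odot> Z"
        unfolding br[OF Sec_fmult[OF f Z]] br[OF Z] two[OF X Y] two[OF Y X]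
        by (auto simp: fun_eq_iff algebra_simps)
    next
      assume z: "\<not> (\<exists>X\<in>Sec. X \<noteq> 0)"
      show "?\<rho> X (?\<rho> Y f) - ?\<rho> Y (?\<rho> X f) = 0" unfolding \<rho>0[OF z] by simp
    qed
  qed
qed

proposition loday_algebroid_is_bracket:
  assumes "B \<in> loday_algebroids"
  obtains d where "d \<in> homological_vector_fields" "bracket d = B"
proof -
  interpret anchored_loday atlas E triv "anchor_of B" B
    by (rule anchored_loday_anchor_of[OF assms])
  have "bracket differential = B"
  proof (intro ext)
    fix X Y p
    show "bracket differential X Y p = B X Y p"
    proof (cases "X \<in> Sec \<and> Y \<in> Sec")
      case True
      then show ?thesis using bracket_differential by simp
    next
      case False
      moreover from False have "B X Y = 0"
        using assms unfolding loday_algebroids_def loday_bracket_def by blast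
      ultimately show ?thesis by (auto simp: bracket_def)
    qed
  qed
  with differential_homological show thesis by (rule that)
qed

end

section \<open>The correspondence\<close>

theorem theorem4p8p6:
  fixes atlas :: "('m::{t2_space, second_countable_topology} set \<times> ('m \<Rightarrow> 'b::real_inner)) set"
    and E :: "'m \<Rightarrow> 'f::real_vector set"
    and triv :: "('m set \<times> ('m \<Rightarrow> 'f \<Rightarrow> 'r::real_inner)) set"
  assumes "vector_bundle atlas E triv"
  shows "\<exists>\<Phi>. bij_betw \<Phi>
             (vector_bundle.homological_vector_fields atlas E triv //
                vector_bundle.hvf_equiv atlas E triv)
             (vector_bundle.loday_algebroids atlas E triv) \<and>
           (\<forall>d\<in>vector_bundle.homological_vector_fields atlas E triv.
              \<Phi> (vector_bundle.hvf_equiv atlas E triv `` {d}) =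
                vector_bundle.bracket atlas E triv d)"
proof -
  interpret vector_bundle atlas E triv by (rule assms)
  \<comment> \<open>Equivalent vector fields have the same bracket, so any representative may be taken.\<close>
  define \<Phi> where "\<Phi> C = bracket (SOME d. d \<in> C)" for C
  have \<Phi>: "\<Phi> (hvf_equiv `` {d}) = bracket d" if d: "d \<in> homological_vector_fields" for d
  proof -
    have "d \<in> hvf_equiv `` {d}"
      using hvf_equiv_iff_bracket_eq[OF d d] by simp
    then have "(SOME e. e \<in> hvf_equiv `` {d}) \<in> hvf_equiv `` {d}"
      by (rule someI[where P = "\<lambda>e. e \<in> hvf_equiv `` {d}"])
    then have e: "(d, SOME e. e \<in> hvf_equiv `` {d}) \<in> hvf_equiv" by simp
    then have "(SOME e. e \<in> hvf_equiv `` {d}) \<in> homological_vector_fields"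
      unfolding hvf_equiv_def by blast
    then show ?thesis
      using hvf_equiv_iff_bracket_eq[OF d] e unfolding \<Phi>_def by simp
  qed
  have class_eq: "hvf_equiv `` {d} = hvf_equiv `` {e}"
    if "d \<in> homological_vector_fields" "e \<in> homological_vector_fields" "bracket d = bracket e" for d e
  proof -
    have "x \<in> hvf_equiv `` {d} \<longleftrightarrow> x \<in> homological_vector_fields \<and> bracket d = bracket x"
      if d: "d \<in> homological_vector_fields" for d x
    proof (cases "x \<in> homological_vector_fields")
      case True
      then show ?thesis using hvf_equiv_iff_bracket_eq[OF d True] by simp
    next
      case False
      then show ?thesis by (auto simp: hvf_equiv_def)
    qed
    then show ?thesis using that by auto
  qed
  have "inj_on \<Phi> (homological_vector_fields // hvf_equiv)"
  proof (rule inj_onI, elim quotientE)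
    fix C C' d e
    assume de: "d \<in> homological_vector_fields" "e \<in> homological_vector_fields"
      and C: "C = hvf_equiv `` {d}" "C' = hvf_equiv `` {e}" and eq: "\<Phi> C = \<Phi> C'"
    have "bracket d = bracket e"
      using eq unfolding C \<Phi>[OF de(1)] \<Phi>[OF de(2)] .
    then show "C = C'"
      unfolding C by (rule class_eq[OF de])
  qed
  moreover have "\<Phi> ` (homological_vector_fields // hvf_equiv) = loday_algebroids"
  proof (intro equalityI subsetI)
    fix B assume "B \<in> \<Phi> ` (homological_vector_fields // hvf_equiv)"
    then obtain d where "d \<in> homological_vector_fields" "B = \<Phi> (hvf_equiv `` {d})"
      by (elim imageE quotientE) simp
    then show "B \<in> loday_algebroids"
      using bracket_loday_algebroid \<Phi> by (simp only:)
  next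
    fix B assume "B \<in> loday_algebroids"
    then obtain d where "d \<in> homological_vector_fields" "bracket d = B"
      by (rule loday_algebroid_is_bracket)
    then show "B \<in> \<Phi> ` (homological_vector_fields // hvf_equiv)"
      using \<Phi>[of d] quotientI[of d homological_vector_fields hvf_equiv]
        image_eqI[of B \<Phi> "hvf_equiv `` {d}"] by (simp only:)
  qed
  ultimately have "bij_betw \<Phi> (homological_vector_fields // hvf_equiv) loday_algebroids"
    by (rule bij_betw_imageI)
  then show ?thesis
    by (intro exI[of _ \<Phi>] conjI ballI \<Phi>)
qed

end
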